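(* Let $\mathfrak{F}:\mathbb{P}^{n-1}\dashrightarrow\mathbb{P}^{m-1}$ be a rational map defined by forms $f_0,\ldots,f_{m-1}\in R=k[x_0,\ldots,x_{n-1}]$ of degree $d$. Let $$g:=g_{\ell}x_n^{d-\ell}+g_{\ell+1}x_n^{d-\ell-1}+\cdots+g_{d-1}x_n+g_d\in R[x_n]$$ be a form of degree $d$, where $g_j\in R$ for $\ell\le j\le d$, and $\deg_{x_n}(g)=d-\ell$ with $\ell\le d-1$. If $\mathfrak{F}$ is birational onto its image, then the rational map $\mathfrak{G}:\mathbb{P}^n\dashrightarrow\mathbb{P}^m$ defined by the forms $\{f_0,\ldots,f_{m-1},g\}\subset R[x_n]$ has topological (i.e., field) degree at most $d-\ell$. In particular, if $\ell=d-1$ then $\mathfrak{G}$ is birational onto its image. Supplement. Suppose that $\deg_{x_n}(g)=1$, so $g=g_{d-1}x_n+g_d$, with $g_d\in I:=(f_0,\ldots,f_{m-1})$ (possibly $g_d=0$). (1) If $g_{d-1}$ avoids all minimal primes of $R/I$ of minimal codimension, then the codimension of $R[x_n]/(I,g)$ is one larger than that of $R/I$. (2) If $g_{d-1}$ is a nonzerodivisor on $R/I$ and $R/I$ is Cohen--Macaulay, then $R[x_n]/(I,g)$ is Cohen--Macaulay.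
   Context: $k$ is an infinite field and $x_n$ is a new variable over $R$. For forms $h_0,\ldots,h_s$ of the same degree $e\ge1$ in $k[x_0,\ldots,x_r]$, the topological (field) degree of the rational map $(h_0:\cdots:h_s):\mathbb{P}^r\dashrightarrow\mathbb{P}^s$ is the degree of the field extension $k(h_0,\ldots,h_s)\subset k(\mathbf{x}_e)$, where $\mathbf{x}_e$ is the set of all monomials of degree $e$ in $x_0,\ldots,x_r$; the map is birational onto its image iff this extension is an equality. The codimension of $R/I$ (resp. of $R[x_n]/(I,g)$) is the height of the ideal $I$ (resp. $(I,g)$). *)

theory Defs
  imports
    "HOL-Algebra.Algebra"
    "HOL-Algebra.Algebraic_Closure_Type"
    "HOL-Library.Poly_Mapping"
    "HOL-Library.Extended_Nat"
    "HOL-Computational_Algebra.Fraction_Field"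
begin

section \<open>Polynomials and forms\<close>

text \<open>
  All polynomials live in \<open>k[x\<^sub>0, x\<^sub>1, \<dots>]\<close> (exponent vectors mapped to coefficients), which is an
  integral domain as a type; \<open>k[x\<^sub>0, \<dots>, x\<^sub>n\<^sub>-\<^sub>1]\<close> is the subring of the polynomials involving only
  the variables with index below \<open>n\<close>.  In this way \<open>R \<subseteq> R[x\<^sub>n]\<close> is a literal inclusion.
\<close>

type_synonym 'a mpoly = "(nat \<Rightarrow>\<^sub>0 nat) \<Rightarrow>\<^sub>0 'a"

definition Const :: "'a::field \<Rightarrow> 'a mpoly" where
  "Const c = Poly_Mapping.single 0 c"

definition Mon :: "(nat \<Rightarrow>\<^sub>0 nat) \<Rightarrow> 'a::field mpoly" where
  "Mon t = Poly_Mapping.single t 1"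

definition Var :: "nat \<Rightarrow> 'a::field mpoly" where
  "Var i = Mon (Poly_Mapping.single i 1)"

definition vars :: "'a::field mpoly \<Rightarrow> nat set" where
  "vars p = (\<Union>t\<in>Poly_Mapping.keys p. Poly_Mapping.keys t)"

definition monom_degree :: "(nat \<Rightarrow>\<^sub>0 nat) \<Rightarrow> nat" where
  "monom_degree t = (\<Sum>i\<in>Poly_Mapping.keys t. Poly_Mapping.lookup t i)"

text \<open>The zero polynomial counts as a form of every degree.\<close>

definition homogeneous :: "nat \<Rightarrow> 'a::field mpoly \<Rightarrow> bool" where
  "homogeneous e p \<longleftrightarrow> (\<forall>t\<in>Poly_Mapping.keys p. monom_degree t = e)"

text \<open>Degree in the single variable \<open>x\<^sub>i\<close>, with value 0 on the zero polynomial.\<close>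

definition degree_in :: "nat \<Rightarrow> 'a::field mpoly \<Rightarrow> nat" where
  "degree_in i p = Max (insert 0 ((\<lambda>t. Poly_Mapping.lookup t i) ` Poly_Mapping.keys p))"

definition mpoly_ring :: "nat \<Rightarrow> 'a::field mpoly ring" where
  "mpoly_ring n = ring_of_type_algebra\<lparr>carrier := {p. vars p \<subseteq> {..<n}}\<rparr>"


section \<open>Degree of a rational map\<close>

text \<open>
  Fields of rational functions are taken inside the fraction field of \<open>k[x\<^sub>0, x\<^sub>1, \<dots>]\<close>; the
  subfield \<open>k(H)\<close> for a set \<open>H\<close> of polynomials does not depend on the number of variables of the
  surrounding field.
\<close>

abbreviation frac_field :: "'a::field mpoly fract ring" where
  "frac_field \<equiv> ring_of_type_algebra"

definition field_adjoin :: "'a::field mpoly set \<Rightarrow> 'a mpoly fract set" where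
  "field_adjoin H = generate_field frac_field ((\<lambda>p. Fract p 1) ` (range Const \<union> H))"

definition monomials :: "nat \<Rightarrow> nat \<Rightarrow> 'a::field mpoly set" where
  "monomials r e = {Mon t | t. Poly_Mapping.keys t \<subseteq> {..<r} \<and> monom_degree t = e}"

definition extension_degree :: "('b, 'c) ring_scheme \<Rightarrow> 'b set \<Rightarrow> 'b set \<Rightarrow> enat" where
  "extension_degree F K L =
     (if ring.finite_dimension F K L then enat (ring.dim F K L) else \<infinity>)"

text \<open>
  The set \<open>H\<close> consists of the coordinates of a rational map from \<open>\<P>\<^sup>r\<^sup>-\<^sup>1\<close>: forms of one common
  positive degree \<open>e\<close> in \<open>r\<close> variables, not all of them zero.
\<close>

definition defines_rational_map :: "nat \<Rightarrow> nat \<Rightarrow> 'a::field mpoly set \<Rightarrow> bool" where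
  "defines_rational_map r e H \<longleftrightarrow>
     r \<ge> 1 \<and> e \<ge> 1 \<and> finite H \<and> H \<subseteq> carrier (mpoly_ring r) \<and>
     (\<forall>h\<in>H. homogeneous e h) \<and> (\<exists>h\<in>H. h \<noteq> 0)"

definition topological_degree :: "nat \<Rightarrow> nat \<Rightarrow> 'a::field mpoly set \<Rightarrow> enat" where
  "topological_degree r e H =
     extension_degree frac_field (field_adjoin H) (field_adjoin (monomials r e))"

definition birational_onto_image :: "nat \<Rightarrow> nat \<Rightarrow> 'a::field mpoly set \<Rightarrow> bool" where
  "birational_onto_image r e H \<longleftrightarrow> field_adjoin H = field_adjoin (monomials r e)"


section \<open>Height, regular sequences and Cohen--Macaulay rings\<close>

definition prime_height :: "('b, 'c) ring_scheme \<Rightarrow> 'b set \<Rightarrow> enat" where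
  "prime_height S P =
     Sup {enat r | r. \<exists>Q. (\<forall>i\<le>r. primeideal (Q i) S) \<and> (\<forall>i<r. Q i \<subset> Q (Suc i)) \<and> Q r = P}"

definition ideal_height :: "('b, 'c) ring_scheme \<Rightarrow> 'b set \<Rightarrow> enat" where
  "ideal_height S I = (INF P\<in>{P. primeideal P S \<and> I \<subseteq> P}. prime_height S P)"

text \<open>The minimal primes of the quotient of \<open>S\<close> by \<open>I\<close>, as prime ideals of \<open>S\<close>.\<close>

definition minimal_primes :: "('b, 'c) ring_scheme \<Rightarrow> 'b set \<Rightarrow> 'b set set" where
  "minimal_primes S I =
     {P. primeideal P S \<and> I \<subseteq> P \<and> (\<forall>Q. primeideal Q S \<and> I \<subseteq> Q \<and> Q \<subseteq> P \<longrightarrow> Q = P)}"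

definition minimal_primes_min_codim :: "('b, 'c) ring_scheme \<Rightarrow> 'b set \<Rightarrow> 'b set set" where
  "minimal_primes_min_codim S I =
     {P \<in> minimal_primes S I. \<forall>Q\<in>minimal_primes S I. prime_height S P \<le> prime_height S Q}"

definition nonzerodivisor :: "('b, 'c) ring_scheme \<Rightarrow> 'b \<Rightarrow> bool" where
  "nonzerodivisor S a \<longleftrightarrow>
     a \<in> carrier S \<and> (\<forall>b\<in>carrier S. a \<otimes>\<^bsub>S\<^esub> b = \<zero>\<^bsub>S\<^esub> \<longrightarrow> b = \<zero>\<^bsub>S\<^esub>)"

definition nonzerodivisor_on_quotient :: "('b, 'c) ring_scheme \<Rightarrow> 'b set \<Rightarrow> 'b \<Rightarrow> bool" where
  "nonzerodivisor_on_quotient S I a \<longleftrightarrow> nonzerodivisor (S Quot I) (I +>\<^bsub>S\<^esub> a)"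

definition regular_sequence :: "('b, 'c) ring_scheme \<Rightarrow> 'b list \<Rightarrow> bool" where
  "regular_sequence S as \<longleftrightarrow>
     set as \<subseteq> carrier S \<and>
     (\<forall>i<length as. nonzerodivisor_on_quotient S (genideal S (set (take i as))) (as ! i)) \<and>
     genideal S (set as) \<noteq> carrier S"

definition ideal_depth :: "('b, 'c) ring_scheme \<Rightarrow> 'b set \<Rightarrow> enat" where
  "ideal_depth S I = Sup {enat (length as) | as. regular_sequence S as \<and> set as \<subseteq> I}"

text \<open>
  The definition of Eisenbud, \<open>Commutative Algebra with a View Toward Algebraic Geometry\<close>,
  Section 18.2: depth and codimension agree at every maximal ideal.
\<close>

definition cohen_macaulay :: "('b, 'c) ring_scheme \<Rightarrow> bool" where
  "cohen_macaulay S \<longleftrightarrow>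
     cring S \<and> noetherian_ring S \<and> (\<forall>P. maximalideal P S \<longrightarrow> ideal_depth S P = ideal_height S P)"

end

theory Submission
  imports Defs
begin

text \<open>
  Write \<open>R = k[x\<^sub>0, \<dots>, x\<^sub>n\<^sub>-\<^sub>1]\<close>, let \<open>I\<close> be the ideal of the forms \<open>f\<^sub>i\<close>, and let \<open>J = (I, g)\<close> in \<open>R[x\<^sub>n]\<close>.

  \<^emph>\<open>Field degree.\<close> If the \<open>f\<^sub>i\<close> define a birational map, then \<open>K = k(f, g)\<close> contains every quotient
  \<open>p / x\<^sub>0\<^sup>j\<close> with \<open>p\<close> a form of degree \<open>j \<le> d\<close> in \<open>R\<close>. Dividing \<open>g = \<Sum> g\<^sub>j x\<^sub>n\<^sup>d\<^sup>-\<^sup>j\<close> by \<open>x\<^sub>0\<^sup>d\<close> exhibits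
  \<open>t = x\<^sub>n / x\<^sub>0\<close> as a root of a polynomial of degree \<open>d - l\<close> over \<open>K\<close>, and the field generated by all
  monomials of degree \<open>d\<close> is \<open>K(t)\<close> (\<open>topological_degree_le\<close>, \<open>birational_if_linear\<close>).

  \<^emph>\<open>Height.\<close> Let \<open>g = a x\<^sub>n + c\<close> with \<open>c \<in> I\<close>. A prime over \<open>J\<close> contains \<open>I\<close> and one of \<open>x\<^sub>n\<close>, \<open>a\<close>. In the
  first case its height exceeds that of its contraction to \<open>R\<close>; in the second the contraction
  strictly contains a minimal prime of \<open>I\<close> of minimal height, or contains one of larger height.
  Conversely, if \<open>q\<close> is a prime over \<open>I\<close> of least height, the prime \<open>(q, x\<^sub>n)\<close> contains \<open>J\<close>, and its
  height is at most one more than the height of \<open>q\<close> (\<open>height_linear_form\<close>).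

  That last inequality is where Noetherianity enters. By Krull's principal ideal theorem, the
  members of a chain of primes whose last term contains an element \<open>u\<close> can be replaced so that all
  but the first contain \<open>u\<close> (\<open>prime_chain_slide\<close>). For \<open>u\<close> a monic polynomial in \<open>x\<^sub>n\<close>, two primes
  \<open>Q \<subset> Q'\<close> containing \<open>u\<close> have different contractions (\<open>incomparability\<close>), so the remaining chain
  contracts to a chain of the same length in \<open>R\<close> (\<open>prime_chain_contract\<close>).

  \<^emph>\<open>Cohen--Macaulay property.\<close> Let \<open>M\<close> be a maximal ideal over \<open>J\<close>. Polynomial rings over fields are
  Jacobson rings, so \<open>m = M \<inter> R\<close> is maximal and \<open>M\<close> contains a monic polynomial \<open>u\<close>
  (\<open>maximal_polys\<close>). Let \<open>r\<close> be the length of a chain of primes over \<open>J\<close> ending in \<open>M\<close>. As \<open>g\<close> is a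
  nonzerodivisor modulo \<open>I\<close>, it lies in no minimal prime of \<open>I\<close>, and the chain can be prolonged
  below by a prime over \<open>I\<close>; sliding along \<open>u\<close> and contracting then gives a chain of length \<open>r\<close> over
  \<open>I\<close> ending in \<open>m\<close>. Since \<open>R/I\<close> is Cohen--Macaulay, \<open>m\<close> contains a regular sequence of length \<open>r\<close>
  modulo \<open>I\<close>; appending \<open>u\<close> gives one of length \<open>r + 1\<close> in \<open>M\<close>, and exchanging one member for \<open>g\<close>
  (\<open>has_regseq_exchange\<close>) leaves a regular sequence of length \<open>r\<close> modulo \<open>J\<close>. The opposite
  inequality between depth and height holds in every Noetherian ring.

  The commutative algebra is developed for subrings \<open>C\<close> of the universe of a ring type, with primes
  and ideals as subsets of \<open>C\<close>; this makes \<open>R \<subseteq> R[x\<^sub>n]\<close> an inclusion of sets. A surjective homomorphism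
  from \<open>C\<close> to an abstract ring (the locale \<open>ring_presentation\<close>) carries the results to the quotients
  \<open>R/I\<close> and \<open>R[x\<^sub>n]/J\<close>, whose primes are the primes of \<open>C\<close> over the kernel.
\<close>

section \<open>Ideals and primes of a subring\<close>

text \<open>
  Univariate polynomials here are those of type \<open>'r poly\<close>, not the coefficient lists of abstract rings.
\<close>

alias coeff = Polynomial.coeff
alias degree = Polynomial.degree
alias monom = Polynomial.monom
alias keys = Poly_Mapping.keys
alias lookup = Poly_Mapping.lookup
alias single = Poly_Mapping.single

definition ideal_in :: "'r::comm_ring_1 set \<Rightarrow> 'r set \<Rightarrow> bool" where
  "ideal_in C I \<longleftrightarrow> I \<subseteq> C \<and> 0 \<in> I \<and> (\<forall>a\<in>I. \<forall>b\<in>I. a + b \<in> I) \<and> (\<forall>c\<in>C. \<forall>a\<in>I. c * a \<in> I)"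

definition prime_in :: "'r::comm_ring_1 set \<Rightarrow> 'r set \<Rightarrow> bool" where
  "prime_in C P \<longleftrightarrow> ideal_in C P \<and> 1 \<notin> P \<and> (\<forall>a\<in>C. \<forall>b\<in>C. a * b \<in> P \<longrightarrow> a \<in> P \<or> b \<in> P)"

definition maximal_in :: "'r::comm_ring_1 set \<Rightarrow> 'r set \<Rightarrow> bool" where
  "maximal_in C M \<longleftrightarrow> ideal_in C M \<and> 1 \<notin> M \<and> (\<forall>I. ideal_in C I \<longrightarrow> M \<subseteq> I \<longrightarrow> 1 \<notin> I \<longrightarrow> I = M)"

text \<open>
  The maximal condition, because the arguments below pick maximal members of families of ideals;
  \<open>noetherian_ring_image\<close> recovers finite generation.
\<close>

definition noetherian :: "'r::comm_ring_1 set \<Rightarrow> bool" where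
  "noetherian C \<longleftrightarrow> (\<forall>\<F>. \<F> \<noteq> {} \<longrightarrow> (\<forall>I\<in>\<F>. ideal_in C I) \<longrightarrow> (\<exists>M\<in>\<F>. \<forall>I\<in>\<F>. M \<subseteq> I \<longrightarrow> I = M))"

definition generated :: "'r::comm_ring_1 set \<Rightarrow> 'r set \<Rightarrow> 'r set" where
  "generated C W = Inter {I. ideal_in C I \<and> W \<subseteq> I}"

definition plus_gen :: "'r::comm_ring_1 set \<Rightarrow> 'r set \<Rightarrow> 'r \<Rightarrow> 'r set" where
  "plus_gen C K a = {k + c * a | k c. k \<in> K \<and> c \<in> C}"

definition colon :: "'r::comm_ring_1 set \<Rightarrow> 'r set \<Rightarrow> 'r \<Rightarrow> 'r set" where
  "colon C K z = {c \<in> C. c * z \<in> K}"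

definition nzd_mod :: "'r::comm_ring_1 set \<Rightarrow> 'r set \<Rightarrow> 'r \<Rightarrow> bool" where
  "nzd_mod C K a \<longleftrightarrow> (\<forall>b\<in>C. a * b \<in> K \<longrightarrow> b \<in> K)"

text \<open>
  Only the last prime of a chain and a lower bound for all its members matter, which makes
  recursion on the length more convenient than sequences of primes.
\<close>

primrec prime_chain :: "'r::comm_ring_1 set \<Rightarrow> 'r set \<Rightarrow> nat \<Rightarrow> 'r set \<Rightarrow> bool" where
  "prime_chain C K 0 P \<longleftrightarrow> prime_in C P \<and> K \<subseteq> P"
| "prime_chain C K (Suc r) P \<longleftrightarrow> prime_in C P \<and> (\<exists>Q. prime_chain C K r Q \<and> Q \<subset> P)"

locale comm_subring =
  fixes C :: "'r::comm_ring_1 set"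
  assumes one_in: "1 \<in> C"
    and diff_in: "a \<in> C \<Longrightarrow> b \<in> C \<Longrightarrow> a - b \<in> C"
    and mult_in: "a \<in> C \<Longrightarrow> b \<in> C \<Longrightarrow> a * b \<in> C"
begin

lemma zero_in: "0 \<in> C" using diff_in[OF one_in one_in] by simp
lemma uminus_in: "a \<in> C \<Longrightarrow> - a \<in> C" using diff_in[OF zero_in, of a] by simp
lemma add_in: "a \<in> C \<Longrightarrow> b \<in> C \<Longrightarrow> a + b \<in> C" using diff_in[of a "- b"] uminus_in by simp
lemma power_in: "a \<in> C \<Longrightarrow> a ^ n \<in> C" by (induction n) (auto intro: one_in mult_in)
lemma sum_in: "(\<And>i. i \<in> W \<Longrightarrow> f i \<in> C) \<Longrightarrow> sum f W \<in> C"
  by (induction W rule: infinite_finite_induct) (auto intro: zero_in add_in)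

lemmas in_C = one_in zero_in uminus_in diff_in add_in mult_in power_in sum_in

lemma idealD:
  assumes "ideal_in C I"
  shows ideal_sub: "a \<in> I \<Longrightarrow> a \<in> C" and ideal_zero: "0 \<in> I"
    and ideal_add: "a \<in> I \<Longrightarrow> b \<in> I \<Longrightarrow> a + b \<in> I"
    and ideal_mult: "c \<in> C \<Longrightarrow> a \<in> I \<Longrightarrow> c * a \<in> I"
    and ideal_mult2: "c \<in> C \<Longrightarrow> a \<in> I \<Longrightarrow> a * c \<in> I"
  using assms by (auto simp: ideal_in_def mult.commute)

lemma ideal_uminus: "ideal_in C I \<Longrightarrow> a \<in> I \<Longrightarrow> - a \<in> I"
  using ideal_mult[of I "-1" a] uminus_in[OF one_in] by simp
lemma ideal_diff: "ideal_in C I \<Longrightarrow> a \<in> I \<Longrightarrow> b \<in> I \<Longrightarrow> a - b \<in> I"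
  using ideal_add[of I a "-b"] ideal_uminus by simp
lemma ideal_sum: "ideal_in C I \<Longrightarrow> (\<And>i. i \<in> W \<Longrightarrow> f i \<in> I) \<Longrightarrow> sum f W \<in> I"
  by (induction W rule: infinite_finite_induct) (auto intro: ideal_zero ideal_add)
lemma ideal_add_cancel: "ideal_in C I \<Longrightarrow> a + b \<in> I \<Longrightarrow> a \<in> I \<Longrightarrow> b \<in> I"
  using ideal_diff[of I "a + b" a] by simp
lemma ideal_diff_cancel: "ideal_in C I \<Longrightarrow> a - b \<in> I \<Longrightarrow> b \<in> I \<Longrightarrow> a \<in> I"
  using ideal_add[of I "a - b" b] by simp

lemma ideal_UNIV: "ideal_in C C" by (auto simp: ideal_in_def intro: in_C)
lemma ideal_one: "ideal_in C I \<Longrightarrow> 1 \<in> I \<Longrightarrow> I = C"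
  by (metis ideal_mult ideal_sub mult.right_neutral subsetI subset_antisym)

lemma primeD:
  assumes "prime_in C P"
  shows prime_ideal: "ideal_in C P" and prime_one: "1 \<notin> P"
    and prime_cases: "a \<in> C \<Longrightarrow> b \<in> C \<Longrightarrow> a * b \<in> P \<Longrightarrow> a \<in> P \<or> b \<in> P"
  using assms by (auto simp: prime_in_def)

lemma prime_power: "prime_in C P \<Longrightarrow> a \<in> C \<Longrightarrow> a ^ n \<in> P \<Longrightarrow> a \<in> P"
  by (induction n) (auto simp: prime_one dest: prime_cases[rotated 3] intro: power_in)

lemma ideal_generated: "W \<subseteq> C \<Longrightarrow> ideal_in C (generated C W)"
  using ideal_UNIV by (auto simp: ideal_in_def generated_def)
lemma generated_incl: "W \<subseteq> generated C W" by (auto simp: generated_def)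
lemma generated_least: "ideal_in C I \<Longrightarrow> W \<subseteq> I \<Longrightarrow> generated C W \<subseteq> I" by (auto simp: generated_def)

lemma ideal_plus_gen:
  assumes "ideal_in C K" "a \<in> C" shows "ideal_in C (plus_gen C K a)"
proof -
  have "0 \<in> plus_gen C K a" unfolding plus_gen_def using ideal_zero[OF assms(1)] zero_in by force
  moreover have "x + y \<in> plus_gen C K a" if xy: "x \<in> plus_gen C K a" "y \<in> plus_gen C K a" for x y
  proof -
    obtain k c k' c' where "x = k + c * a" "y = k' + c' * a" "k \<in> K" "k' \<in> K" "c \<in> C" "c' \<in> C"
      using xy by (auto simp: plus_gen_def)
    then have "x + y = (k + k') + (c + c') * a" "k + k' \<in> K" "c + c' \<in> C"
      using ideal_add[OF assms(1)] by (auto simp: algebra_simps intro: in_C)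
    then show ?thesis unfolding plus_gen_def by blast
  qed
  moreover have "r * x \<in> plus_gen C K a" if rx: "r \<in> C" "x \<in> plus_gen C K a" for r x
  proof -
    obtain k c where "x = k + c * a" "k \<in> K" "c \<in> C" using rx by (auto simp: plus_gen_def)
    then have "r * x = r * k + (r * c) * a" "r * k \<in> K" "r * c \<in> C"
      using ideal_mult[OF assms(1)] rx(1) by (simp_all add: distrib_left mult.assoc mult_in)
    then show ?thesis unfolding plus_gen_def by blast
  qed
  moreover have "plus_gen C K a \<subseteq> C"
    using assms ideal_sub[OF assms(1)] by (auto simp: plus_gen_def intro!: in_C)
  ultimately show ?thesis by (auto simp: ideal_in_def)
qed

lemma plus_gen_incl: "K \<subseteq> plus_gen C K a"
proof
  fix x assume "x \<in> K"
  then have "x = x + 0 * a \<and> x \<in> K \<and> 0 \<in> C" using zero_in by simp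
  then show "x \<in> plus_gen C K a" unfolding plus_gen_def by blast
qed

lemma plus_gen_self: "ideal_in C K \<Longrightarrow> a \<in> plus_gen C K a"
  unfolding plus_gen_def using ideal_zero one_in by force

lemma plus_gen_least: "ideal_in C I \<Longrightarrow> K \<subseteq> I \<Longrightarrow> a \<in> I \<Longrightarrow> plus_gen C K a \<subseteq> I"
  by (auto simp: plus_gen_def intro!: ideal_add ideal_mult)

lemma plus_gen_commute:
  assumes "ideal_in C K" "a \<in> C" "b \<in> C"
  shows "plus_gen C (plus_gen C K a) b = plus_gen C (plus_gen C K b) a"
  by (intro equalityI plus_gen_least ideal_plus_gen assms plus_gen_self)
     (meson plus_gen_incl plus_gen_self assms ideal_plus_gen subset_iff subset_trans)+

lemma ideal_colon:
  assumes "ideal_in C K" "z \<in> C" shows "ideal_in C (colon C K z)"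
  using assms by (auto simp: ideal_in_def colon_def distrib_right mult.assoc intro: in_C)

lemma noetherian_max:
  assumes "noetherian C" "I0 \<in> \<F>" "\<And>I. I \<in> \<F> \<Longrightarrow> ideal_in C I"
  shows "\<exists>M\<in>\<F>. \<forall>I\<in>\<F>. M \<subseteq> I \<longrightarrow> I = M"
  using assms unfolding noetherian_def by (metis empty_iff)

text \<open>
  An ideal maximal among those over \<open>I\<close> that miss the multiplicative set is prime.
\<close>

lemma exists_prime_avoiding:
  assumes "noetherian C" "ideal_in C I" and S: "S \<subseteq> C" "1 \<in> S" "\<And>a b. a \<in> S \<Longrightarrow> b \<in> S \<Longrightarrow> a * b \<in> S"
    and "I \<inter> S = {}"
  obtains P where "prime_in C P" "I \<subseteq> P" "P \<inter> S = {}"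
proof -
  let ?\<F> = "{J. ideal_in C J \<and> I \<subseteq> J \<and> J \<inter> S = {}}"
  have S1: "I \<in> ?\<F>" using assms by blast
  have S2: "ideal_in C J" if "J \<in> ?\<F>" for J using that by blast
  obtain P where P: "P \<in> ?\<F>" and max': "\<forall>J\<in>?\<F>. P \<subseteq> J \<longrightarrow> J = P"
    by (rule bexE[OF noetherian_max[OF assms(1) S1 S2]])
  note max = max'[rule_format]
  have idP: "ideal_in C P" using P by simp
  have meets: "\<exists>p c. p \<in> P \<and> c \<in> C \<and> p + c * a \<in> S" if "a \<in> C" "a \<notin> P" for a
  proof (rule ccontr)
    assume "\<not> ?thesis"
    then have "plus_gen C P a \<inter> S = {}" by (auto simp: plus_gen_def)
    then have "plus_gen C P a = P"
      using max[of "plus_gen C P a"] plus_gen_incl[of P a] ideal_plus_gen[OF idP \<open>a \<in> C\<close>] P by auto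
    then show False using plus_gen_self[OF idP, of a] that by simp
  qed
  have "prime_in C P" unfolding prime_in_def
  proof (intro conjI ballI impI)
    fix a b assume ab: "a \<in> C" "b \<in> C" "a * b \<in> P"
    show "a \<in> P \<or> b \<in> P"
    proof (rule ccontr)
      assume "\<not> ?thesis"
      then obtain p c q e where *: "p \<in> P" "c \<in> C" "p + c * a \<in> S" "q \<in> P" "e \<in> C" "q + e * b \<in> S"
        using meets ab by meson
      then have "(p + c * a) * (q + e * b) \<in> S" using S by simp
      moreover have "(p + c * a) * (q + e * b) = p * (q + e * b) + (c * a) * q + (c * e) * (a * b)"
        by (simp add: algebra_simps)
      moreover have "p * (q + e * b) \<in> P" "(c * a) * q \<in> P" "(c * e) * (a * b) \<in> P"
        using * ab ideal_sub[OF idP]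
        by (meson ideal_mult[OF idP] ideal_mult2[OF idP] add_in mult_in)+
      then have "p * (q + e * b) + (c * a) * q + (c * e) * (a * b) \<in> P"
        by (meson ideal_add[OF idP])
      ultimately show False using P by auto
    qed
  qed (use P S idP in auto)
  with that P show ?thesis by blast
qed

lemma maximal_prime:
  assumes "maximal_in C M" shows "prime_in C M"
proof -
  have M: "ideal_in C M" "1 \<notin> M" using assms by (auto simp: maximal_in_def)
  have "b \<in> M" if ab: "a \<in> C" "b \<in> C" "a * b \<in> M" "a \<notin> M" for a b
  proof -
    have "plus_gen C M a \<noteq> M" using plus_gen_self[OF M(1)] ab by blast
    then have "1 \<in> plus_gen C M a"
      using assms ideal_plus_gen[OF M(1) ab(1)] plus_gen_incl[of M a] unfolding maximal_in_def by blast
    then obtain m c where mc: "1 = m + c * a" "m \<in> M" "c \<in> C" by (auto simp: plus_gen_def)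
    then have "b = b * m + c * (a * b)" by (metis distrib_left mult.commute mult.left_commute mult.right_neutral)
    also have "\<dots> \<in> M" using mc ab by (meson ideal_add[OF M(1)] ideal_mult[OF M(1)])
    finally show ?thesis .
  qed
  then show ?thesis using M by (auto simp: prime_in_def)
qed

lemma exists_maximal:
  assumes "noetherian C" "ideal_in C I" "1 \<notin> I"
  obtains M where "maximal_in C M" "I \<subseteq> M"
proof -
  let ?\<F> = "{J. ideal_in C J \<and> I \<subseteq> J \<and> 1 \<notin> J}"
  have S1: "I \<in> ?\<F>" using assms by blast
  have S2: "ideal_in C J" if "J \<in> ?\<F>" for J using that by blast
  obtain P where P: "P \<in> ?\<F>" and max': "\<forall>J\<in>?\<F>. P \<subseteq> J \<longrightarrow> J = P"
    by (rule bexE[OF noetherian_max[OF assms(1) S1 S2]])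
  note max = max'[rule_format]
  have "I' = P" if "ideal_in C I'" "P \<subseteq> I'" "1 \<notin> I'" for I' using max[of I'] P that by blast
  then have "maximal_in C P" using P by (auto simp: maximal_in_def)
  with P that show ?thesis by blast
qed

definition minimal_over :: "'r set \<Rightarrow> 'r set \<Rightarrow> bool" where
  "minimal_over K P \<longleftrightarrow> prime_in C P \<and> K \<subseteq> P \<and> (\<forall>Q. prime_in C Q \<longrightarrow> K \<subseteq> Q \<longrightarrow> Q \<subseteq> P \<longrightarrow> Q = P)"

text \<open>
  Zorn's lemma for the complements: the intersection of a chain of primes is prime.
\<close>

lemma exists_minimal_over:
  assumes "prime_in C P" "K \<subseteq> P"
  obtains Q where "minimal_over K Q" "Q \<subseteq> P"
proof -
  define A where "A = (\<lambda>Q. C - Q) ` {Q. prime_in C Q \<and> K \<subseteq> Q \<and> Q \<subseteq> P}"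
  have memA: "W \<in> A \<longleftrightarrow> (\<exists>Q. W = C - Q \<and> prime_in C Q \<and> K \<subseteq> Q \<and> Q \<subseteq> P)" for W
    by (auto simp: A_def)
  have ub: "\<exists>U\<in>A. \<forall>W\<in>\<C>. W \<subseteq> U" if ch: "subset.chain A \<C>" for \<C>
  proof (cases "\<C> = {}")
    case True
    moreover have "C - P \<in> A" using assms unfolding memA by blast
    ultimately show ?thesis by blast
  next
    case False
    let ?Q = "C - \<Union>\<C>"
    have "\<C> \<subseteq> A" using ch by (simp add: subset.chain_def)
    then have mem: "\<exists>Q. W = C - Q \<and> prime_in C Q \<and> K \<subseteq> Q \<and> Q \<subseteq> P" if "W \<in> \<C>" for W
      using that memA by blast
    have "\<forall>W\<in>\<C>. \<forall>Y\<in>\<C>. W \<subseteq> Y \<or> Y \<subseteq> W" using ch by (simp add: subset_chain_def)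
    then have lin: "W \<subseteq> Y \<or> Y \<subseteq> W" if "W \<in> \<C>" "Y \<in> \<C>" for W Y
      using that by simp
    have sub: "Q \<subseteq> C" if "prime_in C Q" for Q using that by (auto simp: prime_in_def ideal_in_def)
    have inQ: "a \<in> ?Q" if "\<And>Q. C - Q \<in> \<C> \<Longrightarrow> prime_in C Q \<Longrightarrow> a \<in> Q" for a
    proof -
      have "a \<in> C \<and> a \<notin> W" if XC: "W \<in> \<C>" for W
      proof -
        obtain Q where Q: "W = C - Q" "prime_in C Q" using mem[OF XC] by blast
        then have "a \<in> Q" using \<open>W \<in> \<C>\<close> \<open>\<And>Q. C - Q \<in> \<C> \<Longrightarrow> prime_in C Q \<Longrightarrow> a \<in> Q\<close> by simp
        then show ?thesis using Q sub[OF Q(2)] by auto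
      qed
      then show ?thesis using False by auto
    qed
    have "prime_in C ?Q" unfolding prime_in_def ideal_in_def
    proof (intro conjI ballI impI)
      fix a b assume ab: "a \<in> C" "b \<in> C" "a * b \<in> ?Q"
      show "a \<in> ?Q \<or> b \<in> ?Q"
      proof (rule ccontr)
        assume "\<not> ?thesis"
        then obtain W Y where XY: "W \<in> \<C>" "a \<in> W" "Y \<in> \<C>" "b \<in> Y" using ab by auto
        then obtain Z where Z: "Z \<in> \<C>" "a \<in> Z" "b \<in> Z" using lin[of W Y] by blast
        obtain Q where "Z = C - Q" "prime_in C Q" using mem[OF Z(1)] by blast
        then have "a * b \<in> Z" using prime_cases[of Q a b] ab Z mult_in[of a b] by blast
        then show False using ab \<open>Z \<in> \<C>\<close> by blast
      qed
    next
      obtain W where W: "W \<in> \<C>" using False by blast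
      then obtain Q where "W = C - Q" "prime_in C Q" using mem by blast
      then have "1 \<in> W" using prime_one one_in by auto
      then show "1 \<notin> ?Q" using W by auto
    next
      show "0 \<in> ?Q" by (rule inQ) (rule ideal_zero[OF prime_ideal])
    next
      fix a b assume "a \<in> ?Q" "b \<in> ?Q" then show "a + b \<in> ?Q"
        by (intro inQ) (rule ideal_add[OF prime_ideal], auto)
    next
      fix a b assume "a \<in> C" "b \<in> ?Q" then show "a * b \<in> ?Q"
        by (intro inQ) (rule ideal_mult[OF prime_ideal], auto)
    qed auto
    moreover have "K \<subseteq> ?Q"
    proof
      fix x assume "x \<in> K"
      moreover have "x \<in> C" using \<open>x \<in> K\<close> assms sub by blast
      ultimately show "x \<in> ?Q" using mem by auto
    qed
    moreover have "?Q \<subseteq> P"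
    proof -
      obtain W where "W \<in> \<C>" using False by blast
      then show ?thesis using mem[of W] by blast
    qed
    ultimately have "C - ?Q \<in> A" unfolding memA by blast
    moreover have "W \<subseteq> C - ?Q" if "W \<in> \<C>" for W using mem[OF that] that by auto
    ultimately show ?thesis by blast
  qed
  have "\<exists>M\<in>A. \<forall>W\<in>A. M \<subseteq> W \<longrightarrow> W = M" by (rule subset_Zorn) (rule ub)
  then obtain M where M: "M \<in> A" and max: "\<And>W. W \<in> A \<Longrightarrow> M \<subseteq> W \<Longrightarrow> W = M" by auto
  then obtain Q where Q: "M = C - Q" "prime_in C Q" "K \<subseteq> Q" "Q \<subseteq> P" unfolding memA by auto
  have sub: "Q \<subseteq> C" if "prime_in C Q" for Q using that by (auto simp: prime_in_def ideal_in_def)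
  have "Q' = Q" if Q': "prime_in C Q'" "K \<subseteq> Q'" "Q' \<subseteq> Q" for Q'
  proof -
    have "C - Q' \<in> A" using Q Q' unfolding memA by blast
    then have "C - Q' = C - Q" using max[of "C - Q'"] Q Q' by auto
    then show ?thesis using sub[OF Q(2)] sub[OF Q'(1)] by auto
  qed
  then have "minimal_over K Q" using Q by (auto simp: minimal_over_def)
  then show ?thesis using that Q by blast
qed

text \<open>
  If \<open>b \<in> Q\<close> were a nonzerodivisor modulo \<open>K\<close>, the multiplicative set generated by \<open>b\<close> and the
  complement of \<open>Q\<close> would miss \<open>K\<close>; a prime over \<open>K\<close> avoiding it lies strictly below \<open>Q\<close>.
\<close>

lemma minimal_over_zero_divisors:
  assumes "noetherian C" "ideal_in C K" "minimal_over K Q" "b \<in> Q"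
  shows "\<not> nzd_mod C K b"
proof
  assume nz: "nzd_mod C K b"
  have Q: "prime_in C Q" "K \<subseteq> Q" using assms by (auto simp: minimal_over_def)
  have bC: "b \<in> C" using assms(4) Q(1) ideal_sub prime_ideal by blast
  let ?S = "{s * b ^ n | s n. s \<in> C \<and> s \<notin> Q}"
  have inK: "x \<in> K" if "b ^ n * x \<in> K" "x \<in> C" for n x
    using that
  proof (induction n)
    case (Suc n)
    then have "b * (b ^ n * x) \<in> K" by (simp add: mult.assoc)
    then show ?case using Suc nz bC by (auto simp: nzd_mod_def intro: in_C)
  qed simp
  have S1: "K \<inter> ?S = {}"
  proof -
    have False if "s * b ^ n \<in> K" "s \<in> C" "s \<notin> Q" for s n
      using inK[of n s] that Q by (auto simp: mult.commute)
    then show ?thesis by blast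
  qed
  have S2: "1 \<in> ?S" using prime_one[OF Q(1)] one_in power_0[of b] mult_1[of 1]
    by (metis (mono_tags, lifting) mem_Collect_eq)
  have S3: "x * y \<in> ?S" if xy: "x \<in> ?S" "y \<in> ?S" for x y
  proof -
    obtain s n t m where "x = s * b ^ n" "y = t * b ^ m" "s \<in> C" "s \<notin> Q" "t \<in> C" "t \<notin> Q"
      using xy by blast
    then have "x * y = (s * t) * b ^ (n + m)" "s * t \<in> C" "s * t \<notin> Q"
      using prime_cases[OF Q(1)] by (auto simp: power_add algebra_simps intro: in_C)
    then show ?thesis by blast
  qed
  have S4: "?S \<subseteq> C" using bC by (auto intro: in_C)
  obtain P where P: "prime_in C P" "K \<subseteq> P" "P \<inter> ?S = {}"
    by (rule exists_prime_avoiding[OF assms(1,2) S4 S2 S3 S1])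
  have "s \<in> ?S" if "s \<in> C" "s \<notin> Q" for s
    using that power_0[of b] mult_1_right[of s] by (metis (mono_tags, lifting) mem_Collect_eq)
  then have "P \<subseteq> Q" using P ideal_sub[OF prime_ideal[OF P(1)]] by blast
  then have "P = Q" using P assms(3) by (auto simp: minimal_over_def)
  moreover have "b \<in> ?S" using prime_one[OF Q(1)] one_in power_one_right[of b] mult_1[of b]
    by (metis (mono_tags, lifting) mem_Collect_eq)
  ultimately show False using P assms(4) by blast
qed

text \<open>
  Maximal annihilators are prime: \<open>K : bz\<close> contains \<open>K : z\<close>, hence equals it as soon as
  \<open>bz \<notin> K\<close>.
\<close>

lemma colon_maximal_prime:
  assumes K: "ideal_in C K" and z: "z \<in> C" "z \<notin> K"
    and max: "\<And>w. w \<in> C \<Longrightarrow> w \<notin> K \<Longrightarrow> colon C K z \<subseteq> colon C K w \<Longrightarrow> colon C K w = colon C K z"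
  shows "prime_in C (colon C K z)"
  unfolding prime_in_def
proof (intro conjI ballI impI)
  show "ideal_in C (colon C K z)" by (rule ideal_colon[OF K z(1)])
  show "1 \<notin> colon C K z" using z by (simp add: colon_def)
  fix a b assume ab: "a \<in> C" "b \<in> C" "a * b \<in> colon C K z"
  show "a \<in> colon C K z \<or> b \<in> colon C K z"
  proof (cases "b * z \<in> K")
    case True then show ?thesis using ab by (simp add: colon_def)
  next
    case False
    have "colon C K z \<subseteq> colon C K (b * z)"
      using ideal_mult[OF K ab(2)] by (auto simp: colon_def mult.left_commute[of _ b z])
    then have "colon C K (b * z) = colon C K z" using max[of "b * z"] False ab z by (auto intro: in_C)
    moreover have "a \<in> colon C K (b * z)" using ab by (auto simp: colon_def mult.assoc)
    ultimately show ?thesis by simp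
  qed
qed

lemma exists_maximal_colon:
  assumes "noetherian C" and K: "ideal_in C K" and w: "w \<in> C" "w \<notin> K"
  obtains z where "z \<in> C" "z \<notin> K" "colon C K w \<subseteq> colon C K z" "prime_in C (colon C K z)"
    "\<And>w. w \<in> C \<Longrightarrow> w \<notin> K \<Longrightarrow> colon C K z \<subseteq> colon C K w \<Longrightarrow> colon C K w = colon C K z"
proof -
  let ?\<F> = "{colon C K z | z. z \<in> C \<and> z \<notin> K \<and> colon C K w \<subseteq> colon C K z}"
  have S1: "colon C K w \<in> ?\<F>" using w by blast
  have S2: "ideal_in C I" if "I \<in> ?\<F>" for I using that ideal_colon[OF K] by blast
  obtain M where M: "M \<in> ?\<F>" and max': "\<forall>I\<in>?\<F>. M \<subseteq> I \<longrightarrow> I = M"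
    by (rule bexE[OF noetherian_max[OF assms(1) S1 S2]])
  obtain z where z: "M = colon C K z" "z \<in> C" "z \<notin> K" "colon C K w \<subseteq> colon C K z" using M by blast
  have max: "colon C K v = colon C K z" if "v \<in> C" "v \<notin> K" "colon C K z \<subseteq> colon C K v" for v
    using max'[rule_format, of "colon C K v"] that z by blast
  show ?thesis by (rule that[OF z(2-4) colon_maximal_prime[OF K z(2,3) max] max])
qed

end

section \<open>Krull's principal ideal theorem\<close>

context comm_subring begin

text \<open>
  The contraction to \<open>C\<close> of the extension of \<open>J\<close> to the local ring at \<open>P\<close>. Ideals of the local
  ring correspond to the ideals of \<open>C\<close> that are fixed by this operation, so the local arguments
  below can be carried out inside \<open>C\<close>.
\<close>

definition saturation :: "'r set \<Rightarrow> 'r set \<Rightarrow> 'r set" where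
  "saturation P J = {r \<in> C. \<exists>s\<in>C - P. s * r \<in> J}"

lemma ideal_saturation:
  assumes "prime_in C P" "ideal_in C J" shows "ideal_in C (saturation P J)"
  unfolding ideal_in_def
proof (intro conjI ballI)
  show "saturation P J \<subseteq> C" by (auto simp: saturation_def)
  show "0 \<in> saturation P J" using one_in zero_in prime_one[OF assms(1)] ideal_zero[OF assms(2)]
    by (auto simp: saturation_def)
  fix a b assume "a \<in> saturation P J" "b \<in> saturation P J"
  then obtain s t where *: "s \<in> C" "s \<notin> P" "s * a \<in> J" "t \<in> C" "t \<notin> P" "t * b \<in> J" "a \<in> C" "b \<in> C"
    by (auto simp: saturation_def)
  have "t * (s * a) + s * (t * b) \<in> J" using * by (meson ideal_add ideal_mult assms(2))
  then have "(s * t) * (a + b) \<in> J" by (simp add: algebra_simps)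
  moreover have "s * t \<in> C - P" using * prime_cases[OF assms(1)] mult_in by blast
  ultimately show "a + b \<in> saturation P J" using * add_in by (auto simp: saturation_def)
next
  fix c a assume "c \<in> C" "a \<in> saturation P J"
  then obtain s where *: "s \<in> C" "s \<notin> P" "s * a \<in> J" "a \<in> C" by (auto simp: saturation_def)
  have "s * (c * a) \<in> J" using * ideal_mult[OF assms(2) \<open>c \<in> C\<close>, of "s * a"] by (simp add: mult.left_commute)
  then show "c * a \<in> saturation P J" using * \<open>c \<in> C\<close> by (auto simp: saturation_def intro: in_C)
qed

lemma saturation_incl: "prime_in C P \<Longrightarrow> J \<subseteq> C \<Longrightarrow> J \<subseteq> saturation P J"
  using one_in prime_one[of P] by (auto simp: saturation_def intro!: bexI[of _ 1])

lemma saturation_mono: "J \<subseteq> J' \<Longrightarrow> saturation P J \<subseteq> saturation P J'" by (auto simp: saturation_def)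
lemma saturation_mono2: "Q \<subseteq> P \<Longrightarrow> saturation P J \<subseteq> saturation Q J" by (auto simp: saturation_def)

lemma saturation_saturation: "prime_in C P \<Longrightarrow> saturation P (saturation P J) = saturation P J"
proof
  assume P: "prime_in C P"
  show "saturation P (saturation P J) \<subseteq> saturation P J"
  proof
    fix r assume "r \<in> saturation P (saturation P J)"
    then obtain s t where *: "r \<in> C" "s \<in> C" "s \<notin> P" "t \<in> C" "t \<notin> P" "t * (s * r) \<in> J"
      by (auto simp: saturation_def)
    then have "t * s \<in> C - P" "(t * s) * r \<in> J" using prime_cases[OF P, of t s] by (auto simp: mult.assoc intro: in_C)
    then show "r \<in> saturation P J" using * by (auto simp: saturation_def)
  qed
  show "saturation P J \<subseteq> saturation P (saturation P J)" by (rule saturation_incl[OF P]) (auto simp: saturation_def)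
qed

lemma satD: "saturation P L = L \<Longrightarrow> s \<in> C \<Longrightarrow> s \<notin> P \<Longrightarrow> s * r \<in> L \<Longrightarrow> r \<in> C \<Longrightarrow> r \<in> L"
  by (auto simp: saturation_def)

lemma saturation_prime: "prime_in C P \<Longrightarrow> saturation P P = P"
  using prime_cases[of P] saturation_incl[of P P] ideal_sub[OF prime_ideal, of P] by (auto simp: saturation_def)

text \<open>
  Nakayama's lemma at the prime \<open>P\<close>, for \<open>Y \<subseteq> Z + AY\<close> locally with \<open>A \<subseteq> P\<close>. The hypothesis
  \<open>small\<close> expresses the inclusion without forming \<open>Z + AY\<close>, by quantifying over the ideals \<open>N\<close> that
  contain it. The maximal condition replaces the usual finite generation of \<open>Y\<close>: take a saturated
  ideal \<open>N\<close> over \<open>Z\<close> that is maximal among those not containing \<open>Y\<close>. If \<open>az \<notin> N\<close> for some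
  \<open>a \<in> A\<close> and \<open>z \<in> Y\<close>, then \<open>N + (az)\<close> contains \<open>Y\<close> locally, in particular \<open>z\<close>, and cancelling the
  unit \<open>s - ca\<close> puts \<open>z\<close> into \<open>N\<close>. So \<open>AY \<subseteq> N\<close>, whence \<open>Y \<subseteq> N\<close>.
\<close>

lemma nakayama:
  assumes "noetherian C" and P: "prime_in C P" and A: "A \<subseteq> P"
    and Z: "ideal_in C Z" "saturation P Z = Z" and Y: "Y \<subseteq> C"
    and small: "\<And>N y. ideal_in C N \<Longrightarrow> Z \<subseteq> N \<Longrightarrow> (\<forall>a\<in>A. \<forall>z\<in>Y. a * z \<in> N) \<Longrightarrow> y \<in> Y \<Longrightarrow> y \<in> saturation P N"
  shows "Y \<subseteq> Z"
proof (rule ccontr)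
  assume notsub: "\<not> Y \<subseteq> Z"
  let ?\<F> = "{N. ideal_in C N \<and> Z \<subseteq> N \<and> saturation P N = N \<and> \<not> Y \<subseteq> N}"
  have S1: "Z \<in> ?\<F>" using notsub Z by blast
  have S2: "ideal_in C I" if "I \<in> ?\<F>" for I using that by blast
  obtain N where N: "N \<in> ?\<F>" and max': "\<forall>I\<in>?\<F>. N \<subseteq> I \<longrightarrow> I = N"
    by (rule bexE[OF noetherian_max[OF assms(1) S1 S2]])
  note max = max'[rule_format]
  have idN: "ideal_in C N" and satN: "saturation P N = N" and ZN: "Z \<subseteq> N" and YN: "\<not> Y \<subseteq> N" using N by auto
  have PC: "A \<subseteq> C" using A ideal_sub[OF prime_ideal[OF P]] by blast
  have "a * z \<in> N" if az: "a \<in> A" "z \<in> Y" for a z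
  proof (cases "z \<in> N")
    case True
    then show ?thesis using ideal_mult[OF idN] az PC by auto
  next
    case False
    have zC: "z \<in> C" and aC: "a \<in> C" using az Y PC by auto
    \<comment> \<open>if \<open>?N'\<close> contained \<open>z\<close>, then \<open>s z \<in> N + c a z\<close> with \<open>s - c a \<notin> P\<close>\<close>
    let ?N' = "saturation P (plus_gen C N (a * z))"
    have idA: "ideal_in C (plus_gen C N (a * z))" using ideal_plus_gen[OF idN] zC aC mult_in by blast
    have sub': "N \<subseteq> ?N'" using saturation_mono[OF plus_gen_incl[of N "a * z"], of P] satN by auto
    have "z \<notin> ?N'"
    proof
      assume "z \<in> ?N'"
      then obtain s n c where s: "s \<in> C" "s \<notin> P" "s * z = n + c * (a * z)" "n \<in> N" "c \<in> C"
        by (auto simp: saturation_def plus_gen_def)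
      then have "(s - c * a) * z \<in> N" by (simp add: algebra_simps)
      moreover have "s - c * a \<notin> P"
        using s(2) ideal_diff_cancel[OF prime_ideal[OF P], of s "c * a"]
          ideal_mult[OF prime_ideal[OF P] s(5), of a] az A by blast
      moreover have "s - c * a \<in> C" using s aC by (intro in_C)
      ultimately show False using satD[OF satN, of "s - c * a" z] zC False by blast
    qed
    then have "?N' \<in> ?\<F>" using ideal_saturation[OF P idA] sub' ZN saturation_saturation[OF P] az by auto
    then have "?N' = N" using max[of ?N'] sub' by auto
    moreover have "a * z \<in> ?N'"
      using saturation_incl[OF P, of "plus_gen C N (a * z)"] plus_gen_self[OF idN] ideal_sub[OF idA] by blast
    ultimately show ?thesis by simp
  qed
  then have "Y \<subseteq> saturation P N" using small[OF idN ZN] by blast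
  then show False using YN satN by simp
qed

definition stabilizes :: "(nat \<Rightarrow> 'r set) \<Rightarrow> bool" where
  "stabilizes J \<longleftrightarrow> (\<exists>n. \<forall>i\<ge>n. J i = J n)"

text \<open>
  The descending chain condition for the ideals of the local ring at \<open>P\<close> modulo \<open>L\<close>.
\<close>

definition artinian_mod :: "'r set \<Rightarrow> 'r set \<Rightarrow> bool" where
  "artinian_mod P L \<longleftrightarrow> (\<forall>J. (\<forall>i. ideal_in C (J i) \<and> L \<subseteq> J i \<and> saturation P (J i) = J i) \<longrightarrow>
     decseq J \<longrightarrow> stabilizes J)"

lemma artinian_modD:
  assumes "artinian_mod P L" "\<And>i. ideal_in C (J i)" "\<And>i. L \<subseteq> J i" "\<And>i. saturation P (J i) = J i" "decseq J"
  shows "stabilizes J"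
  using assms unfolding artinian_mod_def by simp

text \<open>
  If \<open>L : z = P\<close>, then modulo \<open>L\<close> the element \<open>z\<close> spans a one-dimensional vector space over the
  residue field of \<open>P\<close>. A saturated ideal over \<open>L\<close> therefore either contains \<open>z\<close> or meets
  \<open>L + (z)\<close> in \<open>L\<close> only, and in the second case the modular law recovers it from its sum with
  \<open>(z)\<close>.
\<close>

lemma artinian_step:
  assumes P: "prime_in C P" and L: "ideal_in C L" "saturation P L = L"
    and z: "z \<in> C" "z \<notin> L" "colon C L z = P"
    and art: "artinian_mod P (saturation P (plus_gen C L z))"
  shows "artinian_mod P L"
  unfolding artinian_mod_def
proof (intro allI impI)
  fix J assume J: "\<forall>i. ideal_in C (J i) \<and> L \<subseteq> J i \<and> saturation P (J i) = J i" and dec: "decseq J"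
  have idJ: "ideal_in C (J i)" and LJ: "L \<subseteq> J i" and satJ: "saturation P (J i) = J i" for i using J by auto
  let ?J = "\<lambda>i. saturation P (plus_gen C (J i) z)"
  have adjmono: "plus_gen C W z \<subseteq> plus_gen C Y z" if "W \<subseteq> Y" for W Y using that unfolding plus_gen_def by blast
  have "decseq ?J" using dec unfolding decseq_def by (meson saturation_mono adjmono)
  moreover have "\<forall>i. ideal_in C (?J i) \<and> saturation P (plus_gen C L z) \<subseteq> ?J i \<and> saturation P (?J i) = ?J i"
    using ideal_saturation[OF P ideal_plus_gen[OF idJ z(1)]] saturation_saturation[OF P] saturation_mono[OF adjmono[OF LJ]] by blast
  ultimately have "stabilizes ?J" by (intro artinian_modD[OF art]) simp_all
  then obtain n where n: "\<And>i. i \<ge> n \<Longrightarrow> ?J i = ?J n" unfolding stabilizes_def by blast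
  show "stabilizes J"
  proof (cases "\<forall>i. z \<in> J i")
    case True
    have "?J i = J i" for i
    proof -
      have "plus_gen C (J i) z = J i" using plus_gen_least[OF idJ, of "J i" i z] plus_gen_incl[of "J i" z] True by auto
      then show ?thesis using satJ by simp
    qed
    then show ?thesis using n unfolding stabilizes_def by metis
  next
    case False
    then obtain m where m: "z \<notin> J m" by blast
    define N where "N = max n m"
    have "J i = J N" if i: "i \<ge> N" for i
    proof
      show "J i \<subseteq> J N" using dec i by (auto simp: decseq_def)
      have zN: "z \<notin> J N" using m dec unfolding decseq_def N_def by (metis max.cobounded2 subsetD)
      show "J N \<subseteq> J i"
      proof
        fix w assume w: "w \<in> J N"
        have wC: "w \<in> C" using ideal_sub[OF idJ w] .
        have "w \<in> ?J N" using w saturation_incl[OF P, of "plus_gen C (J N) z"] plus_gen_incl[of "J N" z]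
          ideal_sub[OF ideal_plus_gen[OF idJ z(1)]] by blast
        also have "?J N = ?J i" using n[of N] n[of i] i unfolding N_def by simp
        finally obtain s v c where s: "s \<in> C" "s \<notin> P" "s * w = v + c * z" "v \<in> J i" "c \<in> C"
          by (auto simp: saturation_def plus_gen_def)
        have "v \<in> J N" using s dec i unfolding decseq_def by blast
        then have "c * z \<in> J N"
          using ideal_add_cancel[OF idJ, of v "c * z" N] ideal_mult[OF idJ s(1) w] s by simp
        then have "c \<in> P" using satD[OF satJ s(5), of z N] zN z by blast
        then have "c * z \<in> L" using z by (auto simp: colon_def)
        then have "s * w \<in> J i" using s LJ[of i] ideal_add[OF idJ] by auto
        then show "w \<in> J i" using satD[OF satJ s(1,2) _ wC] by blast
      qed
    qed
    then show ?thesis unfolding stabilizes_def by blast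
  qed
qed

text \<open>
  Noetherian induction from above: for \<open>L\<close> maximal among the saturated ideals over \<open>F\<close> for which the
  condition fails, a maximal colon ideal \<open>L : z\<close> is a prime between \<open>F\<close> and \<open>P\<close>, so it is \<open>P\<close>, and
  the previous lemma applies.
\<close>

lemma artinian_minimal_over:
  assumes "noetherian C" and min: "minimal_over F P" and F: "ideal_in C F"
  shows "artinian_mod P (saturation P F)"
proof (rule ccontr)
  assume not_artinian: "\<not> ?thesis"
  have P: "prime_in C P" "F \<subseteq> P" using min by (auto simp: minimal_over_def)
  let ?\<F> = "{L. ideal_in C L \<and> F \<subseteq> L \<and> saturation P L = L \<and> \<not> artinian_mod P L}"
  have S1: "saturation P F \<in> ?\<F>"
    using not_artinian ideal_saturation[OF P(1) F] saturation_saturation[OF P(1)] saturation_incl[OF P(1)] ideal_sub[OF F] by auto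
  have S2: "ideal_in C I" if "I \<in> ?\<F>" for I using that by blast
  obtain L where L: "L \<in> ?\<F>" and max': "\<forall>I\<in>?\<F>. L \<subseteq> I \<longrightarrow> I = L"
    by (rule bexE[OF noetherian_max[OF assms(1) S1 S2]])
  note max = max'[rule_format]
  have idL: "ideal_in C L" and FL: "F \<subseteq> L" and satL: "saturation P L = L" and notart: "\<not> artinian_mod P L"
    using L by auto
  have "L \<noteq> C"
  proof
    assume "L = C"
    then have "J i = C" if "\<forall>i. ideal_in C (J i) \<and> L \<subseteq> J i \<and> saturation P (J i) = J i" for i J
      using that ideal_sub by (metis subsetI subset_antisym)
    then have "artinian_mod P L" unfolding artinian_mod_def stabilizes_def by metis
    then show False using notart by blast
  qed
  then obtain w where w: "w \<in> C" "w \<notin> L" using ideal_sub[OF idL] by blast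
  obtain z where z: "z \<in> C" "z \<notin> L" "prime_in C (colon C L z)"
    using exists_maximal_colon[OF assms(1) idL w] by metis
  have "F \<subseteq> colon C L z"
    using FL ideal_sub[OF F] ideal_mult2[OF idL z(1)] by (auto simp: colon_def)
  moreover have "colon C L z \<subseteq> P" using satD[OF satL _ _ _ z(1)] z(2) by (auto simp: colon_def)
  ultimately have "colon C L z = P" using min z(3) unfolding minimal_over_def by blast
  moreover have "artinian_mod P (saturation P (plus_gen C L z))"
  proof (rule ccontr)
    assume *: "\<not> ?thesis"
    let ?L = "saturation P (plus_gen C L z)"
    have idA: "ideal_in C (plus_gen C L z)" by (rule ideal_plus_gen[OF idL z(1)])
    have sub: "plus_gen C L z \<subseteq> ?L" using saturation_incl[OF P(1)] ideal_sub[OF idA] by blast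
    then have "?L \<in> ?\<F>" using * ideal_saturation[OF P(1) idA] saturation_saturation[OF P(1)] plus_gen_incl[of L z] FL by auto
    then have "?L = L" using max sub plus_gen_incl[of L z] by blast
    then show False using plus_gen_self[OF idL, of z] sub z by auto
  qed
  ultimately show False using artinian_step[OF P(1) idL satL z(1,2)] notart by blast
qed

text \<open>
  Krull's principal ideal theorem, with his proof. Let \<open>Y n\<close> be the symbolic powers of \<open>Q\<close> modulo
  \<open>p\<close>. If \<open>P\<close> were minimal over \<open>p + (f)\<close>, the chain \<open>Y n + (f)\<close> would become stationary at \<open>P\<close>; as
  \<open>f \<notin> Q\<close>, this gives \<open>Y n \<subseteq> Y (n + 1) + f Y n\<close>, so \<open>Y n = Y (n + 1)\<close> by Nakayama's lemma at
  \<open>P\<close>, and then \<open>Y n \<subseteq> p\<close> by Nakayama's lemma at \<open>Q\<close>. But \<open>q\<^sup>n \<in> Y n\<close> for \<open>q \<in> Q\<close>, and \<open>p\<close> is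
  prime.
\<close>

theorem principal_ideal:
  assumes noe: "noetherian C" and p: "prime_in C p" and Q: "prime_in C Q" and P: "prime_in C P"
    and chain: "p \<subset> Q" "Q \<subset> P" and f: "f \<in> P"
  shows "\<not> minimal_over (plus_gen C p f) P"
proof
  assume min: "minimal_over (plus_gen C p f) P"
  have idp: "ideal_in C p" and idQ: "ideal_in C Q" and idP: "ideal_in C P"
    using p Q P by (auto intro: prime_ideal)
  have fC: "f \<in> C" using ideal_sub[OF idP f] .
  have fQ: "f \<notin> Q"
    using min plus_gen_least[OF idQ, of p f] chain Q unfolding minimal_over_def by blast
  \<comment> \<open>\<open>prd W\<close> is the ideal \<open>p + Q W\<close>\<close>
  define prd where "prd = (\<lambda>Y. generated C (p \<union> {a * z | a z. a \<in> Q \<and> z \<in> Y}))"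
  define Y where "Y = rec_nat C (\<lambda>_ Y. saturation Q (prd Y))"
  have Y0: "Y 0 = C" and YS: "Y (Suc n) = saturation Q (prd (Y n))" for n by (auto simp: Y_def)
  have idprd: "ideal_in C (prd W)" if "W \<subseteq> C" for W unfolding prd_def
    using that ideal_sub[OF idp] ideal_sub[OF idQ] by (intro ideal_generated) (auto intro: in_C)
  have idY: "ideal_in C (Y n)" for n
    by (induction n) (auto simp: Y0 YS ideal_UNIV intro!: ideal_saturation Q idprd dest: ideal_sub)
  have satY: "saturation Q (Y n) = Y n" for n
  proof (cases n)
    case 0 then show ?thesis using saturation_incl[OF Q, of C] by (auto simp: Y0 saturation_def)
  next
    case (Suc m) then show ?thesis using saturation_saturation[OF Q] by (simp add: YS)
  qed
  have YC: "Y n \<subseteq> C" for n using ideal_sub[OF idY] by blast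
  have prd_sub: "prd (Y n) \<subseteq> Y (Suc n)" for n
    unfolding YS using saturation_incl[OF Q] ideal_sub[OF idprd[OF YC]] by blast
  have prd_incl: "p \<union> {a * z | a z. a \<in> Q \<and> z \<in> W} \<subseteq> prd W" for W
    unfolding prd_def by (rule generated_incl)
  have prdI: "a * z \<in> prd W" if "a \<in> Q" "z \<in> W" for a z W
    by (rule subsetD[OF prd_incl]) (use that in blast)
  have pprd: "p \<subseteq> prd W" for W using prd_incl[of W] by simp
  have Ydec: "Y (Suc n) \<subseteq> Y n" for n
  proof (induction n)
    case 0 then show ?case using YC by (simp add: Y0)
  next
    case (Suc n)
    have "generated C (p \<union> {a * z | a z. a \<in> Q \<and> z \<in> Y (Suc n)}) \<subseteq> prd (Y n)"
    proof (intro generated_least idprd YC Un_least pprd subsetI)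
      fix x assume "x \<in> {a * z |a z. a \<in> Q \<and> z \<in> Y (Suc n)}"
      then show "x \<in> prd (Y n)" using Suc prdI[of _ _ "Y n"] by auto
    qed
    then have "prd (Y (Suc n)) \<subseteq> prd (Y n)" by (simp only: prd_def)
    then show ?case unfolding YS[of "Suc n"] YS[of n] by (rule saturation_mono)
  qed
  let ?J = "\<lambda>n. saturation P (plus_gen C (Y n) f)"
  have idJ: "ideal_in C (plus_gen C (Y n) f)" for n by (rule ideal_plus_gen[OF idY fC])
  have art: "artinian_mod P (saturation P (plus_gen C p f))"
    by (rule artinian_minimal_over[OF noe min ideal_plus_gen[OF idp fC]])
  have "p \<subseteq> Y n" for n
  proof (cases n)
    case 0 then show ?thesis using ideal_sub[OF idp] by (auto simp: Y0)
  next
    case (Suc m) then show ?thesis using pprd prd_sub by blast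
  qed
  then have lower: "saturation P (plus_gen C p f) \<subseteq> ?J n" for n
    by (intro saturation_mono) (auto simp: plus_gen_def)
  have "decseq ?J" unfolding decseq_Suc_iff
  proof
    fix n show "?J (Suc n) \<subseteq> ?J n" using Ydec[of n] by (intro saturation_mono) (auto simp: plus_gen_def)
  qed
  then have "stabilizes ?J"
    by (intro artinian_modD[OF art] ideal_saturation P idJ lower saturation_saturation)
  then obtain n where n: "?J (Suc n) = ?J n" unfolding stabilizes_def by (metis le_SucI order_refl)
  have YnS: "Y n \<subseteq> Y (Suc n)"
  proof (rule nakayama[OF noe P, of "{f}"])
    show "{f} \<subseteq> P" using f by simp
    show "ideal_in C (Y (Suc n))" by (rule idY)
    have "saturation P (Y (Suc n)) \<subseteq> saturation Q (Y (Suc n))" using saturation_mono2 chain by blast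
    then show "saturation P (Y (Suc n)) = Y (Suc n)" using satY saturation_incl[OF P YC] by blast
    show "Y n \<subseteq> C" by (rule YC)
    fix N y assume N: "ideal_in C N" "Y (Suc n) \<subseteq> N" "\<forall>a\<in>{f}. \<forall>z\<in>Y n. a * z \<in> N" and y: "y \<in> Y n"
    have yC: "y \<in> C" using y YC by blast
    have "y \<in> ?J n" using y plus_gen_incl[of "Y n" f] saturation_incl[OF P, of "plus_gen C (Y n) f"] ideal_sub[OF idJ] by blast
    then obtain s w r where s: "s \<in> C" "s \<notin> P" "s * y = w + r * f" "w \<in> Y (Suc n)" "r \<in> C"
      unfolding n[symmetric] by (auto simp: saturation_def plus_gen_def)
    have "r * f \<in> Y n"
      using ideal_add_cancel[OF idY, of w "r * f" n] ideal_mult[OF idY s(1) y] s Ydec by auto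
    then have "r \<in> Y n" using satD[OF satY fC fQ, of r n] s by (simp add: mult.commute)
    then have "r * f \<in> N" using N(3) by (simp add: mult.commute[of r f])
    then have "s * y \<in> N" using s N(2) ideal_add[OF N(1), of w "r * f"] by auto
    then show "y \<in> saturation P N" using s(1,2) yC unfolding saturation_def by blast
  qed
  have "Y n \<subseteq> p"
  proof (rule nakayama[OF noe Q, of Q])
    show "saturation Q p = p"
    proof
      show "saturation Q p \<subseteq> p" using saturation_mono2[of p Q p] chain saturation_prime[OF p] by auto
      show "p \<subseteq> saturation Q p" using saturation_incl[OF Q] ideal_sub[OF idp] by blast
    qed
    fix N y assume N: "ideal_in C N" "p \<subseteq> N" "\<forall>a\<in>Q. \<forall>z\<in>Y n. a * z \<in> N" and y: "y \<in> Y n"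
    have "prd (Y n) \<subseteq> N" unfolding prd_def using N by (intro generated_least) auto
    then have "Y (Suc n) \<subseteq> saturation Q N" unfolding YS by (rule saturation_mono)
    then show "y \<in> saturation Q N" using y YnS by blast
  qed (use idp YC in auto)
  moreover obtain q where q: "q \<in> Q" "q \<notin> p" using chain by blast
  have qC: "q \<in> C" using ideal_sub[OF idQ q(1)] .
  have "q ^ m \<in> Y m" for m
  proof (induction m)
    case 0 then show ?case using one_in by (simp add: Y0)
  next
    case (Suc m) then show ?case using prdI[OF q(1)] prd_sub by auto
  qed
  ultimately show False using prime_power[OF p qC] q by blast
qed

lemma prime_chain_prime: "prime_chain C K r P \<Longrightarrow> prime_in C P" by (cases r) auto
lemma prime_chain_incl: "prime_chain C K r P \<Longrightarrow> K \<subseteq> P" by (induction r arbitrary: P) auto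

text \<open>
  Working downwards from \<open>P\<close>: given \<open>Q0 \<subset> Q \<subset> P\<close> with \<open>u \<in> P\<close> and \<open>u \<notin> Q0\<close>, replace \<open>Q\<close> by a
  prime minimal over \<open>Q0 + (u)\<close> inside \<open>P\<close>. By the principal ideal theorem it is not \<open>P\<close> itself.
\<close>

lemma prime_chain_slide:
  assumes noe: "noetherian C"
  shows "prime_chain C K (Suc r) P \<Longrightarrow> u \<in> P \<Longrightarrow> prime_chain C (insert u K) r P"
proof (induction r arbitrary: P)
  case 0
  then show ?case by auto
next
  case (Suc r)
  then obtain Q0 Q where Q: "prime_chain C K r Q0" "Q0 \<subset> Q" "Q \<subset> P" "prime_in C Q" "prime_in C P"
    by auto
  have Q0: "prime_in C Q0" using Q(1) prime_chain_prime by blast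
  obtain Q' where Q': "prime_in C Q'" "Q0 \<subset> Q'" "Q' \<subset> P" "u \<in> Q'"
  proof (cases "u \<in> Q0")
    case True
    then show ?thesis using that[of Q] Q by blast
  next
    case False
    have "plus_gen C Q0 u \<subseteq> P" using plus_gen_least[OF prime_ideal[OF Q(5)], of Q0 u] Q Suc.prems(2) by blast
    then obtain Q' where m: "minimal_over (plus_gen C Q0 u) Q'" "Q' \<subseteq> P"
      using exists_minimal_over[OF Q(5)] by blast
    then have "Q' \<noteq> P" using principal_ideal[OF noe Q0 Q(4,5,2,3) Suc.prems(2)] by blast
    moreover have "prime_in C Q'" "Q0 \<subseteq> Q'" "u \<in> Q'"
      using m(1) plus_gen_incl[of Q0 u] plus_gen_self[OF prime_ideal[OF Q0], of u] by (auto simp: minimal_over_def)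
    ultimately show ?thesis using that[of Q'] m False by blast
  qed
  then have "prime_chain C K (Suc r) Q'" using Q by auto
  then have "prime_chain C (insert u K) r Q'" using Suc.IH Q' by blast
  then show ?case using Q' Q(5) by auto
qed

text \<open>
  The lowest prime of the chain contains \<open>b\<close>, but the minimal primes of \<open>K\<close> consist of zerodivisors
  and do not.
\<close>

lemma prime_chain_extend_below:
  assumes "noetherian C" "ideal_in C K" "nzd_mod C K b"
  shows "prime_chain C (insert b K) r P \<Longrightarrow> prime_chain C K (Suc r) P"
proof (induction r arbitrary: P)
  case 0
  then have P: "prime_in C P" "K \<subseteq> P" "b \<in> P" by auto
  then obtain Q where Q: "minimal_over K Q" "Q \<subseteq> P" using exists_minimal_over by blast
  then have "b \<notin> Q" using minimal_over_zero_divisors assms by blast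
  then show ?case using P Q by (auto simp: minimal_over_def)
next
  case (Suc r)
  from Suc.prems obtain Q where "prime_in C P" "prime_chain C (insert b K) r Q" "Q \<subset> P" by auto
  then show ?case using Suc.IH[of Q] prime_chain.simps(2)[of C K "Suc r" P] by blast
qed

end

section \<open>Prime avoidance and regular sequences\<close>

context comm_subring begin

text \<open>
  Induction on the number of primes. The correction term is a multiple \<open>cb\<close> of an element of \<open>I\<close>
  outside \<open>P\<close>, where \<open>c\<close> lies outside \<open>P\<close> but in each of the other primes that is not
  contained in \<open>P\<close>.
\<close>

lemma prime_avoidance:
  assumes "finite \<P>" "\<And>P. P \<in> \<P> \<Longrightarrow> prime_in C P" and I: "ideal_in C I" and "I \<subseteq> \<Union>\<P>"
  shows "\<exists>P\<in>\<P>. I \<subseteq> P"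
  using assms(1,2,4)
proof (induction \<P> rule: finite_induct)
  case empty
  then show ?case using ideal_zero[OF I] by auto
next
  case (insert P \<P>)
  show ?case
  proof (rule ccontr)
    assume no: "\<not> ?case"
    then have "\<not> I \<subseteq> \<Union>\<P>" using insert by auto
    then obtain a where a: "a \<in> I" "a \<notin> \<Union>\<P>" by blast
    then have aP: "a \<in> P" using insert.prems by blast
    have P: "prime_in C P" using insert.prems by blast
    obtain b where b: "b \<in> I" "b \<notin> P" using no by auto
    have "\<exists>c. c \<in> C \<and> c \<notin> P \<and> (\<forall>Q\<in>\<Q>. c \<in> Q)" if "finite \<Q>" "\<Q> \<subseteq> {Q \<in> \<P>. \<not> Q \<subseteq> P}" for \<Q>
      using that
    proof (induction \<Q> rule: finite_induct)
      case empty
      then show ?case using one_in prime_one[OF P] by auto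
    next
      case (insert Q \<Q>)
      then obtain c where c: "c \<in> C" "c \<notin> P" "\<forall>Q\<in>\<Q>. c \<in> Q" by auto
      obtain q where q: "q \<in> Q" "q \<notin> P" using insert.prems by auto
      have pr: "prime_in C Q'" if "Q' \<in> insert Q \<Q>" for Q' using that insert.prems \<open>\<And>Pa. Pa \<in> Set.insert P \<P> \<Longrightarrow> prime_in C Pa\<close> by blast
      then have qC: "q \<in> C" using q ideal_sub prime_ideal by blast
      have "c * q \<notin> P" using prime_cases[OF P c(1) qC] c q by blast
      moreover have "c * q \<in> Q'" if "Q' \<in> insert Q \<Q>" for Q'
        using that c q qC ideal_mult[OF prime_ideal[OF pr[OF that]], of c q]
          ideal_mult2[OF prime_ideal[OF pr[OF that]], of q c] by auto
      ultimately show ?case using mult_in[OF c(1) qC] by blast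
    qed
    from this[of "{Q \<in> \<P>. \<not> Q \<subseteq> P}"] insert.hyps
    obtain c where c: "c \<in> C" "c \<notin> P" "\<And>Q. Q \<in> \<P> \<Longrightarrow> \<not> Q \<subseteq> P \<Longrightarrow> c \<in> Q" by auto
    have aC: "a \<in> C" and bC: "b \<in> C" using a b ideal_sub[OF I] by auto
    have cb: "c * b \<notin> P" using prime_cases[OF P c(1) bC] c b by blast
    have "a + c * b \<in> I" using a b c by (meson I ideal_add ideal_mult)
    then obtain Q where Q: "Q \<in> insert P \<P>" "a + c * b \<in> Q" using insert.prems by blast
    have idQ: "ideal_in C Q" using Q insert.prems prime_ideal by blast
    show False
    proof (cases "Q = P")
      case True
      then show ?thesis using ideal_add_cancel[OF idQ Q(2)] aP cb by blast
    next
      case False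
      then have QP: "Q \<in> \<P>" using Q by blast
      show ?thesis
      proof (cases "Q \<subseteq> P")
        case True
        then have "a + c * b \<in> P" using Q by blast
        then show ?thesis using ideal_add_cancel[OF prime_ideal[OF P], of a "c * b"] aP cb by blast
      next
        case False
        then have "c * b \<in> Q" using c(3) QP ideal_mult2[OF idQ bC] by blast
        then have "a \<in> Q" using ideal_add_cancel[OF idQ, of "c * b" a] Q(2) by (simp add: add.commute)
        then show ?thesis using a QP by blast
      qed
    qed
  qed
qed

text \<open>
  The maximal annihilators of nonzero elements modulo \<open>K\<close>. In a Noetherian ring their union is
  the set of zerodivisors, so they play the part of the associated primes.
\<close>

definition max_colons :: "'r set \<Rightarrow> 'r set set" where
  "max_colons K = {colon C K z | z. z \<in> C \<and> z \<notin> K \<and>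
     (\<forall>w\<in>C. w \<notin> K \<longrightarrow> colon C K z \<subseteq> colon C K w \<longrightarrow> colon C K w = colon C K z)}"

text \<open>
  Among infinitely many different maximal annihilators \<open>P i = K : z i\<close>, some \<open>z n\<close> lies in the ideal
  generated by \<open>K\<close> and its predecessors. Then \<open>P 0 \<inter> \<dots> \<inter> P (n - 1) \<subseteq> P n\<close>, so \<open>P i \<subseteq> P n\<close> for some
  \<open>i < n\<close>, and maximality forces \<open>P i = P n\<close>.
\<close>

lemma finite_max_colons:
  assumes "noetherian C" and K: "ideal_in C K"
  shows "finite (max_colons K)"
proof (rule ccontr)
  assume "infinite (max_colons K)"
  then obtain P :: "nat \<Rightarrow> 'r set" where inj: "inj P" and P: "range P \<subseteq> max_colons K"
    using infinite_countable_subset by blast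
  have "\<forall>i. \<exists>z. P i = colon C K z \<and> z \<in> C \<and> z \<notin> K"
    using P unfolding max_colons_def by blast
  then obtain z where z: "\<And>i. P i = colon C K (z i)" "\<And>i. z i \<in> C" "\<And>i. z i \<notin> K" by metis
  have max: "colon C K w = P i" if "w \<in> C" "w \<notin> K" "P i \<subseteq> colon C K w" for w i
    using P that unfolding max_colons_def by (auto simp: image_subset_iff)
  have prime: "prime_in C (P i)" for i
    using colon_maximal_prime[OF K z(2,3), of i] max[of _ i] z(1) by auto
  let ?G = "\<lambda>n. generated C (K \<union> z ` {..<n})"
  have idG: "ideal_in C (?G n)" for n
    using ideal_sub[OF K] z(2) by (intro ideal_generated) auto
  have zG: "z i \<in> ?G n" if "i < n" for i n using generated_incl[of "K \<union> z ` {..<n}"] that by auto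
  have S1: "?G 0 \<in> range ?G" by (rule rangeI)
  have S2: "ideal_in C I" if "I \<in> range ?G" for I using that idG by blast
  obtain M where M: "M \<in> range ?G" and max': "\<forall>I\<in>range ?G. M \<subseteq> I \<longrightarrow> I = M"
    by (rule bexE[OF noetherian_max[OF assms(1) S1 S2]])
  then obtain n where n: "M = ?G n" by blast
  have "?G n \<subseteq> ?G (Suc n)" using generated_incl[of "K \<union> z ` {..<Suc n}"] by (intro generated_least idG) auto
  then have "?G (Suc n) = ?G n" using max' n by auto
  then have zn: "z n \<in> ?G n" using zG[of n "Suc n"] by simp
  have kill: "c * z n \<in> K" if c: "c \<in> C" "\<And>i. i < n \<Longrightarrow> c \<in> P i" for c
  proof -
    have "ideal_in C {y \<in> C. c * y \<in> K}" (is "ideal_in C ?N")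
      using ideal_colon[OF K c(1)] by (simp add: colon_def mult.commute)
    moreover have "K \<union> z ` {..<n} \<subseteq> ?N"
      using c z ideal_sub[OF K] ideal_mult[OF K c(1)] by (auto simp: colon_def)
    ultimately have "?G n \<subseteq> ?N" by (rule generated_least)
    then show ?thesis using zn by auto
  qed
  have "\<exists>c\<in>C. (\<forall>i<m. c \<in> P i) \<and> c \<notin> P n" if "m \<le> n" for m
    using that
  proof (induction m)
    case 0
    then show ?case using one_in prime_one[OF prime] by auto
  next
    case (Suc m)
    then obtain c where c: "c \<in> C" "\<forall>i<m. c \<in> P i" "c \<notin> P n" by auto
    have "\<not> P m \<subseteq> P n" using max[of "z n" m] z Suc inj by (metis Suc_n_not_le_n injD)
    then obtain d where d: "d \<in> P m" "d \<notin> P n" by blast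
    have dC: "d \<in> C" using ideal_sub[OF prime_ideal[OF prime] d(1)] .
    have "c * d \<notin> P n" using prime_cases[OF prime c(1) dC] c d by blast
    moreover have "c * d \<in> P i" if "i < Suc m" for i
      using that c d dC ideal_mult[OF prime_ideal[OF prime] c(1)]
        ideal_mult2[OF prime_ideal[OF prime] dC] by (cases "i = m") auto
    ultimately show ?case using mult_in[OF c(1) dC] by blast
  qed
  then obtain c where c: "c \<in> C" "\<forall>i<n. c \<in> P i" "c \<notin> P n" by blast
  then show False using kill[of c] z(1)[of n] by (auto simp: colon_def)
qed

text \<open>
  No nonzero element modulo \<open>K\<close> is annihilated by \<open>m\<close>. In a Noetherian ring this says that \<open>m\<close>
  contains a nonzerodivisor modulo \<open>K\<close>.
\<close>

definition regular_ideal :: "'r set \<Rightarrow> 'r set \<Rightarrow> bool" where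
  "regular_ideal m K \<longleftrightarrow> (\<forall>z\<in>C. (\<forall>c\<in>m. c * z \<in> K) \<longrightarrow> z \<in> K)"

lemma nzd_mod_imp_regular_ideal: "a \<in> m \<Longrightarrow> nzd_mod C K a \<Longrightarrow> regular_ideal m K"
  by (auto simp: regular_ideal_def nzd_mod_def)

text \<open>
  If every element of \<open>m\<close> is a zerodivisor modulo some \<open>K\<close>, then \<open>m\<close> is covered by finitely many
  prime colon ideals, hence contained in one of them.
\<close>

lemma exists_common_nzd_mod:
  assumes "noetherian C" and m: "ideal_in C m" and "finite \<K>"
    and K: "\<And>K. K \<in> \<K> \<Longrightarrow> ideal_in C K" "\<And>K. K \<in> \<K> \<Longrightarrow> regular_ideal m K"
  shows "\<exists>a\<in>m. \<forall>K\<in>\<K>. nzd_mod C K a"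
proof (rule ccontr)
  assume no: "\<not> ?thesis"
  let ?\<P> = "\<Union>K\<in>\<K>. max_colons K"
  have "m \<subseteq> \<Union>?\<P>"
  proof
    fix a assume a: "a \<in> m"
    then obtain K where Km: "K \<in> \<K>" "\<not> nzd_mod C K a" using no by blast
    then obtain w where w: "w \<in> C" "w \<notin> K" "a * w \<in> K" by (auto simp: nzd_mod_def)
    obtain z where z: "z \<in> C" "z \<notin> K" "colon C K w \<subseteq> colon C K z"
      "\<And>w. w \<in> C \<Longrightarrow> w \<notin> K \<Longrightarrow> colon C K z \<subseteq> colon C K w \<Longrightarrow> colon C K w = colon C K z"
      by (rule exists_maximal_colon[OF assms(1) K(1)[OF Km(1)] w(1,2)]) (rule that)
    have "colon C K z \<in> max_colons K" unfolding max_colons_def using z by blast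
    moreover have "a \<in> colon C K w" using w a ideal_sub[OF m] by (simp add: colon_def)
    ultimately show "a \<in> \<Union>?\<P>" using z(3) Km(1) by blast
  qed
  moreover have "finite ?\<P>" using assms(3) finite_max_colons[OF assms(1) K(1)] by blast
  moreover have pr: "\<exists>K\<in>\<K>. \<exists>z. P = colon C K z \<and> z \<in> C \<and> z \<notin> K \<and> prime_in C P" if Pmem: "P \<in> ?\<P>" for P
  proof -
    obtain K z where z: "K \<in> \<K>" "P = colon C K z" "z \<in> C" "z \<notin> K"
      "\<forall>w\<in>C. w \<notin> K \<longrightarrow> colon C K z \<subseteq> colon C K w \<longrightarrow> colon C K w = colon C K z"
      using Pmem unfolding max_colons_def by blast
    have "prime_in C (colon C K z)"
      by (rule colon_maximal_prime[OF K(1)[OF z(1)] z(3,4)]) (use z(5) in blast)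
    then show ?thesis using z by blast
  qed
  ultimately obtain P where P: "P \<in> ?\<P>" "m \<subseteq> P"
    using prime_avoidance[of ?\<P>, OF _ _ m] by blast
  then obtain K' z where K': "K' \<in> \<K>" "P = colon C K' z" "z \<in> C" "z \<notin> K'" using pr by blast
  have "\<forall>c\<in>m. c * z \<in> K'" using P K' by (auto simp: colon_def)
  then show False using K(2)[OF K'(1)] K' by (auto simp: regular_ideal_def)
qed

text \<open>
  If \<open>m z \<subseteq> K + (y)\<close>, write \<open>x z = k + w y\<close>. Then \<open>m w \<subseteq> K + (x)\<close>, so \<open>w \<in> K + (x)\<close>, and
  cancelling \<open>x\<close> shows \<open>z \<in> K + (y)\<close>.
\<close>

lemma regular_ideal_exchange:
  assumes K: "ideal_in C K" and m: "ideal_in C m"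
    and x: "x \<in> m" "nzd_mod C K x" and y: "y \<in> m" "nzd_mod C K y"
    and reg: "regular_ideal m (plus_gen C K x)"
  shows "regular_ideal m (plus_gen C K y)"
  unfolding regular_ideal_def
proof (intro ballI impI)
  fix z assume z: "z \<in> C" "\<forall>c\<in>m. c * z \<in> plus_gen C K y"
  have xC: "x \<in> C" and yC: "y \<in> C" using x y ideal_sub[OF m] by auto
  obtain k w where kw: "x * z = k + w * y" "k \<in> K" "w \<in> C" using z x by (auto simp: plus_gen_def)
  have "c * w \<in> plus_gen C K x" if c: "c \<in> m" for c
  proof -
    have cC: "c \<in> C" using c ideal_sub[OF m] by auto
    obtain k' v where kv: "c * z = k' + v * y" "k' \<in> K" "v \<in> C" using z c by (auto simp: plus_gen_def)
    have "y * (c * w - x * v) = x * (c * z - v * y) - c * (x * z - w * y)" by (simp add: algebra_simps)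
    also have "\<dots> = x * k' - c * k" using kv kw by simp
    also have "\<dots> \<in> K" using kv kw xC cC by (meson ideal_diff ideal_mult K)
    finally have "c * w - x * v \<in> K" using y xC cC kv kw by (auto simp: nzd_mod_def intro: in_C)
    moreover have "c * w = (c * w - x * v) + v * x" by simp
    ultimately show ?thesis using kv unfolding plus_gen_def by blast
  qed
  then have "w \<in> plus_gen C K x" using reg kw by (auto simp: regular_ideal_def)
  then obtain k'' w' where kw': "w = k'' + w' * x" "k'' \<in> K" "w' \<in> C" by (auto simp: plus_gen_def)
  have "x * (z - w' * y) = k + y * k''" using kw(1) kw'(1) by (simp add: algebra_simps)
  also have "\<dots> \<in> K" using kw kw' yC by (meson ideal_add ideal_mult K)
  finally have "z - w' * y \<in> K" using x z kw' yC by (auto simp: nzd_mod_def intro: in_C)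
  moreover have "z = (z - w' * y) + w' * y" by simp
  ultimately show "z \<in> plus_gen C K y" using kw' unfolding plus_gen_def by blast
qed

lemma nzd_mod_swap:
  assumes K: "ideal_in C K" and x: "x \<in> C" "nzd_mod C K x" and y: "y \<in> C" "nzd_mod C K y" "nzd_mod C (plus_gen C K x) y"
  shows "nzd_mod C (plus_gen C K y) x"
  unfolding nzd_mod_def
proof (intro ballI impI)
  fix w assume w: "w \<in> C" "x * w \<in> plus_gen C K y"
  then obtain k v where kv: "x * w = k + v * y" "k \<in> K" "v \<in> C" by (auto simp: plus_gen_def)
  have "y * v = - k + w * x" using kv(1) by (simp add: algebra_simps)
  then have "y * v \<in> plus_gen C K x" using ideal_uminus[OF K kv(2)] w unfolding plus_gen_def by blast
  then have "v \<in> plus_gen C K x" using y(3) kv by (auto simp: nzd_mod_def)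
  then obtain k' v' where kv': "v = k' + v' * x" "k' \<in> K" "v' \<in> C" by (auto simp: plus_gen_def)
  have "x * (w - v' * y) = k + y * k'" using kv(1) kv'(1) by (simp add: algebra_simps)
  also have "\<dots> \<in> K" using kv kv' y(1) by (meson ideal_add ideal_mult K)
  finally have "w - v' * y \<in> K" using x w kv' y(1) by (auto simp: nzd_mod_def intro: in_C)
  moreover have "w = (w - v' * y) + v' * y" by simp
  ultimately show "w \<in> plus_gen C K y" using kv' unfolding plus_gen_def by blast
qed

text \<open>
  The ideal \<open>m\<close> contains a regular sequence of the given length modulo \<open>K\<close>. The recursion exposes
  the first member of the sequence, which is the one that the exchange argument replaces.
\<close>

primrec has_regseq :: "'r set \<Rightarrow> nat \<Rightarrow> 'r set \<Rightarrow> bool" where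
  "has_regseq m 0 K \<longleftrightarrow> True"
| "has_regseq m (Suc j) K \<longleftrightarrow> (\<exists>b\<in>m. nzd_mod C K b \<and> has_regseq m j (plus_gen C K b))"

text \<open>
  Factoring out one nonzerodivisor lowers the depth by at most one. Let \<open>b\<close> start a regular sequence
  of length \<open>j + 2\<close>, and choose \<open>z \<in> m\<close> regular modulo \<open>K\<close>, \<open>K + (b)\<close> and \<open>K + (c)\<close> at once. The
  induction hypothesis replaces the second member by \<open>z\<close>; then \<open>z\<close> is moved to the front, where
  \<open>b\<close> can be exchanged for \<open>c\<close> modulo \<open>K + (z)\<close>, and moved behind \<open>c\<close> again.
\<close>

theorem has_regseq_exchange:
  assumes noe: "noetherian C" and m: "ideal_in C m"
  shows "ideal_in C K \<Longrightarrow> has_regseq m (Suc j) K \<Longrightarrow> c \<in> m \<Longrightarrow> nzd_mod C K c \<Longrightarrow> has_regseq m j (plus_gen C K c)"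
proof (induction j arbitrary: K c)
  case 0
  then show ?case by simp
next
  case (Suc j)
  have K: "ideal_in C K" and c: "c \<in> m" "nzd_mod C K c" by fact+
  obtain b where b: "b \<in> m" "nzd_mod C K b" "has_regseq m (Suc j) (plus_gen C K b)" using Suc.prems(2) by auto
  have bC: "b \<in> C" and cC: "c \<in> C" using b c ideal_sub[OF m] by auto
  have Kb: "ideal_in C (plus_gen C K b)" and Kc: "ideal_in C (plus_gen C K c)" using ideal_plus_gen[OF K] bC cC by auto
  have rb: "regular_ideal m (plus_gen C K b)" using b(3) nzd_mod_imp_regular_ideal by auto
  have rc: "regular_ideal m (plus_gen C K c)"
    by (rule regular_ideal_exchange[OF K m b(1,2) c rb])
  have "\<exists>z\<in>m. \<forall>K'\<in>{K, plus_gen C K b, plus_gen C K c}. nzd_mod C K' z"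
    using K Kb Kc rb rc nzd_mod_imp_regular_ideal[OF b(1,2)]
    by (intro exists_common_nzd_mod[OF noe m]) auto
  then obtain z where z: "z \<in> m" "nzd_mod C K z" "nzd_mod C (plus_gen C K b) z" "nzd_mod C (plus_gen C K c) z" by auto
  have zC: "z \<in> C" using z ideal_sub[OF m] by auto
  have Kz: "ideal_in C (plus_gen C K z)" using ideal_plus_gen[OF K] zC by auto
  have "has_regseq m j (plus_gen C (plus_gen C K b) z)" by (rule Suc.IH[OF Kb b(3) z(1,3)])
  then have "has_regseq m j (plus_gen C (plus_gen C K z) b)" using plus_gen_commute[OF K bC zC] by simp
  moreover have "nzd_mod C (plus_gen C K z) b" by (rule nzd_mod_swap[OF K bC b(2) zC z(2,3)])
  ultimately have "has_regseq m (Suc j) (plus_gen C K z)" using b(1) by auto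
  moreover have "nzd_mod C (plus_gen C K z) c" by (rule nzd_mod_swap[OF K cC c(2) zC z(2,4)])
  ultimately have "has_regseq m j (plus_gen C (plus_gen C K z) c)" using Suc.IH[OF Kz _ c(1)] by blast
  then have "has_regseq m j (plus_gen C (plus_gen C K c) z)" using plus_gen_commute[OF K cC zC] by simp
  then show ?case using z by auto
qed

lemma has_regseq_mono: "has_regseq m j K \<Longrightarrow> i \<le> j \<Longrightarrow> has_regseq m i K"
proof (induction j arbitrary: i K)
  case (Suc j)
  then show ?case by (cases i) auto
qed simp

end

section \<open>Polynomials over a subring and Hilbert's basis theorem\<close>

text \<open>
  For a subring \<open>C\<close> this is \<open>C[y]\<close>, and for an ideal \<open>K\<close> of \<open>C\<close> it is the extended ideal
  \<open>K C[y]\<close>.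
\<close>

definition polys :: "'r::comm_ring_1 set \<Rightarrow> 'r poly set" where
  "polys K = {p. \<forall>i. coeff p i \<in> K}"

definition contraction :: "'r::comm_ring_1 poly set \<Rightarrow> 'r set" where
  "contraction Q = {c. [:c:] \<in> Q}"

text \<open>
  Equivalent to the usual definition that every prime is an intersection of maximal ideals, in the form
  that passes to polynomial rings by induction: a prime that is isolated below its proper prime
  overideals by a single element \<open>c\<close> is maximal.
\<close>

definition jacobson :: "'r::comm_ring_1 set \<Rightarrow> bool" where
  "jacobson C \<longleftrightarrow> (\<forall>P c. prime_in C P \<longrightarrow> c \<in> C - P \<longrightarrow>
     (\<forall>P'. prime_in C P' \<longrightarrow> P \<subset> P' \<longrightarrow> c \<in> P') \<longrightarrow> maximal_in C P)"

lemma polysI: "(\<And>i. coeff p i \<in> K) \<Longrightarrow> p \<in> polys K" by (simp add: polys_def)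
lemma polysD: "p \<in> polys K \<Longrightarrow> coeff p i \<in> K" by (simp add: polys_def)
lemma polys_mono: "K \<subseteq> L \<Longrightarrow> polys K \<subseteq> polys L" by (auto simp: polys_def)

lemma degree_less_if: "degree f \<le> d \<Longrightarrow> coeff f d = 0 \<Longrightarrow> f = 0 \<or> degree f < d"
  by (metis le_neq_implies_less leading_coeff_0_iff)

context comm_subring begin

lemma polys_subring: "comm_subring (polys C)"
proof
  show "1 \<in> polys C" by (auto intro!: polysI in_C simp: coeff_1)
  show "a - b \<in> polys C" if "a \<in> polys C" "b \<in> polys C" for a b
    using that by (auto intro!: polysI in_C dest: polysD)
  show "a * b \<in> polys C" if "a \<in> polys C" "b \<in> polys C" for a b
    using that by (auto intro!: polysI in_C dest: polysD simp: coeff_mult)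
qed

interpretation P: comm_subring "polys C" by (rule polys_subring)

lemma polys_ideal:
  assumes K: "ideal_in C K" shows "ideal_in (polys C) (polys K)"
  unfolding ideal_in_def
proof (intro conjI ballI)
  show "polys K \<subseteq> polys C" using ideal_sub[OF K] by (auto simp: polys_def)
  show "0 \<in> polys K" using ideal_zero[OF K] by (auto simp: polys_def)
  show "a + b \<in> polys K" if "a \<in> polys K" "b \<in> polys K" for a b
    using that ideal_add[OF K] by (auto simp: polys_def)
  show "c * a \<in> polys K" if "c \<in> polys C" "a \<in> polys K" for c a
    using that ideal_mult[OF K] by (auto simp: polys_def coeff_mult intro!: ideal_sum[OF K])
qed

lemma const_in_polys: "ideal_in C K \<Longrightarrow> c \<in> K \<Longrightarrow> [:c:] \<in> polys K"
  using ideal_zero[of K] by (auto simp: polys_def coeff_pCons split: nat.split)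

lemma monom_in_polys: "ideal_in C K \<Longrightarrow> c \<in> K \<Longrightarrow> monom c n \<in> polys K"
  using ideal_zero[of K] by (auto simp: polys_def)

lemmas const_in = const_in_polys[OF ideal_UNIV]
lemmas monom_in = monom_in_polys[OF ideal_UNIV]

lemma smult_in: "c \<in> C \<Longrightarrow> f \<in> polys K \<Longrightarrow> ideal_in C K \<Longrightarrow> smult c f \<in> polys K"
  using ideal_mult[of K] by (auto simp: polys_def)

lemma var_in: "[:0, 1:] \<in> polys C"
  using zero_in one_in by (auto simp: polys_def coeff_pCons split: nat.split)

lemma polys_least:
  assumes I: "ideal_in (polys C) I" and K: "ideal_in C K" "\<And>k. k \<in> K \<Longrightarrow> [:k:] \<in> I"
  shows "polys K \<subseteq> I"
proof
  fix f assume f: "f \<in> polys K"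
  have "monom c n \<in> I" if "c \<in> K" for c n
    using P.ideal_mult[OF I monom_in[OF one_in] K(2)[OF that], of n] by (simp add: mult_monom monom_0[symmetric])
  then have "(\<Sum>i\<le>degree f. monom (coeff f i) i) \<in> I"
    using f by (intro P.ideal_sum[OF I]) (auto dest: polysD)
  then show "f \<in> I" by (simp add: poly_as_sum_of_monoms)
qed

lemma polys_plus_gen:
  assumes K: "ideal_in C K" and b: "b \<in> C"
  shows "plus_gen (polys C) (polys K) [:b:] = polys (plus_gen C K b)"
proof
  have A: "ideal_in C (plus_gen C K b)" by (rule ideal_plus_gen[OF K b])
  show "plus_gen (polys C) (polys K) [:b:] \<subseteq> polys (plus_gen C K b)"
    by (intro P.plus_gen_least polys_ideal A polys_mono plus_gen_incl const_in_polys plus_gen_self K)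
  show "polys (plus_gen C K b) \<subseteq> plus_gen (polys C) (polys K) [:b:]"
  proof (rule polys_least[OF P.ideal_plus_gen[OF polys_ideal[OF K] const_in[OF b]] A])
    fix x assume "x \<in> plus_gen C K b"
    then obtain k c where "x = k + c * b" "k \<in> K" "c \<in> C" by (auto simp: plus_gen_def)
    then have "[:x:] = [:k:] + [:c:] * [:b:]" "[:k:] \<in> polys K" "[:c:] \<in> polys C"
      using const_in_polys[OF K] const_in by auto
    then show "[:x:] \<in> plus_gen (polys C) (polys K) [:b:]" unfolding plus_gen_def by blast
  qed
qed

lemma contraction_ideal:
  assumes Q: "ideal_in (polys C) Q" shows "ideal_in C (contraction Q)"
  unfolding ideal_in_def
proof (intro conjI ballI)
  show "contraction Q \<subseteq> C" using P.ideal_sub[OF Q] polysD[of _ C 0] by (fastforce simp: contraction_def)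
  show "0 \<in> contraction Q" using P.ideal_zero[OF Q] by (simp add: contraction_def)
  show "a + b \<in> contraction Q" if "a \<in> contraction Q" "b \<in> contraction Q" for a b
    using that P.ideal_add[OF Q, of "[:a:]" "[:b:]"] by (simp add: contraction_def)
  show "c * a \<in> contraction Q" if "c \<in> C" "a \<in> contraction Q" for c a
    using that P.ideal_mult[OF Q const_in, of c "[:a:]"] by (simp add: contraction_def mult.commute[of a c])
qed

lemma contraction_prime:
  assumes Q: "prime_in (polys C) Q" shows "prime_in C (contraction Q)"
  unfolding prime_in_def
proof (intro conjI ballI impI)
  show "ideal_in C (contraction Q)" by (rule contraction_ideal[OF P.prime_ideal[OF Q]])
  show "1 \<notin> contraction Q" using P.prime_one[OF Q] by (simp add: contraction_def one_pCons)
  show "a \<in> contraction Q \<or> b \<in> contraction Q" if "a \<in> C" "b \<in> C" "a * b \<in> contraction Q" for a b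
    using that P.prime_cases[OF Q const_in const_in, of a b] by (simp add: contraction_def mult.commute[of b a])
qed

lemma polys_contraction_sub: "ideal_in (polys C) Q \<Longrightarrow> polys (contraction Q) \<subseteq> Q"
  by (rule polys_least[OF _ contraction_ideal]) (auto simp: contraction_def)

lemma contraction_polys: "ideal_in C K \<Longrightarrow> contraction (polys K) = K"
  using polysD[of _ K 0] const_in_polys[of K] by (fastforce simp: contraction_def)

text \<open>
  Working modulo an ideal, the top coefficient is the last one outside the ideal, which need not be
  the leading coefficient.
\<close>

lemma coeff_mult_top:
  assumes K: "ideal_in C K" and f: "f \<in> polys C" "\<And>a. a > i \<Longrightarrow> coeff f a \<in> K"
    and g: "g \<in> polys C" "\<And>b. b > j \<Longrightarrow> coeff g b \<in> K"
  shows "coeff (f * g) (i + j) - coeff f i * coeff g j \<in> K"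
proof -
  have "coeff (f * g) (i + j) =
      (\<Sum>a\<le>i + j. coeff f a * coeff g (i + j - a))"
    by (rule coeff_mult)
  also have "\<dots> = coeff f i * coeff g j +
      (\<Sum>a\<in>{..i + j} - {i}. coeff f a * coeff g (i + j - a))"
    by (subst sum.remove[of _ i]) auto
  finally have "coeff (f * g) (i + j) - coeff f i * coeff g j =
      (\<Sum>a\<in>{..i + j} - {i}. coeff f a * coeff g (i + j - a))" by simp
  also have "\<dots> \<in> K"
  proof (rule ideal_sum[OF K])
    fix a assume a: "a \<in> {..i + j} - {i}"
    show "coeff f a * coeff g (i + j - a) \<in> K"
    proof (cases "a > i")
      case True
      then show ?thesis using ideal_mult2[OF K polysD[OF g(1)]] f(2) by blast
    next
      case False
      then have "i + j - a > j" using a by auto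
      then show ?thesis using ideal_mult[OF K polysD[OF f(1)]] g(2) by blast
    qed
  qed
  finally show ?thesis .
qed

lemma top_coeff_outside:
  assumes K: "ideal_in C K" and f: "f \<notin> polys K"
  obtains i where "coeff f i \<notin> K" "\<And>a. a > i \<Longrightarrow> coeff f a \<in> K"
proof -
  let ?A = "{i. coeff f i \<notin> K}"
  have ne: "?A \<noteq> {}" using f by (auto simp: polys_def)
  have "a \<le> degree f" if "a \<in> ?A" for a
    using that ideal_zero[OF K] coeff_eq_0[of f a] by (metis mem_Collect_eq not_le)
  then have "?A \<subseteq> {..degree f}" by auto
  then have fin: "finite ?A" using finite_subset by blast
  have "coeff f (Max ?A) \<notin> K" using Max_in[OF fin ne] by simp
  moreover have "coeff f a \<in> K" if "a > Max ?A" for a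
    using Max_ge[OF fin, of a] that by auto
  ultimately show ?thesis by (rule that)
qed

lemma polys_prime:
  assumes p: "prime_in C p" shows "prime_in (polys C) (polys p)"
  unfolding prime_in_def
proof (intro conjI ballI impI)
  have I: "ideal_in C p" by (rule prime_ideal[OF p])
  show "ideal_in (polys C) (polys p)" by (rule polys_ideal[OF I])
  show "1 \<notin> polys p" using polysD[of 1 p 0] prime_one[OF p] by auto
  fix f g assume fg: "f \<in> polys C" "g \<in> polys C" "f * g \<in> polys p"
  show "f \<in> polys p \<or> g \<in> polys p"
  proof (rule ccontr)
    assume "\<not> ?thesis"
    then obtain i j where i: "coeff f i \<notin> p" "\<And>a. a > i \<Longrightarrow> coeff f a \<in> p"
      and j: "coeff g j \<notin> p" "\<And>a. a > j \<Longrightarrow> coeff g a \<in> p"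
      using top_coeff_outside[OF I] by metis
    have "coeff f i * coeff g j \<in> p"
      using coeff_mult_top[OF I fg(1) i(2) fg(2) j(2)] polysD[OF fg(3), of "i + j"]
        ideal_diff[OF I] by fastforce
    then show False using prime_cases[OF p polysD[OF fg(1)] polysD[OF fg(2)]] i j by blast
  qed
qed

lemma nzd_mod_top_coeff:
  assumes K: "ideal_in C K" and u: "u \<in> polys C" "\<And>i. i > n \<Longrightarrow> coeff u i \<in> K"
    and nz: "nzd_mod C K (coeff u n)"
  shows "nzd_mod (polys C) (polys K) u"
  unfolding nzd_mod_def
proof (intro ballI impI, rule ccontr)
  fix f assume f: "f \<in> polys C" "u * f \<in> polys K" "f \<notin> polys K"
  obtain i where i: "coeff f i \<notin> K" "\<And>a. a > i \<Longrightarrow> coeff f a \<in> K"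
    using top_coeff_outside[OF K f(3)] by blast
  have "coeff u n * coeff f i \<in> K"
    using coeff_mult_top[OF K u(1,2) f(1) i(2)] polysD[OF f(2), of "n + i"]
        ideal_diff[OF K] by fastforce
  then show False using nz i polysD[OF f(1)] by (auto simp: nzd_mod_def)
qed

lemma nzd_mod_lead_coeff:
  assumes K: "ideal_in C K" and u: "u \<in> polys C" and nz: "nzd_mod C K (lead_coeff u)"
  shows "nzd_mod (polys C) (polys K) u"
  by (rule nzd_mod_top_coeff[OF K u _ nz]) (use ideal_zero[OF K] in \<open>simp add: coeff_eq_0\<close>)

text \<open>
  Regular sequences extend to the polynomial ring, and a monic polynomial is regular modulo every
  extended ideal.
\<close>

lemma has_regseq_polys:
  assumes m: "m \<subseteq> C" and M: "(\<lambda>c. [:c:]) ` m \<subseteq> M" and u: "u \<in> M" "u \<in> polys C" "lead_coeff u = 1"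
  shows "ideal_in C K \<Longrightarrow> has_regseq m j K \<Longrightarrow> P.has_regseq M (Suc j) (polys K)"
proof (induction j arbitrary: K)
  case 0
  have "nzd_mod C K (lead_coeff u)" using u by (simp add: nzd_mod_def)
  then show ?case using nzd_mod_lead_coeff[OF 0(1) u(2)] u by auto
next
  case (Suc j)
  then obtain b where b: "b \<in> m" "nzd_mod C K b" "has_regseq m j (plus_gen C K b)" by auto
  have bC: "b \<in> C" using b m by auto
  have "P.has_regseq M (Suc j) (polys (plus_gen C K b))" by (rule Suc.IH[OF ideal_plus_gen[OF Suc.prems(1) bC] b(3)])
  then have "P.has_regseq M (Suc j) (plus_gen (polys C) (polys K) [:b:])" using polys_plus_gen[OF Suc.prems(1) bC] by simp
  moreover have "nzd_mod (polys C) (polys K) [:b:]"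
    using nzd_mod_lead_coeff[OF Suc.prems(1) const_in[OF bC]] b by simp
  ultimately show ?case using b M by (auto simp del: P.has_regseq.simps simp: P.has_regseq.simps(2)[of _ "Suc j"])
qed

lemma ideal_plus:
  assumes I: "ideal_in C I" and J: "ideal_in C J" shows "ideal_in C {a + b | a b. a \<in> I \<and> b \<in> J}"
  unfolding ideal_in_def
proof (intro conjI ballI)
  show "{a + b | a b. a \<in> I \<and> b \<in> J} \<subseteq> C" using ideal_sub[OF I] ideal_sub[OF J] add_in by auto
  show "0 \<in> {a + b | a b. a \<in> I \<and> b \<in> J}" using ideal_zero[OF I] ideal_zero[OF J] by force
next
  fix x y assume "x \<in> {a + b | a b. a \<in> I \<and> b \<in> J}" "y \<in> {a + b | a b. a \<in> I \<and> b \<in> J}"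
  then obtain a b a' b' where "x = a + b" "y = a' + b'" "a \<in> I" "a' \<in> I" "b \<in> J" "b' \<in> J" by blast
  then have "x + y = (a + a') + (b + b')" "a + a' \<in> I" "b + b' \<in> J"
    using ideal_add[OF I] ideal_add[OF J] by (auto simp: algebra_simps)
  then show "x + y \<in> {a + b | a b. a \<in> I \<and> b \<in> J}" by blast
next
  fix c x assume c: "c \<in> C" "x \<in> {a + b | a b. a \<in> I \<and> b \<in> J}"
  then obtain a b where "x = a + b" "a \<in> I" "b \<in> J" by blast
  then have "c * x = c * a + c * b" "c * a \<in> I" "c * b \<in> J"
    using ideal_mult[OF I c(1)] ideal_mult[OF J c(1)] by (auto simp: distrib_left)
  then show "c * x \<in> {a + b | a b. a \<in> I \<and> b \<in> J}" by blast
qed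

lemma plus_incl1: "ideal_in C J \<Longrightarrow> I \<subseteq> {a + b | a b. a \<in> I \<and> b \<in> J}"
  using ideal_zero[of J] by force
lemma plus_incl2: "ideal_in C I \<Longrightarrow> J \<subseteq> {a + b | a b. a \<in> I \<and> b \<in> J}"
  using ideal_zero[of I] by force

definition lead_ideal :: "'r poly set \<Rightarrow> nat \<Rightarrow> 'r set" where
  "lead_ideal J d = {coeff f d | f. f \<in> J \<and> degree f \<le> d}"

lemma ideal_lead_ideal:
  assumes J: "ideal_in (polys C) J" shows "ideal_in C (lead_ideal J d)"
  unfolding ideal_in_def
proof (intro conjI ballI)
  show "lead_ideal J d \<subseteq> C" using P.ideal_sub[OF J] polysD by (fastforce simp: lead_ideal_def)
  show "0 \<in> lead_ideal J d" using P.ideal_zero[OF J] by (force simp: lead_ideal_def)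
next
  fix a b assume "a \<in> lead_ideal J d" "b \<in> lead_ideal J d"
  then obtain f g where "a = coeff f d" "f \<in> J" "degree f \<le> d"
    "b = coeff g d" "g \<in> J" "degree g \<le> d" by (auto simp: lead_ideal_def)
  then have "a + b = coeff (f + g) d" "f + g \<in> J" "degree (f + g) \<le> d"
    using P.ideal_add[OF J] degree_add_le by auto
  then show "a + b \<in> lead_ideal J d" unfolding lead_ideal_def by blast
next
  fix c a assume c: "c \<in> C" "a \<in> lead_ideal J d"
  then obtain f where "a = coeff f d" "f \<in> J" "degree f \<le> d" by (auto simp: lead_ideal_def)
  then have "c * a = coeff ([:c:] * f) d" "[:c:] * f \<in> J" "degree ([:c:] * f) \<le> d"
    using P.ideal_mult[OF J const_in[OF c(1)]] degree_smult_le[of c f] by auto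
  then show "c * a \<in> lead_ideal J d" unfolding lead_ideal_def by blast
qed

lemma lead_ideal_Suc:
  assumes J: "ideal_in (polys C) J" shows "lead_ideal J d \<subseteq> lead_ideal J (Suc d)"
proof
  fix a assume "a \<in> lead_ideal J d"
  then obtain f where "a = coeff f d" "f \<in> J" "degree f \<le> d" by (auto simp: lead_ideal_def)
  then have "a = coeff ([:0, 1:] * f) (Suc d)" "[:0, 1:] * f \<in> J"
    "degree ([:0, 1:] * f) \<le> Suc d"
    using P.ideal_mult[OF J var_in] by (auto simp: degree_pCons_eq_if)
  then show "a \<in> lead_ideal J (Suc d)" unfolding lead_ideal_def by blast
qed

lemma lead_ideal_mono: "J \<subseteq> J' \<Longrightarrow> lead_ideal J d \<subseteq> lead_ideal J' d"
  by (auto simp: lead_ideal_def)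

text \<open>
  Subtract from an element of \<open>J'\<close> one of \<open>J\<close> with the same leading term.
\<close>

lemma lead_ideals_determine:
  assumes J: "ideal_in (polys C) J" and J': "ideal_in (polys C) J'" and "J \<subseteq> J'"
    and sub: "\<And>d. lead_ideal J' d \<subseteq> lead_ideal J d"
  shows "J' \<subseteq> J"
proof
  fix f assume "f \<in> J'"
  then show "f \<in> J"
  proof (induction "degree f" arbitrary: f rule: less_induct)
    case less
    have "lead_coeff f \<in> lead_ideal J' (degree f)"
      using less.prems by (auto simp: lead_ideal_def)
    then obtain g where g: "lead_coeff f = coeff g (degree f)" "g \<in> J"
      "degree g \<le> degree f" using sub by (fastforce simp: lead_ideal_def)
    have "f - g \<in> J'" using less.prems g assms(3) P.ideal_diff[OF J'] by blast
    moreover have "f - g = 0 \<or> degree (f - g) < degree f"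
      using g by (intro degree_less_if degree_diff_le) auto
    ultimately have "f - g \<in> J" using less.hyps P.ideal_zero[OF J] by auto
    then show ?case using P.ideal_add[OF J, of "f - g" g] g by simp
  qed
qed

text \<open>
  Take a leading coefficient ideal, of \<open>J0\<close> in degree \<open>d0\<close>, that is maximal among those of all members
  of the family and all degrees. For members over \<open>J0\<close> the degrees from \<open>d0\<close> on are then settled, and
  the finitely many smaller degrees are made stationary one after the other by enlarging \<open>J0\<close>.
\<close>

theorem hilbert_basis:
  assumes "noetherian C" shows "noetherian (polys C)"
  unfolding noetherian_def
proof (intro allI impI)
  fix \<F> :: "'r poly set set"
  assume "\<F> \<noteq> {}" and "\<forall>I\<in>\<F>. ideal_in (polys C) I"
  then obtain I0 where I0: "I0 \<in> \<F>" and id: "\<And>I. I \<in> \<F> \<Longrightarrow> ideal_in (polys C) I" by auto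
  have Lmono: "lead_ideal J d \<subseteq> lead_ideal J d'" if "J \<in> \<F>" "d \<le> d'" for J d d'
    by (rule lift_Suc_mono_le[of "lead_ideal J"]) (use that lead_ideal_Suc[OF id] in auto)
  let ?L = "{lead_ideal J d | J d. J \<in> \<F>}"
  have S1: "lead_ideal I0 0 \<in> ?L" using I0 by blast
  have S2: "ideal_in C I" if "I \<in> ?L" for I using that ideal_lead_ideal[OF id] by blast
  obtain M where M: "M \<in> ?L" and max: "\<forall>I\<in>?L. M \<subseteq> I \<longrightarrow> I = M"
    by (rule bexE[OF noetherian_max[OF assms(1) S1 S2]])
  obtain J0 d0 where J0: "J0 \<in> \<F>" "M = lead_ideal J0 d0" using M by blast
  have top: "lead_ideal J d = M" if "J \<in> \<F>" "J0 \<subseteq> J" "d0 \<le> d" for J d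
  proof -
    have "M \<subseteq> lead_ideal J d"
      using lead_ideal_mono[OF that(2), of d0] Lmono[OF that(1,3)] J0 by blast
    moreover have "lead_ideal J d \<in> ?L" using that(1) by blast
    ultimately show ?thesis using max by simp
  qed
  have ex: "\<exists>J\<in>\<F>. J0 \<subseteq> J \<and> (\<forall>d<k. \<forall>J'\<in>\<F>. J \<subseteq> J' \<longrightarrow> lead_ideal J' d = lead_ideal J d)" for k
  proof (induction k)
    case 0 then show ?case using J0 by auto
  next
    case (Suc k)
    then obtain J where J: "J \<in> \<F>" "J0 \<subseteq> J"
      "\<forall>d<k. \<forall>J'\<in>\<F>. J \<subseteq> J' \<longrightarrow> lead_ideal J' d = lead_ideal J d" by blast
    let ?L = "{lead_ideal J' k | J'. J' \<in> \<F> \<and> J \<subseteq> J'}"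
    have S1: "lead_ideal J k \<in> ?L" using J by blast
    have S2: "ideal_in C I" if "I \<in> ?L" for I using that ideal_lead_ideal[OF id] by blast
    obtain M where M: "M \<in> ?L" and max: "\<forall>I\<in>?L. M \<subseteq> I \<longrightarrow> I = M"
      by (rule bexE[OF noetherian_max[OF assms(1) S1 S2]])
    obtain J1 where J1: "J1 \<in> \<F>" "J \<subseteq> J1" "M = lead_ideal J1 k" using M by blast
    have stable: "lead_ideal J' d = lead_ideal J1 d" if d: "d < Suc k" and J': "J' \<in> \<F>" "J1 \<subseteq> J'" for d J'
    proof (cases "d = k")
      case True
      have "J \<subseteq> J'" using J1(2) J'(2) by simp
      then have "lead_ideal J' k \<in> ?L" using J'(1) by blast
      moreover have "M \<subseteq> lead_ideal J' k" using lead_ideal_mono[OF J'(2)] J1(3) by simp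
      ultimately have "lead_ideal J' k = M" using max by simp
      then show ?thesis using J1(3) True by simp
    next
      case False
      then have "d < k" using d by simp
      moreover have "J \<subseteq> J'" using J1 J' by blast
      ultimately show ?thesis using J(3) J1 J' by metis
    qed
    have "J0 \<subseteq> J1" using J(2) J1(2) by simp
    moreover have "\<forall>d<Suc k. \<forall>J'\<in>\<F>. J1 \<subseteq> J' \<longrightarrow> lead_ideal J' d = lead_ideal J1 d"
      by (intro allI ballI impI) (rule stable)
    ultimately show ?case by (intro bexI[OF _ J1(1)] conjI)
  qed
  obtain J where J: "J \<in> \<F>" "J0 \<subseteq> J"
    "\<forall>d<d0. \<forall>J'\<in>\<F>. J \<subseteq> J' \<longrightarrow> lead_ideal J' d = lead_ideal J d"
    using ex[of d0] by blast
  have "J' = J" if J': "J' \<in> \<F>" "J \<subseteq> J'" for J'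
  proof -
    have "lead_ideal J' d = lead_ideal J d" for d
    proof (cases "d < d0")
      case True then show ?thesis using J J' by blast
    next
      case False
      have "J0 \<subseteq> J'" using J J' by blast
      then show ?thesis using top[of J' d] top[of J d] J J' False by simp
    qed
    then have "J' \<subseteq> J" using lead_ideals_determine[OF id[OF J(1)] id[OF J'(1)] J'(2)] by blast
    then show ?thesis using J'(2) by blast
  qed
  then show "\<exists>M\<in>\<F>. \<forall>I\<in>\<F>. M \<subseteq> I \<longrightarrow> I = M" using J(1) by blast
qed

end

section \<open>Incomparability and the Jacobson property\<close>

context comm_subring begin

interpretation P: comm_subring "polys C" by (rule polys_subring)

text \<open>
  The version for \<open>f \<in> K C[y]\<close> keeps quotient and remainder in \<open>K C[y]\<close>, as lying over
  in \<open>isolated_contract\<close> requires.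
\<close>

lemma pseudo_division:
  assumes K: "ideal_in C K" and h: "h \<in> polys C" and f: "f \<in> polys K"
  shows "\<exists>n q r. q \<in> polys K \<and> r \<in> polys K \<and> smult (lead_coeff h ^ n) f = q * h + r \<and>
    (r = 0 \<or> degree r < degree h)"
  using f
proof (induction "degree f" arbitrary: f rule: less_induct)
  case less
  have PK: "ideal_in (polys C) (polys K)" by (rule polys_ideal[OF K])
  show ?case
  proof (cases "f = 0 \<or> degree f < degree h")
    case True
    then show ?thesis using less.prems P.ideal_zero[OF PK]
      by (intro exI[of _ 0] exI[of _ "0 :: 'r poly"] exI[of _ f]) auto
  next
    case False
    let ?e = "lead_coeff h" and ?c = "lead_coeff f"
    let ?k = "degree f - degree h"
    let ?f = "smult ?e f - monom ?c ?k * h"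
    have eC: "?e \<in> C" using polysD[OF h] .
    have cK: "?c \<in> K" using polysD[OF less.prems] .
    have mK: "monom ?c ?k \<in> polys K" by (rule monom_in_polys[OF K cK])
    have fK: "?f \<in> polys K"
      using P.ideal_diff[OF PK smult_in[OF eC less.prems K]] P.ideal_mult2[OF PK h mK] by blast
    have "degree (monom ?c ?k * h) \<le> degree f"
      using degree_mult_le[of "monom ?c ?k" h] degree_monom_le[of ?c ?k] False by linarith
    then have "degree ?f \<le> degree f"
      using degree_smult_le[of ?e f] by (intro degree_diff_le) auto
    moreover have "coeff ?f (degree f) = 0"
      using False coeff_monom_mult[of ?c ?k h "degree f"] by (simp add: mult.commute)
    ultimately have "?f = 0 \<or> degree ?f < degree f" by (rule degree_less_if)
    then have "\<exists>n q r. q \<in> polys K \<and> r \<in> polys K \<and> smult (?e ^ n) ?f = q * h + r \<and>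
        (r = 0 \<or> degree r < degree h)"
    proof
      assume "?f = 0"
      then show ?thesis using P.ideal_zero[OF PK]
        by (intro exI[of _ 0] exI[of _ "0 :: 'r poly"]) simp
    qed (use less.hyps fK in blast)
    then obtain n q r where *: "q \<in> polys K" "r \<in> polys K" "smult (?e ^ n) ?f = q * h + r"
      "r = 0 \<or> degree r < degree h" by blast
    have "smult (?e ^ Suc n) f = smult (?e ^ n) ?f + smult (?e ^ n) (monom ?c ?k) * h"
      by (simp add: smult_diff_right mult.commute)
    also have "\<dots> = (q + smult (?e ^ n) (monom ?c ?k)) * h + r"
      unfolding *(3) by (simp add: algebra_simps)
    finally have "smult (?e ^ Suc n) f = (q + smult (?e ^ n) (monom ?c ?k)) * h + r" .
    moreover have "q + smult (?e ^ n) (monom ?c ?k) \<in> polys K"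
      using P.ideal_add[OF PK *(1) smult_in[OF power_in[OF eC] mK K]] .
    ultimately show ?thesis using *(2,4) by blast
  qed
qed

text \<open>
  Such an \<open>h\<close> plays the part of the generator of \<open>Q\<close> over the residue field of its contraction:
  up to powers of its leading coefficient, and modulo the extended contraction, it divides all of
  \<open>Q\<close>.
\<close>

lemma minimal_degree_element:
  assumes Q: "ideal_in (polys C) Q" "1 \<notin> Q" and ne: "Q \<noteq> polys (contraction Q)"
  obtains h where "h \<in> Q" "lead_coeff h \<notin> contraction Q" "0 < degree h"
    "\<And>g. g \<in> Q \<Longrightarrow> degree g < degree h \<Longrightarrow> g \<in> polys (contraction Q)"
proof -
  let ?p = "contraction Q"
  have idp: "ideal_in C ?p" by (rule contraction_ideal[OF Q(1)])
  have sub: "polys ?p \<subseteq> Q" by (rule polys_contraction_sub[OF Q(1)])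
  have "\<exists>h. h \<in> Q \<and> h \<notin> polys ?p" using ne sub by blast
  then obtain h where h: "h \<in> Q" "h \<notin> polys ?p"
    and min: "\<And>g. g \<in> Q \<Longrightarrow> g \<notin> polys ?p \<Longrightarrow> degree h \<le> degree g"
    using ex_has_least_nat[of "\<lambda>h. h \<in> Q \<and> h \<notin> polys ?p" _ degree] by blast
  have small: "g \<in> polys ?p" if "g \<in> Q" "degree g < degree h" for g
    using min[OF that(1)] that(2) by force
  let ?m = "monom (lead_coeff h) (degree h)"
  have lead: "lead_coeff h \<notin> ?p"
  proof
    assume a: "lead_coeff h \<in> ?p"
    have m: "?m \<in> polys ?p" by (rule monom_in_polys[OF idp a])
    have "h - ?m \<in> Q" using P.ideal_diff[OF Q(1) h(1)] m sub by blast
    moreover have "h - ?m = 0 \<or> degree (h - ?m) < degree h"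
      by (rule degree_less_if) (auto intro: degree_diff_le degree_monom_le)
    ultimately have "h - ?m \<in> polys ?p"
      using small P.ideal_zero[OF polys_ideal[OF idp]] by auto
    then have "h \<in> polys ?p" using P.ideal_add[OF polys_ideal[OF idp] _ m] by fastforce
    then show False using h by blast
  qed
  moreover have "0 < degree h"
  proof (rule ccontr)
    assume "\<not> ?thesis"
    then have "h = [:lead_coeff h:]" by (metis degree_eq_zeroE gr0I lead_coeff_pCons(2) pCons_0_0)
    then show False using lead h(1) by (simp add: contraction_def)
  qed
  ultimately show ?thesis using that h(1) small by blast
qed

end

locale comm_domain = comm_subring C for C :: "'r::idom set"
begin

interpretation P: comm_subring "polys C" by (rule polys_subring)

text \<open>
  Over the residue field of the common contraction the nonzero prime \<open>Q\<close> is maximal. Without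
  localizing: take \<open>u \<in> Q\<close> and \<open>h \<in> Q'\<close> of minimal degree outside the extended contraction. Dividing
  \<open>u\<close> by \<open>h\<close> leaves a remainder in the extended contraction, so \<open>w h \<in> Q\<close> for the quotient \<open>w\<close>; the
  degree of \<open>w\<close> is too small for \<open>w \<in> Q\<close>, so \<open>h \<in> Q\<close>, and \<open>h\<close> divides all of \<open>Q'\<close> in the same
  sense.
\<close>

theorem incomparability:
  assumes Q: "prime_in (polys C) Q" and Q': "prime_in (polys C) Q'" and QQ': "Q \<subseteq> Q'"
    and con: "contraction Q = contraction Q'" and ne: "Q \<noteq> polys (contraction Q)"
  shows "Q = Q'"
proof -
  let ?p = "contraction Q"
  have idQ: "ideal_in (polys C) Q" and idQ': "ideal_in (polys C) Q'" using Q Q' by (auto intro: P.prime_ideal)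
  have p: "prime_in C ?p" by (rule contraction_prime[OF Q])
  have idp: "ideal_in C ?p" by (rule prime_ideal[OF p])
  have pQ: "polys ?p \<subseteq> Q" by (rule polys_contraction_sub[OF idQ])
  have ne': "Q' \<noteq> polys (contraction Q')" using ne con QQ' pQ by auto
  obtain u where u: "u \<in> Q" "lead_coeff u \<notin> ?p"
    and umin: "\<And>g. g \<in> Q \<Longrightarrow> degree g < degree u \<Longrightarrow> g \<in> polys ?p"
    using minimal_degree_element[OF idQ P.prime_one[OF Q] ne] by metis
  obtain h where h: "h \<in> Q'" "lead_coeff h \<notin> ?p" "0 < degree h"
    and hmin: "\<And>g. g \<in> Q' \<Longrightarrow> degree g < degree h \<Longrightarrow> g \<in> polys ?p"
    using minimal_degree_element[OF idQ' P.prime_one[OF Q'] ne'] con by metis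
  have hC: "h \<in> polys C" using P.ideal_sub[OF idQ' h(1)] .
  let ?e = "lead_coeff h"
  have eC: "?e \<in> C" using polysD[OF hC] .
  have en: "?e ^ n \<notin> ?p" for n using prime_power[OF p eC] h(2) by blast
  have division: "\<exists>n q r. q \<in> polys C \<and> r \<in> polys ?p \<and> smult (?e ^ n) f = q * h + r \<and>
      (r = 0 \<or> degree r < degree h)" if f: "f \<in> Q'" for f
  proof -
    have fC: "f \<in> polys C" using P.ideal_sub[OF idQ' f] .
    obtain n q r where *: "q \<in> polys C" "smult (?e ^ n) f = q * h + r"
      "r = 0 \<or> degree r < degree h"
      using pseudo_division[OF ideal_UNIV hC fC] by blast
    have "[:?e ^ n:] * f \<in> Q'" "q * h \<in> Q'"
      using P.ideal_mult[OF idQ'] const_in power_in[OF eC] f h(1) *(1) by blast+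
    then have "r \<in> Q'" using *(2) P.ideal_add_cancel[OF idQ', of "q * h" r] by simp
    then have "r \<in> polys ?p" using hmin *(3) P.ideal_zero[OF polys_ideal[OF idp]] by blast
    then show ?thesis using * by blast
  qed
  have hQ: "h \<in> Q"
  proof (rule ccontr)
    assume hQ: "h \<notin> Q"
    obtain n w r where *: "w \<in> polys C" "r \<in> polys ?p" "smult (?e ^ n) u = w * h + r"
      "r = 0 \<or> degree r < degree h"
      using division u(1) QQ' by blast
    have "[:?e ^ n:] * u \<in> Q" using P.ideal_mult[OF idQ const_in[OF power_in[OF eC]] u(1)] .
    moreover have "w * h = [:?e ^ n:] * u - r" using *(3) by simp
    ultimately have "w * h \<in> Q" using P.ideal_diff[OF idQ] *(2) pQ by auto
    then have wQ: "w \<in> Q" using P.prime_cases[OF Q *(1) hC] hQ by blast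
    have "w \<in> polys ?p"
    proof (cases "w = 0")
      case True
      then show ?thesis using P.ideal_zero[OF polys_ideal[OF idp]] by simp
    next
      case False
      have "h \<noteq> 0" using h(3) by auto
      then have dwh: "degree (w * h) = degree w + degree h"
        using False degree_mult_eq by blast
      have "w * h = smult (?e ^ n) u - r" using *(3) by simp
      then have "degree (w * h) \<le> max (degree (smult (?e ^ n) u)) (degree r)"
        using degree_diff_le_max by metis
      then have "degree w + degree h \<le> max (degree u) (degree r)"
        using dwh degree_smult_le[of "?e ^ n" u] by linarith
      then have "degree w < degree u" using *(4) h(3) by auto
      then show ?thesis using umin[OF wQ] by blast
    qed
    then have "smult (?e ^ n) u \<in> polys ?p"
      using *(2,3) P.ideal_add[OF polys_ideal[OF idp]] P.ideal_mult2[OF polys_ideal[OF idp] hC] by simp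
    then have "?e ^ n * lead_coeff u \<in> ?p" using polysD[of _ ?p "degree u"] by fastforce
    then show False
      using prime_cases[OF p power_in[OF eC] polysD[OF P.ideal_sub[OF idQ u(1)]]] en u(2) by blast
  qed
  have "f \<in> Q" if f: "f \<in> Q'" for f
  proof -
    obtain n q r where *: "q \<in> polys C" "r \<in> polys ?p" "smult (?e ^ n) f = q * h + r"
      using division[OF f] by blast
    have "[:?e ^ n:] * f \<in> Q"
      using * pQ P.ideal_add[OF idQ P.ideal_mult[OF idQ *(1) hQ], of r] by auto
    moreover have "[:?e ^ n:] \<notin> Q" using en[of n] by (simp add: contraction_def)
    ultimately show ?thesis
      using P.prime_cases[OF Q const_in[OF power_in[OF eC]] P.ideal_sub[OF idQ' f]] by blast
  qed
  then show ?thesis using QQ' by blast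
qed

text \<open>
  A monic polynomial lies in no extended prime, so every member of the chain is a proper overideal
  of its extended contraction, and incomparability keeps the contractions apart.
\<close>

lemma prime_chain_contract:
  assumes u: "lead_coeff u = 1" "u \<in> K'" and K: "(\<lambda>c. [:c:]) ` K \<subseteq> K'"
  shows "prime_chain (polys C) K' r M \<Longrightarrow> prime_chain C K r (contraction M)"
proof (induction r arbitrary: M)
  case 0
  then show ?case using contraction_prime K by (auto simp: contraction_def)
next
  case (Suc r)
  then obtain Q where Q: "prime_chain (polys C) K' r Q" "Q \<subset> M" and M: "prime_in (polys C) M" by auto
  have Qp: "prime_in (polys C) Q" using P.prime_chain_prime[OF Q(1)] .
  have uQ: "u \<in> Q" using P.prime_chain_incl[OF Q(1)] u(2) by blast
  have "1 \<notin> contraction Q" using prime_one[OF contraction_prime[OF Qp]] .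
  then have "Q \<noteq> polys (contraction Q)" using uQ u(1) polysD[of u "contraction Q" "degree u"] by auto
  then have "contraction Q \<noteq> contraction M" using incomparability[OF Qp M] Q(2) by blast
  moreover have "contraction Q \<subseteq> contraction M" using Q(2) by (auto simp: contraction_def)
  ultimately show ?case using Suc.IH[OF Q(1)] contraction_prime[OF M] by auto
qed

text \<open>
  If \<open>P\<close> were extended, some prime over \<open>P + (1 + y c)\<close> would contain \<open>c\<close> and thus \<open>1\<close>. For the
  second claim, let \<open>e\<close> be the leading coefficient of an element \<open>h\<close> of minimal degree, and let \<open>c'\<close>
  be an element of \<open>P + (c)\<close> in \<open>C\<close> outside the contraction of \<open>P\<close>. A prime \<open>p'\<close> over the contraction that
  does not contain \<open>e\<close> has a prime \<open>P' \<supset> P\<close> lying over it, because modulo \<open>P\<close> and after inverting \<open>e\<close> the powers of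
  \<open>y\<close> below the degree of \<open>h\<close> form a basis; so \<open>c \<in> P'\<close> and \<open>c' \<in> p'\<close>. Hence \<open>e c'\<close> isolates the
  contraction.
\<close>

lemma isolated_contract:
  assumes noe: "noetherian C" and P: "prime_in (polys C) P" and c: "c \<in> polys C" "c \<notin> P"
    and above: "\<And>P'. prime_in (polys C) P' \<Longrightarrow> P \<subset> P' \<Longrightarrow> c \<in> P'"
  shows "P \<noteq> polys (contraction P)"
    and "\<exists>c'\<in>C - contraction P. \<forall>p'. prime_in C p' \<longrightarrow> contraction P \<subset> p' \<longrightarrow> c' \<in> p'"
proof -
  let ?p = "contraction P"
  have noeP: "noetherian (polys C)" by (rule hilbert_basis[OF noe])
  have idP: "ideal_in (polys C) P" by (rule P.prime_ideal[OF P])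
  have p: "prime_in C ?p" by (rule contraction_prime[OF P])
  have idp: "ideal_in C ?p" by (rule prime_ideal[OF p])
  show ne: "P \<noteq> polys ?p"
  proof
    assume eq: "P = polys ?p"
    define t where "t = 1 + [:0, 1:] * c"
    have tC: "t \<in> polys C" unfolding t_def by (intro P.add_in P.mult_in P.one_in var_in c)
    obtain k where k: "coeff c k \<notin> ?p" "\<And>a. a > k \<Longrightarrow> coeff c a \<in> ?p"
      using top_coeff_outside[OF idp] c(2) eq by blast
    have t1: "coeff t (Suc a) = coeff c a" for a by (simp add: t_def)
    have tk: "coeff t (Suc k) \<notin> ?p" "\<And>a. a > Suc k \<Longrightarrow> coeff t a \<in> ?p"
      using k t1 by (auto simp: Suc_less_eq2)
    have tP: "t \<notin> P" using polysD[of t ?p "Suc k"] tk(1) eq by blast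
    have "1 \<notin> plus_gen (polys C) P t"
    proof
      assume "1 \<in> plus_gen (polys C) P t"
      then obtain q w where qw: "1 = q + w * t" "q \<in> P" "w \<in> polys C" by (auto simp: plus_gen_def)
      show False
      proof (cases "w \<in> P")
        case True
        then have "q + w * t \<in> P" using qw P.ideal_add[OF idP] P.ideal_mult2[OF idP tC] by blast
        then show False using qw(1) P.prime_one[OF P] by simp
      next
        case False
        then obtain i where i: "coeff w i \<notin> ?p" "\<And>a. a > i \<Longrightarrow> coeff w a \<in> ?p"
          using top_coeff_outside[OF idp] eq by blast
        have "coeff (w * t) (i + Suc k) - coeff w i * coeff t (Suc k) \<in> ?p"
          by (rule coeff_mult_top[OF idp qw(3) i(2) tC tk(2)])
        moreover have "coeff (w * t) (i + Suc k) = - coeff q (i + Suc k)"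
        proof -
          have "w * t = 1 - q" using qw(1) by (simp add: eq_diff_eq add.commute)
          then show ?thesis by simp
        qed
        moreover have "- coeff q (i + Suc k) \<in> ?p"
          using polysD[of q ?p] qw(2) eq ideal_uminus[OF idp] by blast
        ultimately have "coeff w i * coeff t (Suc k) \<in> ?p"
          using ideal_diff[OF idp] by fastforce
        then show False using prime_cases[OF p polysD[OF qw(3)] polysD[OF tC]] i(1) tk(1) by blast
      qed
    qed
    then obtain M where M: "maximal_in (polys C) M" "plus_gen (polys C) P t \<subseteq> M"
      using P.exists_maximal[OF noeP P.ideal_plus_gen[OF idP tC]] by blast
    have Mp: "prime_in (polys C) M" by (rule P.maximal_prime[OF M(1)])
    have tM: "t \<in> M" "P \<subseteq> M" using M(2) P.plus_gen_self[OF idP, of t] P.plus_gen_incl[of P t] by auto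
    then have "c \<in> M" using above[OF Mp] tP by blast
    then have "[:0, 1:] * c \<in> M" by (rule P.ideal_mult[OF P.prime_ideal[OF Mp] var_in])
    then have "1 \<in> M" using tM(1) P.ideal_diff[OF P.prime_ideal[OF Mp], of t "[:0, 1:] * c"]
      by (simp add: t_def)
    then show False using P.prime_one[OF Mp] by blast
  qed
  obtain h where h: "h \<in> P" "lead_coeff h \<notin> ?p" "0 < degree h"
    and hmin: "\<And>g. g \<in> P \<Longrightarrow> degree g < degree h \<Longrightarrow> g \<in> polys ?p"
    using minimal_degree_element[OF idP P.prime_one[OF P] ne] by metis
  have hC: "h \<in> polys C" using P.ideal_sub[OF idP h(1)] .
  let ?e = "lead_coeff h"
  have eC: "?e \<in> C" using polysD[OF hC] .
  have mult_set: "(\<lambda>s. [:s:]) ` (C - q) \<subseteq> polys C" "1 \<in> (\<lambda>s. [:s:]) ` (C - q)"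
    "\<And>a b. a \<in> (\<lambda>s. [:s:]) ` (C - q) \<Longrightarrow> b \<in> (\<lambda>s. [:s:]) ` (C - q) \<Longrightarrow> a * b \<in> (\<lambda>s. [:s:]) ` (C - q)"
    if q: "prime_in C q" for q
  proof -
    show "(\<lambda>s. [:s:]) ` (C - q) \<subseteq> polys C" using const_in by auto
    show "1 \<in> (\<lambda>s. [:s:]) ` (C - q)" using prime_one[OF q] one_in by (auto simp: one_pCons)
    fix a b assume "a \<in> (\<lambda>s. [:s:]) ` (C - q)" "b \<in> (\<lambda>s. [:s:]) ` (C - q)"
    then obtain s t where st: "a = [:s:]" "b = [:t:]" "s \<in> C" "t \<in> C" "s \<notin> q" "t \<notin> q" by blast
    then have "a * b = [:s * t:]" "s * t \<in> C - q" using prime_cases[OF q] mult_in by auto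
    then show "a * b \<in> (\<lambda>s. [:s:]) ` (C - q)" by blast
  qed
  have contraction_sub: "contraction P' \<subseteq> q"
    if "P' \<inter> (\<lambda>s. [:s:]) ` (C - q) = {}" "ideal_in (polys C) P'" for P' q
    using that ideal_sub[OF contraction_ideal[OF that(2)]] by (auto simp: contraction_def)
  have "\<not> contraction (plus_gen (polys C) P c) \<subseteq> ?p"
  proof
    assume sub: "contraction (plus_gen (polys C) P c) \<subseteq> ?p"
    then have "plus_gen (polys C) P c \<inter> (\<lambda>s. [:s:]) ` (C - ?p) = {}" by (auto simp: contraction_def)
    then obtain P' where P': "prime_in (polys C) P'" "plus_gen (polys C) P c \<subseteq> P'"
        "P' \<inter> (\<lambda>s. [:s:]) ` (C - ?p) = {}"
      using P.exists_prime_avoiding[OF noeP P.ideal_plus_gen[OF idP c(1)] mult_set[OF p]] by blast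
    have PP': "P \<subseteq> P'" "c \<in> P'" using P'(2) P.plus_gen_incl[of P c] P.plus_gen_self[OF idP, of c] by auto
    have "contraction P' \<subseteq> ?p" by (rule contraction_sub[OF P'(3) P.prime_ideal[OF P'(1)]])
    then have "?p = contraction P'" using PP'(1) by (auto simp: contraction_def)
    then show False using incomparability[OF P P'(1) PP'(1) _ ne] PP'(2) c(2) by blast
  qed
  then obtain c' where c': "c' \<in> contraction (plus_gen (polys C) P c)" "c' \<notin> ?p" by blast
  have c'C: "c' \<in> C" using ideal_sub[OF contraction_ideal[OF P.ideal_plus_gen[OF idP c(1)]] c'(1)] .
  have "?e * c' \<in> p'" if p': "prime_in C p'" "?p \<subset> p'" for p'
  proof (cases "?e \<in> p'")
    case True
    then show ?thesis using ideal_mult2[OF prime_ideal[OF p'(1)] c'C] by blast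
  next
    case False
    have idp': "ideal_in C p'" by (rule prime_ideal[OF p'(1)])
    have idPp': "ideal_in (polys C) (polys p')" by (rule polys_ideal[OF idp'])
    let ?I = "{a + b | a b. a \<in> P \<and> b \<in> polys p'}"
    have idI: "ideal_in (polys C) ?I" by (rule P.ideal_plus[OF idP idPp'])
    have IP: "P \<subseteq> ?I" and Ip': "polys p' \<subseteq> ?I"
      using P.plus_incl1[OF idPp', of P] P.plus_incl2[OF idP, of "polys p'"] by auto
    have "False" if sI: "[:s:] \<in> ?I" and s: "s \<in> C" "s \<notin> p'" for s
    proof -
      obtain v w where vw: "[:s:] = v + w" "v \<in> P" "w \<in> polys p'" using sI by blast
      obtain n q r where *: "q \<in> polys p'" "r \<in> polys p'" "smult (?e ^ n) w = q * h + r"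
        "r = 0 \<or> degree r < degree h"
        using pseudo_division[OF idp' hC vw(3)] by blast
      have "[:?e ^ n * s:] - r = [:?e ^ n:] * v + q * h"
      proof -
        have "[:?e ^ n * s:] = [:?e ^ n:] * [:s:]" by simp
        also have "\<dots> = [:?e ^ n:] * v + smult (?e ^ n) w" unfolding vw(1) by (simp add: smult_add_right)
        finally show ?thesis using *(3) by simp
      qed
      moreover have "[:?e ^ n:] * v + q * h \<in> P"
        using P.ideal_add[OF idP P.ideal_mult[OF idP const_in[OF power_in[OF eC]] vw(2)]
            P.ideal_mult[OF idP P.ideal_sub[OF idPp' *(1)] h(1)]] .
      ultimately have "[:?e ^ n * s:] - r \<in> P" by simp
      moreover have "degree ([:?e ^ n * s:] - r) < degree h"
        using *(4) h(3) by (auto intro!: degree_diff_less)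
      ultimately have "[:?e ^ n * s:] - r \<in> polys ?p" by (rule hmin)
      then have "?e ^ n * s - coeff r 0 \<in> p'"
        using polysD[of "[:?e ^ n * s:] - r" ?p 0] p'(2) by auto
      then have "?e ^ n * s \<in> p'" using ideal_diff_cancel[OF idp'] polysD[OF *(2)] by blast
      then have "?e ^ n \<in> p'" using prime_cases[OF p'(1) power_in[OF eC] s(1)] s(2) by blast
      then show False using prime_power[OF p'(1) eC] False by blast
    qed
    note avoid = this
    have disj: "?I \<inter> (\<lambda>s. [:s:]) ` (C - p') = {}"
    proof (rule equals0I)
      fix x assume x: "x \<in> ?I \<inter> (\<lambda>s. [:s:]) ` (C - p')"
      obtain s where "x = [:s:]" "s \<in> C" "s \<notin> p'" using IntD2[OF x] by (elim imageE DiffE)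
      then show False using avoid[of s] IntD1[OF x] by simp
    qed
    obtain P' where P': "prime_in (polys C) P'" "?I \<subseteq> P'" "P' \<inter> (\<lambda>s. [:s:]) ` (C - p') = {}"
      by (rule P.exists_prime_avoiding[OF noeP idI mult_set[OF p'(1)] disj])
    have "contraction P' \<subseteq> p'" by (rule contraction_sub[OF P'(3) P.prime_ideal[OF P'(1)]])
    have "p' \<subseteq> contraction P'"
      using subset_trans[OF Ip' P'(2)] const_in_polys[OF idp'] by (auto simp: contraction_def)
    then have "P \<noteq> P'" using p'(2) by blast
    then have "P \<subset> P'" using IP P'(2) by blast
    then have "c \<in> P'" by (rule above[OF P'(1)])
    then have "plus_gen (polys C) P c \<subseteq> P'"
      using P.plus_gen_least[OF P.prime_ideal[OF P'(1)]] IP P'(2) by blast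
    then have "c' \<in> contraction P'" using c'(1) by (auto simp: contraction_def)
    then have "c' \<in> p'" using \<open>contraction P' \<subseteq> p'\<close> by blast
    then show ?thesis using ideal_mult[OF idp' eC] by blast
  qed
  moreover have "?e * c' \<in> C - ?p" using prime_cases[OF p eC c'C] h(2) c'(2) mult_in[OF eC c'C] by blast
  ultimately show "\<exists>c'\<in>C - ?p. \<forall>p'. prime_in C p' \<longrightarrow> ?p \<subset> p' \<longrightarrow> c' \<in> p'" by blast
qed

theorem jacobson_polys:
  assumes noe: "noetherian C" and jac: "jacobson C"
  shows "jacobson (polys C)"
  unfolding jacobson_def
proof (intro allI impI)
  fix P c
  assume P: "prime_in (polys C) P" and c: "c \<in> polys C - P"
    and above: "\<forall>P'. prime_in (polys C) P' \<longrightarrow> P \<subset> P' \<longrightarrow> c \<in> P'"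
  let ?p = "contraction P"
  have p: "prime_in C ?p" by (rule contraction_prime[OF P])
  have ne: "P \<noteq> polys ?p"
    using isolated_contract(1)[OF noe P, of c] c above by blast
  obtain c' where "c' \<in> C - ?p" "\<forall>p'. prime_in C p' \<longrightarrow> ?p \<subset> p' \<longrightarrow> c' \<in> p'"
    using isolated_contract(2)[OF noe P, of c] c above by blast
  then have max: "maximal_in C ?p" using jac p unfolding jacobson_def by blast
  show "maximal_in (polys C) P" unfolding maximal_in_def
  proof (intro conjI allI impI)
    show "ideal_in (polys C) P" by (rule P.prime_ideal[OF P])
    show "1 \<notin> P" by (rule P.prime_one[OF P])
    fix I assume I: "ideal_in (polys C) I" "P \<subseteq> I" "1 \<notin> I"
    obtain M where M: "maximal_in (polys C) M" "I \<subseteq> M"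
      using P.exists_maximal[OF hilbert_basis[OF noe] I(1,3)] by blast
    have Mp: "prime_in (polys C) M" by (rule P.maximal_prime[OF M(1)])
    have PM: "P \<subseteq> M" using I M by blast
    have "?p \<subseteq> contraction M" using PM by (auto simp: contraction_def)
    then have "?p = contraction M"
      using max contraction_ideal[OF P.prime_ideal[OF Mp]] prime_one[OF contraction_prime[OF Mp]]
      unfolding maximal_in_def by blast
    then have "P = M" using incomparability[OF P Mp PM _ ne] by blast
    then show "I = P" using I M by blast
  qed
qed

text \<open>
  A maximal ideal is isolated by \<open>1\<close>. Its element of minimal degree has a leading coefficient that is
  invertible modulo the contraction, and becomes monic after multiplying by an inverse and correcting
  the leading coefficient by an element of the contraction.
\<close>

lemma maximal_polys:
  assumes noe: "noetherian C" and jac: "jacobson C" and M: "maximal_in (polys C) M"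
  shows "maximal_in C (contraction M)" and "\<exists>u\<in>M. lead_coeff u = 1"
proof -
  have Mp: "prime_in (polys C) M" by (rule P.maximal_prime[OF M])
  have none: "1 \<in> P'" if "prime_in (polys C) P'" "M \<subset> P'" for P'
    using M that P.prime_ideal unfolding maximal_in_def by blast
  have one: "1 \<in> polys C" "1 \<notin> M" using P.one_in P.prime_one[OF Mp] by auto
  note iso = isolated_contract[OF noe Mp one none]
  let ?m = "contraction M"
  have m: "prime_in C ?m" by (rule contraction_prime[OF Mp])
  have idm: "ideal_in C ?m" by (rule prime_ideal[OF m])
  show max: "maximal_in C ?m" using jac m iso(2) unfolding jacobson_def by blast
  have idM: "ideal_in (polys C) M" by (rule P.prime_ideal[OF Mp])
  obtain h where h: "h \<in> M" "lead_coeff h \<notin> ?m"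
    using minimal_degree_element[OF idM one(2) iso(1)] by metis
  let ?e = "lead_coeff h" and ?d = "degree h"
  have eC: "?e \<in> C" using polysD[OF P.ideal_sub[OF idM h(1)]] .
  have "plus_gen C ?m ?e \<noteq> ?m" using plus_gen_self[OF idm, of ?e] h(2) by blast
  then have "1 \<in> plus_gen C ?m ?e"
    using max ideal_plus_gen[OF idm eC] plus_gen_incl[of ?m ?e] unfolding maximal_in_def by blast
  then obtain k b where kb: "1 = k + b * ?e" "k \<in> ?m" "b \<in> C" by (auto simp: plus_gen_def)
  define u where "u = [:b:] * h + monom k ?d"
  have "monom k ?d \<in> M"
    using monom_in_polys[OF idm kb(2)] polys_contraction_sub[OF idM] by blast
  then have "u \<in> M" unfolding u_def
    using P.ideal_add[OF idM P.ideal_mult[OF idM const_in[OF kb(3)] h(1)]] by blast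
  moreover have "lead_coeff u = 1"
  proof -
    have "coeff u ?d = 1" using kb(1) by (simp add: u_def add.commute)
    moreover have "degree u \<le> ?d" unfolding u_def
      by (intro degree_add_le) (auto intro: degree_monom_le degree_smult_le)
    ultimately have "degree u = ?d" using le_degree[of u ?d] by auto
    then show ?thesis using \<open>coeff u ?d = 1\<close> by simp
  qed
  ultimately show "\<exists>u\<in>M. lead_coeff u = 1" by blast
qed

end

section \<open>Rings presented as quotients of a subring\<close>

definition height_over :: "'r::comm_ring_1 set \<Rightarrow> 'r set \<Rightarrow> 'r set \<Rightarrow> enat" where
  "height_over C K P = Sup {enat r | r. prime_chain C K r P}"

definition (in comm_subring) depth_over :: "'r set \<Rightarrow> 'r set \<Rightarrow> enat" where
  "depth_over K M = Sup {enat j | j. has_regseq M j K}"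

locale ring_presentation = comm_subring C + S: cring S
  for C :: "'r::comm_ring_1 set" and S :: "('b, 'c) ring_scheme" (structure) +
  fixes \<pi> :: "'r \<Rightarrow> 'b"
  assumes surj: "\<pi> ` C = carrier S"
    and map_add: "a \<in> C \<Longrightarrow> b \<in> C \<Longrightarrow> \<pi> (a + b) = \<pi> a \<oplus> \<pi> b"
    and map_mult: "a \<in> C \<Longrightarrow> b \<in> C \<Longrightarrow> \<pi> (a * b) = \<pi> a \<otimes> \<pi> b"
    and map_one: "\<pi> 1 = \<one>"
begin

definition pull :: "'b set \<Rightarrow> 'r set" where
  "pull J = {c \<in> C. \<pi> c \<in> J}"

abbreviation "ker \<equiv> pull {\<zero>}"

lemma map_closed [simp]: "a \<in> C \<Longrightarrow> \<pi> a \<in> carrier S" using surj by blast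

lemma map_zero: "\<pi> 0 = \<zero>"
proof -
  have "\<pi> 0 \<oplus> \<pi> 0 = \<pi> 0" using map_add[OF zero_in zero_in] by simp
  then show ?thesis using S.add.r_cancel_one'[of "\<pi> 0" "\<pi> 0"] zero_in by simp
qed

lemma map_uminus: "a \<in> C \<Longrightarrow> \<pi> (- a) = \<ominus> \<pi> a"
  using map_add[of "- a" a] uminus_in[of a] map_zero by (simp add: S.minus_equality)

lemma map_diff: "a \<in> C \<Longrightarrow> b \<in> C \<Longrightarrow> \<pi> (a - b) = \<pi> a \<ominus> \<pi> b"
  using map_add[of a "- b"] map_uminus[of b] uminus_in by (simp add: a_minus_def)

lemma pull_mono: "J \<subseteq> J' \<Longrightarrow> pull J \<subseteq> pull J'" by (auto simp: pull_def)

lemma image_pull: "J \<subseteq> carrier S \<Longrightarrow> \<pi> ` pull J = J"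
  using surj by (fastforce simp: pull_def)

lemma ideal_carrier: "ideal J S \<Longrightarrow> J \<subseteq> carrier S"
  using additive_subgroup.a_subset[OF ideal.axioms(1)] by blast

lemma ideal_pull:
  assumes "ideal J S" shows "ideal_in C (pull J)" and "ker \<subseteq> pull J"
proof -
  interpret J: ideal J S by (rule assms)
  show "ideal_in C (pull J)"
    by (auto simp: ideal_in_def pull_def map_zero map_add map_mult J.I_l_closed intro: in_C)
  show "ker \<subseteq> pull J" by (auto simp: pull_def)
qed

lemma ideal_ker: "ideal_in C ker" by (rule ideal_pull(1)[OF S.zeroideal])

lemma pull_image:
  assumes I: "ideal_in C I" "ker \<subseteq> I" shows "pull (\<pi> ` I) = I"
proof
  show "I \<subseteq> pull (\<pi> ` I)" using ideal_sub[OF I(1)] by (auto simp: pull_def)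
  show "pull (\<pi> ` I) \<subseteq> I"
  proof
    fix c assume "c \<in> pull (\<pi> ` I)"
    then obtain i where i: "c \<in> C" "i \<in> I" "\<pi> c = \<pi> i" by (auto simp: pull_def)
    have iC: "i \<in> C" using ideal_sub[OF I(1) i(2)] .
    have "\<pi> (c - i) = \<zero>" using map_diff[OF i(1) iC] i(3) iC by (simp add: S.r_neg a_minus_def)
    then have "c - i \<in> I" using I(2) i(1) iC by (auto simp: pull_def intro: in_C)
    then show "c \<in> I" using ideal_diff_cancel[OF I(1)] i(2) by blast
  qed
qed

lemma ideal_image:
  assumes I: "ideal_in C I" shows "ideal (\<pi> ` I) S"
proof (rule idealI)
  show "ring S" by (rule S.ring_axioms)
  have sub: "I \<subseteq> C" using ideal_sub[OF I] by blast
  show "subgroup (\<pi> ` I) (add_monoid S)"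
  proof
    show "\<pi> ` I \<subseteq> carrier (add_monoid S)" using sub by auto
    show "\<one>\<^bsub>add_monoid S\<^esub> \<in> \<pi> ` I" using map_zero ideal_zero[OF I] by force
    fix x assume "x \<in> \<pi> ` I"
    then obtain a where a: "x = \<pi> a" "a \<in> I" by blast
    have "\<pi> (- a) = \<ominus> x" using map_uminus a sub by blast
    then show "inv\<^bsub>add_monoid S\<^esub> x \<in> \<pi> ` I"
      using ideal_uminus[OF I a(2)] by (metis a_inv_def imageI)
  next
    fix x y assume "x \<in> \<pi> ` I" "y \<in> \<pi> ` I"
    then obtain a b where "x = \<pi> a" "a \<in> I" "y = \<pi> b" "b \<in> I" by blast
    moreover from this have "a \<in> C" "b \<in> C" using sub by auto
    ultimately have "x \<oplus> y = \<pi> (a + b)" "a + b \<in> I" using map_add[of a b] ideal_add[OF I] by auto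
    then show "x \<otimes>\<^bsub>add_monoid S\<^esub> y \<in> \<pi> ` I" by simp
  qed
next
  fix x y assume "x \<in> \<pi> ` I" "y \<in> carrier S"
  then obtain a b where ab: "x = \<pi> a" "a \<in> I" "y = \<pi> b" "b \<in> C" using surj by blast
  have aC: "a \<in> C" using ideal_sub[OF I ab(2)] .
  have "y \<otimes> x = \<pi> (b * a)" using ab aC map_mult by simp
  then show "y \<otimes> x \<in> \<pi> ` I" using ideal_mult[OF I ab(4,2)] by blast
  have "x \<otimes> y = \<pi> (a * b)" using ab aC map_mult by simp
  then show "x \<otimes> y \<in> \<pi> ` I" using ideal_mult2[OF I ab(4,2)] by blast
qed

lemma one_pull: "1 \<in> pull J \<longleftrightarrow> \<one> \<in> J" using map_one one_in by (simp add: pull_def)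

lemma prime_pull:
  assumes "primeideal Q S" shows "prime_in C (pull Q)"
proof -
  interpret Q: primeideal Q S by (rule assms)
  have "1 \<notin> pull Q" using one_pull Q.one_imp_carrier Q.I_notcarr by blast
  moreover have "a \<in> pull Q \<or> b \<in> pull Q" if "a \<in> C" "b \<in> C" "a * b \<in> pull Q" for a b
    using that Q.I_prime[of "\<pi> a" "\<pi> b"] map_mult by (auto simp: pull_def)
  ultimately show ?thesis using ideal_pull(1)[OF Q.is_ideal] by (simp add: prime_in_def)
qed

lemma prime_image:
  assumes P: "prime_in C P" "ker \<subseteq> P" shows "primeideal (\<pi> ` P) S"
proof (rule primeidealI)
  have I: "ideal_in C P" by (rule prime_ideal[OF P(1)])
  note pi = pull_image[OF I P(2)]
  show "ideal (\<pi> ` P) S" by (rule ideal_image[OF I])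
  show "cring S" by (rule S.is_cring)
  show "carrier S \<noteq> \<pi> ` P" using prime_one[OF P(1)] one_pull[of "\<pi> ` P"] pi by auto
  fix x y assume "x \<in> carrier S" "y \<in> carrier S" "x \<otimes> y \<in> \<pi> ` P"
  then obtain a b where ab: "x = \<pi> a" "a \<in> C" "y = \<pi> b" "b \<in> C" "\<pi> (a * b) \<in> \<pi> ` P"
    using surj map_mult by (metis imageE)
  then have "a * b \<in> P" using pi mult_in by (auto simp: pull_def)
  then show "x \<in> \<pi> ` P \<or> y \<in> \<pi> ` P" using prime_cases[OF P(1) ab(2,4)] ab by blast
qed

lemma maximal_pull:
  assumes "maximalideal M S" shows "maximal_in C (pull M)" and "ker \<subseteq> pull M"
proof -
  interpret M: maximalideal M S by (rule assms)
  show k: "ker \<subseteq> pull M" by (rule ideal_pull(2)[OF M.is_ideal])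
  have "I = pull M" if I: "ideal_in C I" "pull M \<subseteq> I" "1 \<notin> I" for I
  proof -
    have pi: "pull (\<pi> ` I) = I" using pull_image[OF I(1)] k I(2) by blast
    have "M \<subseteq> \<pi> ` I" using image_pull[of M] I(2) M.a_subset by blast
    moreover have "\<pi> ` I \<noteq> carrier S" using one_pull[of "\<pi> ` I"] pi I(3) by auto
    ultimately have "\<pi> ` I = M" using M.I_maximal[OF ideal_image[OF I(1)]] surj ideal_sub[OF I(1)]
      by (metis image_mono subsetI)
    then show ?thesis using pi by simp
  qed
  moreover have "1 \<notin> pull M" using one_pull M.one_imp_carrier M.I_notcarr by blast
  ultimately show "maximal_in C (pull M)"
    using ideal_pull(1)[OF M.is_ideal] by (simp add: maximal_in_def)
qed

lemma maximal_image:
  assumes M: "maximal_in C M" "ker \<subseteq> M" shows "maximalideal (\<pi> ` M) S"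
proof (rule maximalidealI)
  have I: "ideal_in C M" using M by (simp add: maximal_in_def)
  show "ideal (\<pi> ` M) S" by (rule ideal_image[OF I])
  show "carrier S \<noteq> \<pi> ` M"
    using M one_pull[of "\<pi> ` M"] pull_image[OF I M(2)] by (auto simp: maximal_in_def)
  fix J assume J: "ideal J S" "\<pi> ` M \<subseteq> J" "J \<subseteq> carrier S"
  have "M \<subseteq> pull J" using pull_mono[OF J(2)] pull_image[OF I M(2)] by simp
  then have "pull J = M \<or> 1 \<in> pull J"
    using M(1) ideal_pull(1)[OF J(1)] unfolding maximal_in_def by blast
  then show "J = \<pi> ` M \<or> J = carrier S"
    using image_pull[OF J(3)] one_pull[of J] ideal.one_imp_carrier[OF J(1)] by auto
qed

lemma prime_chain_pull:
  assumes "\<forall>i\<le>r. primeideal (Q i) S" "\<forall>i<r. Q i \<subset> Q (Suc i)"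
  shows "prime_chain C ker r (pull (Q r))"
  using assms
proof (induction r)
  case 0
  then show ?case using prime_pull[of "Q 0"] ideal_pull(2)[of "Q 0"] by (auto simp: primeideal_def)
next
  case (Suc r)
  have *: "Q r \<subseteq> carrier S" "Q (Suc r) \<subseteq> carrier S"
    using Suc.prems(1) ideal_carrier primeideal.axioms(1) by (metis le_SucI order_refl)+
  have QQ: "Q r \<subset> Q (Suc r)" using Suc.prems(2) by simp
  have "pull (Q r) \<noteq> pull (Q (Suc r))"
    using image_pull[OF *(1)] image_pull[OF *(2)] less_imp_neq[OF QQ] by metis
  moreover have "pull (Q r) \<subseteq> pull (Q (Suc r))" using QQ by (intro pull_mono) blast
  moreover have "prime_chain C ker r (pull (Q r))" using Suc by simp
  moreover have "prime_in C (pull (Q (Suc r)))" using Suc.prems(1) prime_pull by simp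
  ultimately show ?case by auto
qed

lemma prime_chain_image:
  assumes "prime_chain C ker r P"
  shows "\<exists>Q. (\<forall>i\<le>r. primeideal (Q i) S) \<and> (\<forall>i<r. Q i \<subset> Q (Suc i)) \<and> Q r = \<pi> ` P"
  using assms
proof (induction r arbitrary: P)
  case 0
  then show ?case using prime_image[of P] by (intro exI[of _ "\<lambda>_. \<pi> ` P"]) auto
next
  case (Suc r)
  then obtain P0 where P0: "prime_chain C ker r P0" "P0 \<subset> P" and P: "prime_in C P" by auto
  obtain Q where Q: "\<forall>i\<le>r. primeideal (Q i) S" "\<forall>i<r. Q i \<subset> Q (Suc i)" "Q r = \<pi> ` P0"
    using Suc.IH[OF P0(1)] by blast
  have k0: "ker \<subseteq> P0" by (rule prime_chain_incl[OF P0(1)])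
  then have k: "ker \<subseteq> P" using P0(2) by blast
  have "\<pi> ` P0 \<noteq> \<pi> ` P"
    using pull_image[OF prime_ideal[OF P] k]
      pull_image[OF prime_ideal[OF prime_chain_prime[OF P0(1)]] k0] P0(2) by auto
  then have "\<pi> ` P0 \<subset> \<pi> ` P" using P0(2) by blast
  then show ?case using Q prime_image[OF P k]
    by (intro exI[of _ "Q(Suc r := \<pi> ` P)"]) (auto simp: le_Suc_eq less_Suc_eq)
qed

lemma prime_height_eq:
  assumes Q: "primeideal Q S" shows "prime_height S Q = height_over C ker (pull Q)"
proof -
  have "Q \<subseteq> carrier S"
    by (rule ideal_carrier[OF primeideal.axioms(1)[OF Q]])
  then have "(\<exists>Q'. (\<forall>i\<le>r. primeideal (Q' i) S) \<and> (\<forall>i<r. Q' i \<subset> Q' (Suc i)) \<and> Q' r = Q)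
      \<longleftrightarrow> prime_chain C ker r (pull Q)" for r
    using prime_chain_image[of r "pull Q"] prime_chain_pull[of r] image_pull[of Q] by auto
  then show ?thesis by (simp add: prime_height_def height_over_def)
qed

lemma ideal_height_eq:
  assumes J: "J \<subseteq> carrier S"
  shows "ideal_height S J = (INF P\<in>{P. prime_in C P \<and> ker \<subseteq> P \<and> pull J \<subseteq> P}. height_over C ker P)"
proof -
  have "prime_height S ` {P. primeideal P S \<and> J \<subseteq> P} =
      height_over C ker ` {P. prime_in C P \<and> ker \<subseteq> P \<and> pull J \<subseteq> P}"
  proof (intro equalityI image_subsetI)
    fix Q assume Q: "Q \<in> {P. primeideal P S \<and> J \<subseteq> P}"
    then have "prime_in C (pull Q)" "ker \<subseteq> pull Q" "pull J \<subseteq> pull Q"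
      using prime_pull ideal_pull(2) pull_mono by (auto simp: primeideal_def)
    then show "prime_height S Q \<in> height_over C ker ` {P. prime_in C P \<and> ker \<subseteq> P \<and> pull J \<subseteq> P}"
      using prime_height_eq Q by auto
  next
    fix P assume P: "P \<in> {P. prime_in C P \<and> ker \<subseteq> P \<and> pull J \<subseteq> P}"
    then have pr: "primeideal (\<pi> ` P) S" using prime_image by blast
    have "pull (\<pi> ` P) = P" using P by (intro pull_image prime_ideal) auto
    then have "height_over C ker P = prime_height S (\<pi> ` P)" using prime_height_eq[OF pr] by simp
    moreover have "J \<subseteq> \<pi> ` P" using image_pull[OF J] P by blast
    ultimately show "height_over C ker P \<in> prime_height S ` {P. primeideal P S \<and> J \<subseteq> P}"
      using pr by blast
  qed
  then show ?thesis by (simp add: ideal_height_def)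
qed

lemma ideal_height_maximal:
  assumes M: "maximalideal M S" shows "ideal_height S M = height_over C ker (pull M)"
proof -
  interpret M: maximalideal M S by (rule M)
  have sub: "M \<subseteq> carrier S" by (rule M.a_subset)
  have max: "maximal_in C (pull M)" "ker \<subseteq> pull M" using maximal_pull[OF M] by auto
  have "{P. prime_in C P \<and> ker \<subseteq> P \<and> pull M \<subseteq> P} = {pull M}"
    using max maximal_prime[OF max(1)] prime_ideal prime_one unfolding maximal_in_def by blast
  then show ?thesis using ideal_height_eq[OF sub] by simp
qed

lemma noetherian_ring_image:
  assumes "noetherian C" shows "noetherian_ring S"
proof (rule S.noetherian_ringI)
  fix I assume I: "ideal I S"
  then have Ic: "I \<subseteq> carrier S" by (rule ideal_carrier)
  let ?F = "{pull (genideal S A) | A. finite A \<and> A \<subseteq> I}"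
  have S1: "pull (genideal S {}) \<in> ?F" by blast
  have S2: "ideal_in C J" if "J \<in> ?F" for J
    using that Ic by (auto intro!: ideal_pull(1) S.genideal_ideal)
  obtain M where M: "M \<in> ?F" and max: "\<forall>J\<in>?F. M \<subseteq> J \<longrightarrow> J = M"
    by (rule bexE[OF noetherian_max[OF assms S1 S2]])
  obtain A where A: "finite A" "A \<subseteq> I" "M = pull (genideal S A)" using M by blast
  have AC: "A \<subseteq> carrier S" using A Ic by blast
  have "x \<in> genideal S A" if x: "x \<in> I" for x
  proof -
    have xA: "insert x A \<subseteq> carrier S" using AC x Ic by blast
    have "genideal S A \<subseteq> genideal S (insert x A)"
      using S.genideal_self[OF xA] by (intro S.genideal_minimal S.genideal_ideal xA) auto
    then have "M \<subseteq> pull (genideal S (insert x A))" using A(3) pull_mono by simp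
    moreover have "pull (genideal S (insert x A)) \<in> ?F"
      using A x by (intro CollectI exI[of _ "insert x A"]) simp
    ultimately have "pull (genideal S (insert x A)) = pull (genideal S A)" using max A(3) by simp
    moreover have "x \<in> \<pi> ` C" using Ic x unfolding surj by blast
    then obtain c where "c \<in> C" "x = \<pi> c" by (elim imageE)
    moreover have "x \<in> genideal S (insert x A)" using S.genideal_self[OF xA] by blast
    ultimately show ?thesis by (auto simp: pull_def)
  qed
  then have "I = genideal S A" using S.genideal_minimal[OF I A(2)] by blast
  then show "\<exists>A\<subseteq>carrier S. finite A \<and> I = genideal S A" using A AC by blast
qed

lemma foldl_plus_gen:
  assumes "ideal_in C K" "set bs \<subseteq> C"
  shows "ideal_in C (foldl (plus_gen C) K bs)" "K \<subseteq> foldl (plus_gen C) K bs" "set bs \<subseteq> foldl (plus_gen C) K bs"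
    "ideal_in C I \<Longrightarrow> K \<subseteq> I \<Longrightarrow> set bs \<subseteq> I \<Longrightarrow> foldl (plus_gen C) K bs \<subseteq> I"
  using assms
proof (induction bs rule: rev_induct)
  case (snoc b bs)
  { case 1 then show ?case using snoc by (auto intro: ideal_plus_gen) }
  { case 2 then show ?case using snoc plus_gen_incl by (auto; blast) }
  { case 3
    then have "ideal_in C (foldl (plus_gen C) K bs)" "set bs \<subseteq> foldl (plus_gen C) K bs" using snoc by auto
    then show ?case using plus_gen_incl[of "foldl (plus_gen C) K bs" b] plus_gen_self[of "foldl (plus_gen C) K bs" b] by auto }
  { case 4 then show ?case using snoc plus_gen_least[OF 4(1), of "foldl (plus_gen C) K bs" b] by auto }
qed auto

lemma pull_genideal:
  assumes "set bs \<subseteq> C" shows "pull (genideal S (set (map \<pi> bs))) = foldl (plus_gen C) ker bs"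
proof
  note F = foldl_plus_gen[OF ideal_ker assms]
  have sub: "set (map \<pi> bs) \<subseteq> carrier S" using assms by auto
  have id: "ideal (genideal S (set (map \<pi> bs))) S" by (rule S.genideal_ideal[OF sub])
  have "genideal S (set (map \<pi> bs)) \<subseteq> \<pi> ` foldl (plus_gen C) ker bs"
    using F(3) by (intro S.genideal_minimal ideal_image F(1)) auto
  then show "pull (genideal S (set (map \<pi> bs))) \<subseteq> foldl (plus_gen C) ker bs"
    using pull_mono pull_image[OF F(1,2)] by blast
  have "set bs \<subseteq> pull (genideal S (set (map \<pi> bs)))"
    using S.genideal_self[OF sub] assms by (auto simp: pull_def)
  then show "foldl (plus_gen C) ker bs \<subseteq> pull (genideal S (set (map \<pi> bs)))"
    by (intro F(4) ideal_pull[OF id])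
qed

lemma nonzerodivisor_on_quotient_iff:
  assumes J: "ideal J S" and b: "b \<in> C"
  shows "nonzerodivisor_on_quotient S J (\<pi> b) \<longleftrightarrow> nzd_mod C (pull J) b"
proof -
  interpret J: ideal J S by (rule J)
  have car: "carrier (S Quot J) = (\<lambda>c. J +> \<pi> c) ` C"
    unfolding FactRing_def A_RCOSETS_def' surj[symmetric] by auto
  have zero: "\<zero>\<^bsub>S Quot J\<^esub> = J" by (simp add: FactRing_def)
  have mult: "(J +> \<pi> b) \<otimes>\<^bsub>S Quot J\<^esub> (J +> \<pi> c) = J +> \<pi> (b * c)" if "c \<in> C" for c
    using that b by (simp add: FactRing_def J.rcoset_mult_add map_mult)
  have coset: "J +> \<pi> c = J \<longleftrightarrow> c \<in> pull J" if "c \<in> C" for c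
    using that J.a_rcos_const[of "\<pi> c"] J.rcos_const_imp_mem[of "\<pi> c"] by (auto simp: pull_def)
  show ?thesis
    unfolding nonzerodivisor_on_quotient_def nonzerodivisor_def nzd_mod_def car zero
    using b mult coset mult_in by auto
qed

lemma has_regseq_iff_list:
  assumes "m \<subseteq> C"
  shows "has_regseq m j K \<longleftrightarrow> (\<exists>bs. length bs = j \<and> set bs \<subseteq> m \<and> (\<forall>i<j. nzd_mod C (foldl (plus_gen C) K (take i bs)) (bs ! i)))"
proof (induction j arbitrary: K)
  case 0
  then show ?case by simp
next
  case (Suc j)
  show ?case
  proof
    assume "has_regseq m (Suc j) K"
    then obtain b where b: "b \<in> m" "nzd_mod C K b" "has_regseq m j (plus_gen C K b)" by auto
    then obtain bs where bs: "length bs = j" "set bs \<subseteq> m"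
      "\<forall>i<j. nzd_mod C (foldl (plus_gen C) (plus_gen C K b) (take i bs)) (bs ! i)" using Suc by blast
    have "nzd_mod C (foldl (plus_gen C) K (take i (b # bs))) ((b # bs) ! i)" if "i < Suc j" for i
      using that bs b by (cases i) auto
    then show "\<exists>bs. length bs = Suc j \<and> set bs \<subseteq> m \<and>
        (\<forall>i<Suc j. nzd_mod C (foldl (plus_gen C) K (take i bs)) (bs ! i))"
      using bs b by (intro exI[of _ "b # bs"]) auto
  next
    assume "\<exists>bs. length bs = Suc j \<and> set bs \<subseteq> m \<and>
        (\<forall>i<Suc j. nzd_mod C (foldl (plus_gen C) K (take i bs)) (bs ! i))"
    then obtain cs where cs: "length cs = Suc j" "set cs \<subseteq> m"
      "\<forall>i<Suc j. nzd_mod C (foldl (plus_gen C) K (take i cs)) (cs ! i)" by blast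
    then obtain b bs where b: "cs = b # bs" by (cases cs) auto
    have "nzd_mod C K b" using cs(3) b by force
    moreover have "\<forall>i<j. nzd_mod C (foldl (plus_gen C) (plus_gen C K b) (take i bs)) (bs ! i)"
      using cs(3) b by force
    ultimately show "has_regseq m (Suc j) K" using cs b Suc[of "plus_gen C K b"] by auto
  qed
qed

text \<open>
  Regular sequences only depend on classes modulo the kernel, so they may be lifted one member at a
  time.
\<close>

lemma ideal_depth_eq:
  assumes Q: "ideal Q S" "Q \<noteq> carrier S" shows "ideal_depth S Q = depth_over ker (pull Q)"
proof -
  interpret Q: ideal Q S by (rule Q(1))
  have Qc: "Q \<subseteq> carrier S" by (rule Q.a_subset)
  have key: "(\<exists>as. length as = j \<and> regular_sequence S as \<and> set as \<subseteq> Q) \<longleftrightarrow> has_regseq (pull Q) j ker" for j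
  proof -
    have "regular_sequence S (map \<pi> bs) \<longleftrightarrow>
        (\<forall>i<length bs. nzd_mod C (foldl (plus_gen C) ker (take i bs)) (bs ! i))" if bs: "set bs \<subseteq> pull Q" for bs
    proof -
      have bsC: "set bs \<subseteq> C" using bs by (auto simp: pull_def)
      have bsQ: "set (map \<pi> bs) \<subseteq> Q" using bs by (auto simp: pull_def)
      have "genideal S (set (map \<pi> bs)) \<noteq> carrier S"
        using S.genideal_minimal[OF Q(1) bsQ] Q(2) Qc by blast
      moreover have "nonzerodivisor_on_quotient S (genideal S (set (take i (map \<pi> bs)))) (map \<pi> bs ! i) \<longleftrightarrow>
          nzd_mod C (foldl (plus_gen C) ker (take i bs)) (bs ! i)" if i: "i < length bs" for i
      proof -
        have tk: "set (take i bs) \<subseteq> C" using bsC set_take_subset by fast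
        then have "ideal (genideal S (set (map \<pi> (take i bs)))) S"
          by (intro S.genideal_ideal) auto
        moreover have "bs ! i \<in> C" using i bsC by auto
        ultimately show ?thesis
          using nonzerodivisor_on_quotient_iff pull_genideal[OF tk] i by (simp add: take_map)
      qed
      ultimately show ?thesis using bsC by (auto simp: regular_sequence_def)
    qed
    moreover have "\<exists>bs. as = map \<pi> bs \<and> set bs \<subseteq> pull Q" if "set as \<subseteq> Q" for as
    proof -
      have "\<forall>a\<in>set as. \<exists>b. a = \<pi> b \<and> b \<in> pull Q" using that image_pull[OF Qc] by blast
      then have "\<exists>bs. list_all2 (\<lambda>a b. a = \<pi> b \<and> b \<in> pull Q) as bs"
        by (induction as) (auto simp: list_all2_Cons1)
      then obtain bs where "list_all2 (\<lambda>a b. a = \<pi> b \<and> b \<in> pull Q) as bs" by blast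
      then have "as = map \<pi> bs \<and> set bs \<subseteq> pull Q" by (induction rule: list_all2_induct) auto
      then show ?thesis by blast
    qed
    moreover have "set (map \<pi> bs) \<subseteq> Q" if "set bs \<subseteq> pull Q" for bs using that by (auto simp: pull_def)
    moreover have "pull Q \<subseteq> C" by (auto simp: pull_def)
    ultimately show ?thesis unfolding has_regseq_iff_list[OF \<open>pull Q \<subseteq> C\<close>] by (metis length_map)
  qed
  have "{enat (length as) | as. regular_sequence S as \<and> set as \<subseteq> Q} =
      {enat j | j. \<exists>as. length as = j \<and> regular_sequence S as \<and> set as \<subseteq> Q}" by blast
  also have "\<dots> = {enat j | j. has_regseq (pull Q) j ker}" unfolding key ..
  finally have "{enat (length as) | as. regular_sequence S as \<and> set as \<subseteq> Q} =
      {enat j | j. has_regseq (pull Q) j ker}" .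
  then show ?thesis by (simp add: ideal_depth_def depth_over_def)
qed

lemma cohen_macaulay_iff:
  assumes "noetherian C"
  shows "cohen_macaulay S \<longleftrightarrow> (\<forall>M. maximal_in C M \<longrightarrow> ker \<subseteq> M \<longrightarrow> depth_over ker M = height_over C ker M)"
proof
  assume cm: "cohen_macaulay S"
  show "\<forall>M. maximal_in C M \<longrightarrow> ker \<subseteq> M \<longrightarrow> depth_over ker M = height_over C ker M"
  proof (intro allI impI)
    fix M assume M: "maximal_in C M" "ker \<subseteq> M"
    have max: "maximalideal (\<pi> ` M) S" by (rule maximal_image[OF M])
    have "pull (\<pi> ` M) = M" using M by (intro pull_image) (auto simp: maximal_in_def)
    moreover have "ideal_depth S (\<pi> ` M) = ideal_height S (\<pi> ` M)"
      using cm max by (simp add: cohen_macaulay_def)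
    ultimately show "depth_over ker M = height_over C ker M"
      using ideal_height_maximal[OF max] ideal_depth_eq[of "\<pi> ` M"] max
      by (metis maximalideal.I_notcarr maximalideal.axioms(1))
  qed
next
  assume eq: "\<forall>M. maximal_in C M \<longrightarrow> ker \<subseteq> M \<longrightarrow> depth_over ker M = height_over C ker M"
  have "ideal_depth S M = ideal_height S M" if max: "maximalideal M S" for M
    using eq maximal_pull[OF max] ideal_height_maximal[OF max] ideal_depth_eq[of M] max
    by (metis maximalideal.I_notcarr maximalideal.axioms(1))
  then show "cohen_macaulay S"
    using noetherian_ring_image[OF assms] S.is_cring by (simp add: cohen_macaulay_def)
qed

lemma presentation_Quot:
  assumes J: "ideal J S"
  shows "ring_presentation C (S Quot J) (\<lambda>c. J +> \<pi> c)"
    and "{c \<in> C. J +> \<pi> c \<in> {\<zero>\<^bsub>S Quot J\<^esub>}} = pull J"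
proof -
  interpret J: ideal J S by (rule J)
  interpret Q: cring "S Quot J" by (rule J.quotient_is_cring[OF S.is_cring])
  show "ring_presentation C (S Quot J) (\<lambda>c. J +> \<pi> c)"
  proof
    show "(\<lambda>c. J +> \<pi> c) ` C = carrier (S Quot J)"
      unfolding FactRing_def A_RCOSETS_def' surj[symmetric] by auto
    show "J +> \<pi> (a + b) = (J +> \<pi> a) \<oplus>\<^bsub>S Quot J\<^esub> (J +> \<pi> b)" if "a \<in> C" "b \<in> C" for a b
      using that by (simp add: FactRing_def J.a_rcos_sum map_add)
    show "J +> \<pi> (a * b) = (J +> \<pi> a) \<otimes>\<^bsub>S Quot J\<^esub> (J +> \<pi> b)" if "a \<in> C" "b \<in> C" for a b
      using that by (simp add: FactRing_def J.rcoset_mult_add map_mult)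
    show "J +> \<pi> 1 = \<one>\<^bsub>S Quot J\<^esub>" by (simp add: FactRing_def map_one)
  qed
  show "{c \<in> C. J +> \<pi> c \<in> {\<zero>\<^bsub>S Quot J\<^esub>}} = pull J"
  proof -
    have "J +> \<pi> c = J \<longleftrightarrow> \<pi> c \<in> J" if "c \<in> C" for c
      using that J.a_rcos_const[of "\<pi> c"] J.rcos_const_imp_mem[of "\<pi> c"] by auto
    then show ?thesis by (simp add: FactRing_def pull_def cong: conj_cong)
  qed
qed

end

section \<open>Heights and depths after adjoining one variable\<close>

lemma enat_Sup_plus_one_le:
  assumes "A \<noteq> {}" "\<And>r. enat r \<in> A \<Longrightarrow> enat (Suc r) \<le> b" "\<infinity> \<notin> A"
  shows "Sup A + 1 \<le> (b :: enat)"
proof (cases b)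
  case (enat n)
  have "Sup A \<le> enat (n - 1) \<and> 0 < n"
  proof
    show "Sup A \<le> enat (n - 1)"
    proof (rule Sup_least)
      fix x assume x: "x \<in> A"
      then obtain r where "x = enat r" using assms(3) by (cases x) auto
      then show "x \<le> enat (n - 1)" using assms(2)[of r] x enat by simp
    qed
    obtain x where x: "x \<in> A" using assms(1) by blast
    then obtain r where "x = enat r" using assms(3) by (cases x) auto
    then show "0 < n" using assms(2)[of r] x enat by simp
  qed
  then have "Sup A + 1 \<le> enat (n - 1) + 1" by (intro add_mono) auto
  also have "\<dots> = enat n" using \<open>_ \<and> 0 < n\<close> by (simp add: one_enat_def)
  finally show ?thesis using enat by simp
qed simp

lemma enat_Inf_in:
  fixes A :: "enat set"
  assumes "A \<noteq> {}" shows "Inf A \<in> A"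
proof -
  obtain x where "x \<in> A" using assms by blast
  then have "(LEAST x. x \<in> A) \<in> A" by (rule LeastI)
  then show ?thesis using assms by (simp add: Inf_enat_def)
qed

lemma le_enat_Sup_imp_ex:
  assumes "enat r \<le> Sup {enat j | j. P j}" "P 0"
  shows "\<exists>j\<ge>r. P j"
proof (rule ccontr)
  assume no: "\<not> ?thesis"
  then have r: "0 < r" using assms(2) by (cases r) auto
  have "Sup {enat j | j. P j} \<le> enat (r - 1)"
  proof (rule Sup_least)
    fix x assume "x \<in> {enat j | j. P j}"
    then obtain j where j: "x = enat j" "P j" by blast
    then have "j < r" using no by (meson not_le)
    then show "x \<le> enat (r - 1)" using j by simp
  qed
  then have "enat r \<le> enat (r - 1)" using assms(1) order_trans by blast
  then show False using r by simp
qed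

context comm_subring begin

lemma prime_chain_weaken: "K \<subseteq> K' \<Longrightarrow> prime_chain C K' r P \<Longrightarrow> prime_chain C K r P"
  by (induction r arbitrary: P) auto

lemma prime_chain_le_height: "prime_chain C K r P \<Longrightarrow> enat r \<le> height_over C K P"
  unfolding height_over_def by (intro Sup_upper) blast

lemma height_over_mono:
  assumes P: "prime_in C P" and "Q \<subseteq> P" shows "height_over C K Q \<le> height_over C K P"
  unfolding height_over_def[of C K Q]
proof (rule Sup_least)
  fix x assume "x \<in> {enat r | r. prime_chain C K r Q}"
  then obtain r where r: "x = enat r" "prime_chain C K r Q" by blast
  show "x \<le> height_over C K P"
  proof (cases "Q = P")
    case True then show ?thesis using r prime_chain_le_height by simp
  next
    case False
    then have "prime_chain C K (Suc r) P" using r P assms(2) by auto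
    then have "enat (Suc r) \<le> height_over C K P" by (rule prime_chain_le_height)
    then show ?thesis using r(1) by (meson enat_ord_simps(1) le_SucI order_refl order_trans)
  qed
qed

lemma height_over_Suc_le:
  assumes Q: "prime_in C Q" "K \<subseteq> Q" and b: "\<And>r. prime_chain C K r Q \<Longrightarrow> enat (Suc r) \<le> b"
  shows "height_over C K Q + 1 \<le> b"
  unfolding height_over_def
proof (rule enat_Sup_plus_one_le)
  have "prime_chain C K 0 Q" using Q by simp
  then show "{enat r | r. prime_chain C K r Q} \<noteq> {}" by blast
qed (use b in auto)

lemma height_over_psubset:
  assumes Q: "prime_in C Q" "K \<subseteq> Q" and P: "prime_in C P" "Q \<subset> P"
  shows "height_over C K Q + 1 \<le> height_over C K P"
proof (rule height_over_Suc_le[OF Q])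
  fix r assume "prime_chain C K r Q"
  then have "prime_chain C K (Suc r) P" using P by auto
  then show "enat (Suc r) \<le> height_over C K P" by (rule prime_chain_le_height)
qed

text \<open>
  Depth is at most height: every regular element adds a step at the bottom of the chain.
\<close>

lemma has_regseq_imp_prime_chain:
  assumes noe: "noetherian C" and M: "prime_in C M"
  shows "ideal_in C K \<Longrightarrow> K \<subseteq> M \<Longrightarrow> has_regseq M j K \<Longrightarrow> prime_chain C K j M"
proof (induction j arbitrary: K)
  case 0
  then show ?case using M by simp
next
  case (Suc j)
  then obtain b where b: "b \<in> M" "nzd_mod C K b" "has_regseq M j (plus_gen C K b)" by auto
  have bC: "b \<in> C" using ideal_sub[OF prime_ideal[OF M] b(1)] .
  have "prime_chain C (plus_gen C K b) j M"
    using Suc.IH[OF ideal_plus_gen[OF Suc.prems(1) bC] plus_gen_least[OF prime_ideal[OF M] Suc.prems(2) b(1)] b(3)] .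
  moreover have "insert b K \<subseteq> plus_gen C K b" using plus_gen_incl plus_gen_self[OF Suc.prems(1)] by simp
  ultimately have "prime_chain C (insert b K) j M" using prime_chain_weaken by blast
  then show ?case by (rule prime_chain_extend_below[OF noe Suc.prems(1) b(2)])
qed

end

context comm_domain begin

interpretation P: comm_subring "polys C" by (rule polys_subring)

lemma polys_strict_mono: "ideal_in C Q \<Longrightarrow> ideal_in C P \<Longrightarrow> Q \<subset> P \<Longrightarrow> polys Q \<subset> polys P"
  using polys_mono[of Q P] contraction_polys by (metis less_le)

lemma prime_chain_polys: "prime_chain C {0} r p \<Longrightarrow> prime_chain (polys C) {0} r (polys p)"
proof (induction r arbitrary: p)
  case 0
  then show ?case using polys_prime P.ideal_zero[OF P.prime_ideal] by auto
next
  case (Suc r)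
  then obtain q where q: "prime_chain C {0} r q" "q \<subset> p" and p: "prime_in C p" by auto
  have "polys q \<subset> polys p"
    using polys_strict_mono[OF prime_ideal[OF prime_chain_prime[OF q(1)]] prime_ideal[OF p] q(2)] .
  then show ?case using Suc.IH[OF q(1)] polys_prime[OF p] by auto
qed

lemma height_contraction_le:
  assumes M: "prime_in (polys C) M"
  shows "height_over C {0} (contraction M) \<le> height_over (polys C) {0} M"
proof -
  have "height_over C {0} (contraction M) \<le> height_over (polys C) {0} (polys (contraction M))"
    unfolding height_over_def by (rule Sup_mono) (auto intro!: prime_chain_polys)
  also have "\<dots> \<le> height_over (polys C) {0} M"
    by (rule P.height_over_mono[OF M polys_contraction_sub[OF P.prime_ideal[OF M]]])
  finally show ?thesis .
qed

lemma height_contraction_var: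
  assumes M: "prime_in (polys C) M" and y: "[:0, 1:] \<in> M"
  shows "height_over C {0} (contraction M) + 1 \<le> height_over (polys C) {0} M"
proof (rule height_over_Suc_le)
  have p: "prime_in C (contraction M)" by (rule contraction_prime[OF M])
  show "prime_in C (contraction M)" by (rule p)
  show "{0} \<subseteq> contraction M" using ideal_zero[OF prime_ideal[OF p]] by simp
  fix r assume "prime_chain C {0} r (contraction M)"
  then have "prime_chain (polys C) {0} r (polys (contraction M))" by (rule prime_chain_polys)
  moreover have "polys (contraction M) \<subset> M"
    using polys_contraction_sub[OF P.prime_ideal[OF M]] y prime_one[OF p] polysD[of "[:0, 1:]" "contraction M" 1] by auto
  ultimately have "prime_chain (polys C) {0} (Suc r) M" using M by auto
  then show "enat (Suc r) \<le> height_over (polys C) {0} M" by (rule P.prime_chain_le_height)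
qed

text \<open>
  The prime \<open>(q, y)\<close>.
\<close>

definition origin_over :: "'r set \<Rightarrow> 'r poly set" where
  "origin_over q = {f \<in> polys C. coeff f 0 \<in> q}"

lemma prime_origin_over:
  assumes q: "prime_in C q" shows "prime_in (polys C) (origin_over q)"
  unfolding prime_in_def ideal_in_def
proof (intro conjI ballI impI)
  have I: "ideal_in C q" by (rule prime_ideal[OF q])
  show "origin_over q \<subseteq> polys C" by (auto simp: origin_over_def)
  show "0 \<in> origin_over q" using P.zero_in ideal_zero[OF I] by (simp add: origin_over_def)
  show "a + b \<in> origin_over q" if "a \<in> origin_over q" "b \<in> origin_over q" for a b
    using that P.add_in ideal_add[OF I] by (auto simp: origin_over_def)
  show "c * a \<in> origin_over q" if "c \<in> polys C" "a \<in> origin_over q" for c a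
    using that P.mult_in ideal_mult[OF I polysD] by (auto simp: origin_over_def coeff_mult)
  show "1 \<notin> origin_over q" using prime_one[OF q] by (simp add: origin_over_def)
  show "a \<in> origin_over q \<or> b \<in> origin_over q"
    if "a \<in> polys C" "b \<in> polys C" "a * b \<in> origin_over q" for a b
    using that prime_cases[OF q polysD polysD] by (auto simp: origin_over_def coeff_mult)
qed

text \<open>
  Slide a chain along \<open>y\<close>, then contract; only the lowest prime is lost.
\<close>

lemma height_origin_over:
  assumes noe: "noetherian C" and q: "prime_in C q"
  shows "height_over (polys C) {0} (origin_over q) \<le> height_over C {0} q + 1"
  unfolding height_over_def[of "polys C"]
proof (rule Sup_least)
  fix x assume "x \<in> {enat r | r. prime_chain (polys C) {0} r (origin_over q)}"
  then obtain r where r: "x = enat r" "prime_chain (polys C) {0} r (origin_over q)" by blast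
  show "x \<le> height_over C {0} q + 1"
  proof (cases r)
    case 0
    then show ?thesis using r(1) by (simp add: zero_enat_def[symmetric])
  next
    case (Suc s)
    have y: "[:0, 1:] \<in> origin_over q" using var_in ideal_zero[OF prime_ideal[OF q]] by (simp add: origin_over_def)
    have "prime_chain (polys C) (insert [:0, 1:] {0}) s (origin_over q)"
      using P.prime_chain_slide[OF hilbert_basis[OF noe] _ y] r(2) Suc by blast
    then have "prime_chain C {0} s (contraction (origin_over q))"
      by (rule prime_chain_contract[rotated 3]) auto
    moreover have "contraction (origin_over q) = q"
      using const_in ideal_sub[OF prime_ideal[OF q]] polysD[of "[:_:]" C 0]
      by (fastforce simp: contraction_def origin_over_def)
    ultimately have "enat s \<le> height_over C {0} q" using prime_chain_le_height by simp
    then have "enat s + 1 \<le> height_over C {0} q + 1" by (rule add_right_mono)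
    then show ?thesis using r(1) Suc by (simp add: one_enat_def)
  qed
qed

text \<open>
  The lower bound splits the primes over \<open>I\<close> and \<open>a y + c\<close> according to whether they contain \<open>y\<close> or
  \<open>a\<close>; the upper bound is the height of \<open>(q, y)\<close>.
\<close>

theorem height_linear_form:
  assumes noe: "noetherian C" and I: "ideal_in C I" and a: "a \<in> C" and c: "c \<in> I"
    and avoid: "\<And>P. minimal_over I P \<Longrightarrow>
      (\<And>Q. minimal_over I Q \<Longrightarrow> height_over C {0} P \<le> height_over C {0} Q) \<Longrightarrow> a \<notin> P"
  shows "(INF P\<in>{P. prime_in (polys C) P \<and> plus_gen (polys C) (polys I) [:c, a:] \<subseteq> P}. height_over (polys C) {0} P)
    = (INF P\<in>{P. prime_in C P \<and> I \<subseteq> P}. height_over C {0} P) + 1"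
    (is "?L = ?h + 1")
proof (rule antisym)
  let ?g = "[:c, a:]"
  have le_h: "?h \<le> height_over C {0} q" if "prime_in C q" "I \<subseteq> q" for q
    using that by (intro INF_lower) simp
  have idI: "ideal_in (polys C) (polys I)" by (rule polys_ideal[OF I])
  show "?h + 1 \<le> ?L"
  proof (rule INF_greatest)
    fix P assume "P \<in> {P. prime_in (polys C) P \<and> plus_gen (polys C) (polys I) ?g \<subseteq> P}"
    then have P: "prime_in (polys C) P" and sub: "plus_gen (polys C) (polys I) ?g \<subseteq> P" by auto
    have idP: "ideal_in (polys C) P" by (rule P.prime_ideal[OF P])
    let ?p = "contraction P"
    have p: "prime_in C ?p" by (rule contraction_prime[OF P])
    have IP: "polys I \<subseteq> P" and gP: "?g \<in> P" using sub P.plus_gen_incl[of "polys I" ?g] P.plus_gen_self[OF idI, of ?g] by auto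
    have Ip: "I \<subseteq> ?p" using IP const_in_polys[OF I] by (auto simp: contraction_def)
    have "[:c:] \<in> P" using Ip c by (auto simp: contraction_def)
    then have "?g - [:c:] \<in> P" using P.ideal_diff[OF idP gP] by blast
    then have "[:a:] * [:0, 1:] \<in> P" by simp
    then have "[:a:] \<in> P \<or> [:0, 1:] \<in> P" using P.prime_cases[OF P const_in[OF a] var_in] by blast
    then show "?h + 1 \<le> height_over (polys C) {0} P"
    proof
      assume "[:0, 1:] \<in> P"
      have "?h + 1 \<le> height_over C {0} ?p + 1" by (rule add_right_mono[OF le_h[OF p Ip]])
      also have "\<dots> \<le> height_over (polys C) {0} P" by (rule height_contraction_var[OF P]) fact
      finally show ?thesis .
    next
      assume "[:a:] \<in> P"
      then have ap: "a \<in> ?p" by (simp add: contraction_def)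
      obtain q where q: "minimal_over I q" "q \<subseteq> ?p" using exists_minimal_over[OF p Ip] by blast
      have qp: "prime_in C q" "I \<subseteq> q" using q(1) by (auto simp: minimal_over_def)
      have q0: "{0} \<subseteq> q" using ideal_zero[OF prime_ideal[OF qp(1)]] by simp
      have "?h + 1 \<le> height_over C {0} ?p"
      proof (cases "\<forall>Q. minimal_over I Q \<longrightarrow> height_over C {0} q \<le> height_over C {0} Q")
        case True
        then have "a \<notin> q" using avoid[OF q(1)] by blast
        then have "q \<subset> ?p" using q(2) ap by blast
        then have "height_over C {0} q + 1 \<le> height_over C {0} ?p" by (rule height_over_psubset[OF qp(1) q0 p])
        moreover have "?h + 1 \<le> height_over C {0} q + 1" by (rule add_right_mono[OF le_h[OF qp]])
        ultimately show ?thesis by (rule order_trans[rotated])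
      next
        case False
        then obtain Q where Q: "minimal_over I Q" "height_over C {0} Q < height_over C {0} q"
          by (auto simp: not_le)
        have "?h \<le> height_over C {0} Q" using Q(1) by (intro le_h) (auto simp: minimal_over_def)
        then have "?h < height_over C {0} q" using Q(2) by (rule order_le_less_trans)
        then have "?h + 1 \<le> height_over C {0} q" by (simp add: plus_1_eSuc ileI1 add.commute)
        also have "\<dots> \<le> height_over C {0} ?p" by (rule height_over_mono[OF p q(2)])
        finally show ?thesis .
      qed
      also have "\<dots> \<le> height_over (polys C) {0} P" by (rule height_contraction_le[OF P])
      finally show ?thesis .
    qed
  qed
  show "?L \<le> ?h + 1"
  proof (cases "{P. prime_in C P \<and> I \<subseteq> P} = {}")
    case True
    then have "?h = \<infinity>" by (simp only: image_empty Inf_empty top_enat_def)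
    then show ?thesis by simp
  next
    case False
    then have "?h \<in> height_over C {0} ` {P. prime_in C P \<and> I \<subseteq> P}"
      by (intro enat_Inf_in) simp
    then obtain q where q: "prime_in C q" "I \<subseteq> q" "?h = height_over C {0} q"
      by (elim imageE CollectE conjE)
    have O: "prime_in (polys C) (origin_over q)" by (rule prime_origin_over[OF q(1)])
    have "polys I \<subseteq> origin_over q" using q(2) ideal_sub[OF I] by (auto simp: origin_over_def polys_def)
    moreover have "?g \<in> polys C" using a c ideal_sub[OF I] zero_in
      by (auto simp: polys_def coeff_pCons split: nat.split)
    then have "?g \<in> origin_over q" using c q(2) by (auto simp: origin_over_def)
    ultimately have "plus_gen (polys C) (polys I) ?g \<subseteq> origin_over q"
      by (intro P.plus_gen_least P.prime_ideal[OF O])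
    then have "?L \<le> height_over (polys C) {0} (origin_over q)" using O by (intro INF_lower) simp
    also have "\<dots> \<le> height_over C {0} q + 1" by (rule height_origin_over[OF noe q(1)])
    finally show ?thesis using q(3) by simp
  qed
qed

text \<open>
  The chain of primes and the regular sequence are both compared with those of \<open>C\<close> modulo \<open>I\<close>: the
  passage to \<open>C[y]\<close> adds one to both lengths, through the monic polynomial \<open>u\<close>, and the passage
  modulo \<open>a y + c\<close> removes it again.
\<close>

theorem depth_eq_height_linear_form:
  assumes noe: "noetherian C" and jac: "jacobson C" and I: "ideal_in C I"
    and a: "a \<in> C" "nzd_mod C I a" and c: "c \<in> C"
    and cm: "\<And>M. maximal_in C M \<Longrightarrow> I \<subseteq> M \<Longrightarrow> depth_over I M = height_over C I M"
    and M: "maximal_in (polys C) M" "plus_gen (polys C) (polys I) [:c, a:] \<subseteq> M"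
  shows "comm_subring.depth_over (polys C) (plus_gen (polys C) (polys I) [:c, a:]) M =
    height_over (polys C) (plus_gen (polys C) (polys I) [:c, a:]) M"
proof -
  let ?g = "[:c, a:]"
  let ?J = "plus_gen (polys C) (polys I) ?g"
  have noeP: "noetherian (polys C)" by (rule hilbert_basis[OF noe])
  have Mp: "prime_in (polys C) M" by (rule P.maximal_prime[OF M(1)])
  have idM: "ideal_in (polys C) M" by (rule P.prime_ideal[OF Mp])
  have idI: "ideal_in (polys C) (polys I)" by (rule polys_ideal[OF I])
  have gC: "?g \<in> polys C" using a(1) c zero_in by (auto simp: polys_def coeff_pCons split: nat.split)
  have idJ: "ideal_in (polys C) ?J" by (rule P.ideal_plus_gen[OF idI gC])
  have gJ: "insert ?g (polys I) \<subseteq> ?J" using P.plus_gen_incl P.plus_gen_self[OF idI] by simp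
  have gn: "nzd_mod (polys C) (polys I) ?g"
    by (rule nzd_mod_top_coeff[OF I gC, of 1])
       (use a ideal_zero[OF I] in \<open>auto simp: coeff_pCons split: nat.split\<close>)
  obtain u where u: "u \<in> M" "lead_coeff u = 1"
    using maximal_polys(2)[OF noe jac M(1)] by blast
  have uC: "u \<in> polys C" using P.ideal_sub[OF idM u(1)] .
  let ?m = "contraction M"
  have m: "maximal_in C ?m" by (rule maximal_polys(1)[OF noe jac M(1)])
  have mC: "?m \<subseteq> C" using ideal_sub m unfolding maximal_in_def by blast
  have Im: "I \<subseteq> ?m" using gJ M(2) const_in_polys[OF I] by (auto simp: contraction_def)
  have upper: "prime_chain (polys C) ?J j M" if "P.has_regseq M j ?J" for j
    using P.has_regseq_imp_prime_chain[OF noeP Mp idJ M(2) that] .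
  have lower: "P.has_regseq M r ?J" if r: "prime_chain (polys C) ?J r M" for r
  proof -
    have "prime_chain (polys C) (insert ?g (polys I)) r M" using P.prime_chain_weaken[OF gJ r] .
    then have "prime_chain (polys C) (polys I) (Suc r) M"
      by (rule P.prime_chain_extend_below[OF noeP idI gn])
    then have "prime_chain (polys C) (insert u (polys I)) r M"
      by (rule P.prime_chain_slide[OF noeP _ u(1)])
    then have "prime_chain C I r ?m"
      by (rule prime_chain_contract[rotated 3]) (use u const_in_polys[OF I] in auto)
    then have "enat r \<le> depth_over I ?m" using prime_chain_le_height cm[OF m Im] by simp
    then obtain j where "j \<ge> r" "has_regseq ?m j I"
      using le_enat_Sup_imp_ex[of r "\<lambda>j. has_regseq ?m j I"] by (auto simp: depth_over_def)
    then have dp: "has_regseq ?m r I" using has_regseq_mono by blast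
    have "P.has_regseq M (Suc r) (polys I)"
      by (rule has_regseq_polys[OF mC _ u(1) uC u(2) I dp]) (auto simp: contraction_def)
    then show ?thesis
      using P.has_regseq_exchange[OF noeP idM idI] gn gJ M(2) by blast
  qed
  have "P.has_regseq M r ?J \<longleftrightarrow> prime_chain (polys C) ?J r M" for r using upper lower by blast
  then show ?thesis by (simp add: P.depth_over_def height_over_def)
qed

end

abbreviation sring :: "'r::comm_ring_1 set \<Rightarrow> 'r ring" where
  "sring C \<equiv> ring_of_type_algebra\<lparr>carrier := C\<rparr>"

lemma sring_simps [simp]:
  "carrier (sring C) = C" "monoid.mult (sring C) = (*)" "monoid.one (sring C) = 1"
  "ring.zero (sring C) = 0" "ring.add (sring C) = (+)"
  by (simp_all add: ring_of_type_algebra_def)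

lemma (in comm_subring) cring_sring: "cring (sring C)"
proof (intro cringI abelian_groupI comm_monoidI)
  fix x assume "x \<in> carrier (sring C)"
  then show "\<exists>y\<in>carrier (sring C). y \<oplus>\<^bsub>sring C\<^esub> x = \<zero>\<^bsub>sring C\<^esub>"
    using uminus_in[of x] by (intro bexI[of _ "- x"]) auto
qed (auto simp: algebra_simps intro: in_C)

lemma (in comm_subring) presentation_sring: "ring_presentation C (sring C) (\<lambda>x. x)"
  by (intro ring_presentation.intro ring_presentation_axioms.intro comm_subring_axioms cring_sring) auto

context comm_subring begin

interpretation T: ring_presentation C "sring C" "\<lambda>x. x" by (rule presentation_sring)

lemma pull_sring: "J \<subseteq> C \<Longrightarrow> T.pull J = J"
  by (auto simp: T.pull_def)

lemma ideal_sring: "ideal J (sring C) \<longleftrightarrow> ideal_in C J"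
  using T.ideal_image[of J] T.ideal_pull(1)[of J] T.ideal_carrier[of J] pull_sring[of J] by auto

lemma prime_sring: "primeideal P (sring C) \<longleftrightarrow> prime_in C P"
proof
  assume P: "primeideal P (sring C)"
  then show "prime_in C P"
    using T.prime_pull[OF P] pull_sring T.ideal_carrier[OF primeideal.axioms(1)[OF P]] by simp
next
  assume P: "prime_in C P"
  then show "primeideal P (sring C)"
    using T.prime_image[OF P] ideal_zero[OF prime_ideal[OF P]] by (auto simp: T.pull_def)
qed

lemma maximal_sring: "maximalideal M (sring C) \<Longrightarrow> maximal_in C M"
  using T.maximal_pull(1)[of M] pull_sring[of M] T.ideal_carrier[OF maximalideal.axioms(1)[of M]] by simp

end

lemma noetherian_image:
  assumes "ring_presentation C (sring D) \<pi>" "comm_subring D" "noetherian C"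
  shows "noetherian D"
  unfolding noetherian_def
proof (intro allI impI)
  interpret ring_presentation C "sring D" \<pi> by (rule assms(1))
  interpret D: comm_subring D by (rule assms(2))
  fix \<F> assume F: "\<F> \<noteq> {}" "\<forall>I\<in>\<F>. ideal_in D I"
  then obtain I0 where I0: "I0 \<in> \<F>" by blast
  have S1: "pull I0 \<in> pull ` \<F>" using I0 by blast
  have S2: "ideal_in C I" if "I \<in> pull ` \<F>" for I
    using that F(2) ideal_pull(1) D.ideal_sring by blast
  obtain M where M: "M \<in> pull ` \<F>" and max: "\<forall>I\<in>pull ` \<F>. M \<subseteq> I \<longrightarrow> I = M"
    by (rule bexE[OF noetherian_max[OF assms(3) S1 S2]])
  obtain I where I: "I \<in> \<F>" "M = pull I" using M by blast
  have "I' = I" if I': "I' \<in> \<F>" "I \<subseteq> I'" for I'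
  proof -
    have "pull I' = pull I" using max I I' pull_mono[OF I'(2)] by blast
    moreover have "I \<subseteq> D" "I' \<subseteq> D" using F(2) I(1) I'(1) D.ideal_sub by blast+
    ultimately show ?thesis using image_pull[of I] image_pull[of I'] by simp
  qed
  then show "\<exists>M\<in>\<F>. \<forall>I\<in>\<F>. M \<subseteq> I \<longrightarrow> I = M" using I(1) by blast
qed

lemma jacobson_image:
  assumes "ring_presentation C (sring D) \<pi>" "comm_subring D" "jacobson C"
  shows "jacobson D"
  unfolding jacobson_def
proof (intro allI impI)
  interpret ring_presentation C "sring D" \<pi> by (rule assms(1))
  interpret D: comm_subring D by (rule assms(2))
  fix P c
  assume P: "prime_in D P" and c: "c \<in> D - P" and above: "\<forall>P'. prime_in D P' \<longrightarrow> P \<subset> P' \<longrightarrow> c \<in> P'"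
  have PS: "primeideal P (sring D)" using P D.prime_sring by simp
  have PD: "P \<subseteq> D" using D.ideal_sub[OF D.prime_ideal[OF P]] by blast
  have imP: "\<pi> ` pull P = P" using image_pull[of P] PD by simp
  have k: "ker \<subseteq> pull P" using ideal_pull(2)[OF primeideal.axioms(1)[OF PS]] .
  have "c \<in> \<pi> ` C" using c surj by simp
  then obtain b where b: "b \<in> C" "c = \<pi> b" by blast
  have "b \<notin> pull P" using c b by (auto simp: pull_def)
  moreover have "b \<in> P'" if P': "prime_in C P'" "pull P \<subset> P'" for P'
  proof -
    have k': "ker \<subseteq> P'" using k P' by blast
    have pi: "pull (\<pi> ` P') = P'" by (rule pull_image[OF prime_ideal[OF P'(1)] k'])
    have "prime_in D (\<pi> ` P')" using prime_image[OF P'(1) k'] D.prime_sring by simp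
    moreover have "P \<subseteq> \<pi> ` P'" using imP P'(2) by blast
    moreover have "P \<noteq> \<pi> ` P'" using pi P'(2) by auto
    ultimately have "c \<in> \<pi> ` P'" using above by blast
    then have "b \<in> pull (\<pi> ` P')" using b by (simp add: pull_def)
    then show ?thesis using pi by simp
  qed
  ultimately have "maximal_in C (pull P)"
    using assms(3) prime_pull[OF PS] b(1) unfolding jacobson_def by blast
  then have "maximalideal P (sring D)" using maximal_image[OF _ k] imP by simp
  then show "maximal_in D P" by (rule D.maximal_sring)
qed

section \<open>Polynomial rings in finitely many variables\<close>

definition mpolys :: "nat \<Rightarrow> 'a::field mpoly set" where
  "mpolys n = {p. vars p \<subseteq> {..<n}}"

lemma mpoly_ring_eq: "mpoly_ring n = sring (mpolys n)"
  by (simp add: mpoly_ring_def mpolys_def)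

lemma mpolys_iff: "p \<in> mpolys n \<longleftrightarrow> (\<forall>t\<in>keys p. keys t \<subseteq> {..<n})"
  by (auto simp: mpolys_def vars_def)

lemma single_in_mpolys: "keys t \<subseteq> {..<n} \<Longrightarrow> single t c \<in> mpolys n"
  by (auto simp: mpolys_iff)

lemma mpolys_subring: "comm_subring (mpolys n)"
proof
  show "1 \<in> mpolys n" by (auto simp: mpolys_iff)
  show "a - b \<in> mpolys n" if "a \<in> mpolys n" "b \<in> mpolys n" for a b :: "'a mpoly"
    using that keys_diff[of a b] by (fastforce simp: mpolys_iff)
  show "a * b \<in> mpolys n" if ab: "a \<in> mpolys n" "b \<in> mpolys n" for a b :: "'a mpoly"
    unfolding mpolys_iff
  proof
    fix t assume "t \<in> keys (a * b)"
    then obtain s u where su: "t = s + u" "s \<in> keys a" "u \<in> keys b"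
      using keys_mult[of a b] by blast
    then show "keys t \<subseteq> {..<n}"
      using Poly_Mapping.keys_add[of s u] ab by (fastforce simp: mpolys_iff)
  qed
qed

lemma mpolys_domain: "comm_domain (mpolys n)"
  by (intro comm_domain.intro mpolys_subring)

lemma Var_power: "Var n ^ k = Mon (single n k)"
  by (induction k) (auto simp: Var_def Mon_def mult_single single_add[symmetric])

lemma poly_mapping_sum_single:
  fixes p :: "'b \<Rightarrow>\<^sub>0 'c::comm_monoid_add"
  shows "p = (\<Sum>t\<in>keys p. single t (lookup p t))"
proof (rule poly_mapping_eqI)
  fix s
  show "lookup p s = lookup
      (\<Sum>t\<in>keys p. single t (lookup p t)) s"
    by (auto simp: lookup_sum lookup_single when_def in_keys_iff)
qed

lemma lookup_mult_single_shift:
  fixes p :: "'a::field mpoly"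
  shows "lookup (p * single u 1) (s + u) = lookup p s"
proof -
  have "p * single u 1 =
      (\<Sum>t\<in>keys p. single (t + u) (lookup p t))"
    by (subst poly_mapping_sum_single[of p]) (simp add: sum_distrib_right mult_single)
  then show ?thesis by (auto simp: lookup_sum lookup_single when_def in_keys_iff)
qed

lemma exponent_split:
  fixes t :: "nat \<Rightarrow>\<^sub>0 nat"
  assumes "keys t \<subseteq> {..<Suc n}"
  obtains s where "keys s \<subseteq> {..<n}" "t = s + single n (lookup t n)"
proof
  let ?k = "lookup t n"
  let ?s = "t - single n ?k"
  show "keys ?s \<subseteq> {..<n}"
  proof
    fix i assume "i \<in> keys ?s"
    then have i: "lookup t i - lookup (single n ?k) i \<noteq> 0"
      by (simp add: in_keys_iff lookup_minus)
    then have "i \<noteq> n" by auto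
    moreover have "i \<in> keys t" using i by (simp add: in_keys_iff)
    ultimately show "i \<in> {..<n}" using assms by (auto simp: less_Suc_eq)
  qed
  show "t = ?s + single n ?k"
    by (rule poly_mapping_eqI) (auto simp: lookup_add lookup_minus lookup_single when_def)
qed

lemma eval_in_mpolys:
  assumes "G \<in> polys (mpolys n)" shows "poly G (Var n) \<in> mpolys (Suc n)"
proof -
  interpret D: comm_subring "mpolys (Suc n)" by (rule mpolys_subring)
  have sub: "mpolys n \<subseteq> mpolys (Suc n)" by (auto simp: mpolys_def)
  have "Var n \<in> mpolys (Suc n)" by (auto simp: Var_def Mon_def mpolys_iff)
  then have "coeff G i * Var n ^ i \<in> mpolys (Suc n)" for i
    using polysD[OF assms] sub D.mult_in D.power_in by blast
  then show ?thesis by (auto simp: poly_altdef intro: D.sum_in)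
qed

lemma single_is_eval:
  assumes "keys t \<subseteq> {..<Suc n}"
  shows "single t c \<in> (\<lambda>G. poly G (Var n)) ` polys (mpolys n)"
proof -
  interpret C: comm_subring "mpolys n" by (rule mpolys_subring)
  let ?k = "lookup t n"
  obtain s where s: "keys s \<subseteq> {..<n}" and t: "t = s + single n ?k"
    using exponent_split[OF assms] .
  have "single t c = single s c * Mon (single n ?k)"
    unfolding Mon_def mult_single t[symmetric] by simp
  then have "single t c = poly (monom (single s c) ?k) (Var n)"
    by (simp add: poly_monom Var_power)
  then show ?thesis using C.monom_in[OF single_in_mpolys[OF s]] by (rule image_eqI)
qed

lemma eval_surj: "(\<lambda>G. poly G (Var n)) ` polys (mpolys n) = (mpolys (Suc n) :: 'a::field mpoly set)"
proof (intro equalityI subsetI)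
  show "p \<in> mpolys (Suc n)" if "p \<in> (\<lambda>G. poly G (Var n)) ` polys (mpolys n)" for p :: "'a mpoly"
    using that eval_in_mpolys by blast
  interpret C: comm_subring "mpolys n" by (rule mpolys_subring)
  interpret P: comm_subring "polys (mpolys n)" by (rule C.polys_subring)
  fix p :: "'a mpoly" assume p: "p \<in> mpolys (Suc n)"
  have "\<exists>G\<in>polys (mpolys n). single t (lookup p t) = poly G (Var n)"
    if t: "t \<in> keys p" for t
  proof -
    have "keys t \<subseteq> {..<Suc n}" using p t unfolding mpolys_iff by blast
    from single_is_eval[OF this] show ?thesis by blast
  qed
  then obtain G where G: "\<And>t. t \<in> keys p \<Longrightarrow> G t \<in> polys (mpolys n)"
    "\<And>t. t \<in> keys p \<Longrightarrow> single t (lookup p t) = poly (G t) (Var n)"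
    by metis
  have "p = (\<Sum>t\<in>keys p. poly (G t) (Var n))"
    by (subst poly_mapping_sum_single) (rule sum.cong, auto simp: G)
  then have "p = poly (\<Sum>t\<in>keys p. G t) (Var n)" by (simp add: poly_sum)
  moreover have "(\<Sum>t\<in>keys p. G t) \<in> polys (mpolys n)" using G by (intro P.sum_in)
  ultimately show "p \<in> (\<lambda>G. poly G (Var n)) ` polys (mpolys n)" by blast
qed

text \<open>
  The exponents of the summands \<open>coeff G i * Var n ^ i\<close> for different \<open>i\<close> differ at \<open>n\<close>, so there is
  no cancellation between them.
\<close>

lemma lookup_eval:
  fixes G :: "'a::field mpoly poly"
  assumes G: "G \<in> polys (mpolys n)" and s: "n \<notin> keys s"
  shows "lookup (poly G (Var n)) (s + single n i) =
    lookup (coeff G i) s"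
proof -
  let ?t = "s + single n i"
  let ?M = "\<lambda>j. coeff G j * Var n ^ j"
  have other: "lookup (?M j) ?t = 0" if "j \<noteq> i" for j
  proof (rule ccontr)
    assume "\<not> ?thesis"
    then have "?t \<in> keys (?M j)" by (simp add: in_keys_iff)
    then obtain u where u: "?t = u + single n j" "u \<in> keys (coeff G j)"
      using keys_mult[of "coeff G j" "Var n ^ j"] by (auto simp: Var_power Mon_def)
    have "n \<notin> keys u" using polysD[OF G, of j] u(2) by (auto simp: mpolys_iff)
    then have "lookup (u + single n j) n = j" by (simp add: lookup_add in_keys_iff)
    moreover have "lookup ?t n = i" using s by (simp add: lookup_add in_keys_iff)
    ultimately show False using that u(1) by simp
  qed
  have same: "lookup (?M i) ?t = lookup (coeff G i) s"
    by (simp add: Var_power Mon_def lookup_mult_single_shift)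
  have "lookup (poly G (Var n)) ?t = (\<Sum>j\<le>degree G. lookup (?M j) ?t)"
    by (simp add: poly_altdef lookup_sum)
  also have "\<dots> = (\<Sum>j\<le>degree G. if j = i then lookup (coeff G i) s else 0)"
    using other same by (intro sum.cong) auto
  also have "\<dots> = lookup (coeff G i) s"
    using coeff_eq_0[of G i] by (auto simp: not_le)
  finally show ?thesis .
qed

lemma eval_inj:
  fixes G :: "'a::field mpoly poly"
  assumes G: "G \<in> polys (mpolys n)" and "poly G (Var n) = 0" shows "G = 0"
proof (intro poly_eqI poly_mapping_eqI)
  fix i s
  show "lookup (coeff G i) s = lookup (coeff 0 i) s"
  proof (cases "n \<in> keys s")
    case True
    then have "s \<notin> keys (coeff G i)"
      using polysD[OF G, of i] unfolding mpolys_iff by blast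
    then show ?thesis by (simp add: in_keys_iff)
  next
    case False
    then show ?thesis using lookup_eval[OF G, of s i] assms(2) by simp
  qed
qed

lemma eval_presentation:
  "ring_presentation (polys (mpolys n)) (sring (mpolys (Suc n))) (\<lambda>G. poly G (Var n))"
proof -
  interpret C: comm_subring "mpolys n" by (rule mpolys_subring)
  interpret P: comm_subring "polys (mpolys n)" by (rule C.polys_subring)
  interpret D: comm_subring "mpolys (Suc n)" by (rule mpolys_subring)
  show ?thesis
    by (intro ring_presentation.intro ring_presentation_axioms.intro P.comm_subring_axioms D.cring_sring)
       (auto simp: eval_surj)
qed

lemma mpolys_0: "mpolys 0 = range Const"
proof (intro equalityI subsetI)
  fix p :: "'a mpoly" assume "p \<in> mpolys 0"
  then have "keys p \<subseteq> {0}" by (auto simp: mpolys_iff)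
  then have "p = Const (lookup p 0)" unfolding Const_def
    by (intro poly_mapping_eqI) (auto simp: lookup_single when_def in_keys_iff)
  then show "p \<in> range Const" by blast
qed (auto simp: mpolys_iff Const_def split: if_splits)

lemma mpolys_0_ideals:
  assumes I: "ideal_in (mpolys 0) I" "1 \<notin> I" shows "I = {0 :: 'a::field mpoly}"
proof -
  interpret C: comm_subring "mpolys 0" by (rule mpolys_subring)
  have "x = 0" if x: "x \<in> I" for x
  proof (rule ccontr)
    assume "x \<noteq> 0"
    obtain c where c: "x = Const c" using x C.ideal_sub[OF I(1)] mpolys_0 by blast
    have "c \<noteq> 0" using \<open>x \<noteq> 0\<close> c by (auto simp: Const_def)
    then have "Const (inverse c) * x = 1" by (simp add: c Const_def mult_single)
    moreover have "Const (inverse c) \<in> mpolys 0" unfolding mpolys_0 by blast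
    ultimately show False using C.ideal_mult[OF I(1) _ x] I(2) by metis
  qed
  then show ?thesis using C.ideal_zero[OF I(1)] by blast
qed

theorem mpolys_noetherian_jacobson: "noetherian (mpolys n :: 'a::field mpoly set) \<and> jacobson (mpolys n :: 'a mpoly set)"
proof (induction n)
  case 0
  interpret C: comm_subring "mpolys 0 :: 'a mpoly set" by (rule mpolys_subring)
  have "\<exists>M\<in>\<F>. \<forall>I\<in>\<F>. M \<subseteq> I \<longrightarrow> I = M"
    if F: "\<F> \<noteq> {}" "\<forall>I\<in>\<F>. ideal_in (mpolys 0) I" for \<F> :: "'a mpoly set set"
  proof (cases "mpolys 0 \<in> \<F>")
    case True
    then show ?thesis using F(2) C.ideal_sub by (intro bexI[of _ "mpolys 0"]) blast+
  next
    case False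
    have "I = {0}" if "I \<in> \<F>" for I
    proof (rule mpolys_0_ideals)
      show "ideal_in (mpolys 0) I" using F(2) that by blast
      then show "1 \<notin> I" using C.ideal_one False that by blast
    qed
    then show ?thesis using F(1) by (metis ex_in_conv)
  qed
  then have "noetherian (mpolys 0 :: 'a mpoly set)" by (simp add: noetherian_def)
  moreover have "maximal_in (mpolys 0) P" if "prime_in (mpolys 0) P" for P :: "'a mpoly set"
    using that mpolys_0_ideals unfolding maximal_in_def prime_in_def by metis
  then have "jacobson (mpolys 0 :: 'a mpoly set)" by (simp add: jacobson_def)
  ultimately show ?case ..
next
  case (Suc n)
  interpret C: comm_domain "mpolys n :: 'a mpoly set" by (rule mpolys_domain)
  have "noetherian (polys (mpolys n :: 'a mpoly set))" "jacobson (polys (mpolys n :: 'a mpoly set))"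
    using Suc C.hilbert_basis C.jacobson_polys by auto
  then show ?case
    using noetherian_image[OF eval_presentation mpolys_subring] jacobson_image[OF eval_presentation mpolys_subring]
    by blast
qed

section \<open>Height and Cohen--Macaulayness after adding a linear form\<close>

context
  fixes n :: nat and I :: "'a::field mpoly set" and a c :: "'a mpoly"
  assumes I: "ideal_in (mpolys n) I" and a: "a \<in> mpolys n" and c: "c \<in> I"
begin

interpretation C: comm_domain "mpolys n :: 'a mpoly set" by (rule mpolys_domain)
interpretation P: comm_subring "polys (mpolys n :: 'a mpoly set)" by (rule C.polys_subring)
interpretation E: ring_presentation "polys (mpolys n)" "sring (mpolys (Suc n))" "\<lambda>G. poly G (Var n) :: 'a mpoly"
  by (rule eval_presentation)
interpretation T: ring_presentation "mpolys n" "sring (mpolys n)" "\<lambda>x. x :: 'a mpoly"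
  by (rule C.presentation_sring)
interpretation D: comm_subring "mpolys (Suc n) :: 'a mpoly set" by (rule mpolys_subring)

lemma E_ker: "E.pull {\<zero>\<^bsub>sring (mpolys (Suc n))\<^esub>} = {0}"
  using eval_inj P.zero_in by (auto simp: E.pull_def)

lemma T_ker: "T.pull {\<zero>\<^bsub>sring (mpolys n)\<^esub>} = {0}"
  using C.zero_in by (auto simp: T.pull_def)

lemma lin_in: "[:c, a:] \<in> polys (mpolys n)"
  using a c C.ideal_sub[OF I] C.zero_in by (auto simp: polys_def coeff_pCons split: nat.split)

lemma J_carrier: "I \<union> {a * Var n + c} \<subseteq> mpolys (Suc n)"
proof -
  have "mpolys n \<subseteq> (mpolys (Suc n) :: 'a mpoly set)" by (auto simp: mpolys_def)
  moreover have "poly [:c, a:] (Var n) \<in> mpolys (Suc n)" by (rule eval_in_mpolys[OF lin_in])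
  ultimately show ?thesis using C.ideal_sub[OF I] by (auto simp: algebra_simps)
qed

lemma J_ideal: "ideal (genideal (sring (mpolys (Suc n))) (I \<union> {a * Var n + c})) (sring (mpolys (Suc n)))"
  by (rule E.S.genideal_ideal) (use J_carrier in simp)

lemma pull_J:
  "E.pull (genideal (sring (mpolys (Suc n))) (I \<union> {a * Var n + c})) =
     plus_gen (polys (mpolys n)) (polys I) [:c, a:]" (is "E.pull ?J = ?A")
proof
  have idI: "ideal_in (polys (mpolys n)) (polys I)" by (rule C.polys_ideal[OF I])
  have idA: "ideal_in (polys (mpolys n)) ?A" by (rule P.ideal_plus_gen[OF idI lin_in])
  have self: "I \<union> {a * Var n + c} \<subseteq> ?J" by (rule E.S.genideal_self) (use J_carrier in simp)
  have kA: "E.pull {\<zero>\<^bsub>sring (mpolys (Suc n))\<^esub>} \<subseteq> ?A" unfolding E_ker using P.ideal_zero[OF idA] by simp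
  have idJ: "ideal_in (polys (mpolys n)) (E.pull ?J)" by (rule E.ideal_pull(1)[OF J_ideal])
  have "x \<in> (\<lambda>G. poly G (Var n)) ` ?A" if "x \<in> I" for x
    using C.const_in_polys[OF I that] P.plus_gen_incl[of "polys I" "[:c, a:]"] by (intro image_eqI[of _ _ "[:x:]"]) auto
  moreover have "a * Var n + c \<in> (\<lambda>G. poly G (Var n)) ` ?A"
    using P.plus_gen_self[OF idI, of "[:c, a:]"] by (intro image_eqI[of _ _ "[:c, a:]"]) (auto simp: algebra_simps)
  ultimately have "?J \<subseteq> (\<lambda>G. poly G (Var n)) ` ?A"
    by (intro E.S.genideal_minimal E.ideal_image[OF idA]) auto
  then show "E.pull ?J \<subseteq> ?A" using E.pull_mono E.pull_image[OF idA kA] by blast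
  show "?A \<subseteq> E.pull ?J"
  proof (intro P.plus_gen_least[OF idJ] C.polys_least[OF idJ I])
    show "[:k:] \<in> E.pull ?J" if "k \<in> I" for k
      using that self C.const_in[OF C.ideal_sub[OF I that]] by (auto simp: E.pull_def)
    show "[:c, a:] \<in> E.pull ?J" using self lin_in by (auto simp: E.pull_def algebra_simps)
  qed
qed

lemma height_supplement:
  assumes avoid: "\<forall>P\<in>minimal_primes_min_codim (sring (mpolys n)) I. a \<notin> P"
  shows "ideal_height (sring (mpolys (Suc n))) (genideal (sring (mpolys (Suc n))) (I \<union> {a * Var n + c})) =
    ideal_height (sring (mpolys n)) I + 1"
proof -
  let ?J = "genideal (sring (mpolys (Suc n))) (I \<union> {a * Var n + c})"
  have noe: "noetherian (mpolys n :: 'a mpoly set)" using mpolys_noetherian_jacobson by blast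
  have IC: "I \<subseteq> mpolys n" using C.ideal_sub[OF I] by blast
  have "?J \<subseteq> carrier (sring (mpolys (Suc n)))" by (rule E.ideal_carrier[OF J_ideal])
  then have "ideal_height (sring (mpolys (Suc n))) ?J =
      (INF P\<in>{P. prime_in (polys (mpolys n)) P \<and> {0} \<subseteq> P \<and> plus_gen (polys (mpolys n)) (polys I) [:c, a:] \<subseteq> P}.
        height_over (polys (mpolys n)) {0} P)"
    using E.ideal_height_eq[of ?J] unfolding E_ker pull_J by simp
  also have "{P. prime_in (polys (mpolys n)) P \<and> {0} \<subseteq> P \<and> plus_gen (polys (mpolys n)) (polys I) [:c, a:] \<subseteq> P} =
      {P. prime_in (polys (mpolys n)) P \<and> plus_gen (polys (mpolys n)) (polys I) [:c, a:] \<subseteq> P}"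
    using P.ideal_zero[OF P.prime_ideal] by auto
  also have "(INF P\<in>{P. prime_in (polys (mpolys n)) P \<and> plus_gen (polys (mpolys n)) (polys I) [:c, a:] \<subseteq> P}.
        height_over (polys (mpolys n)) {0} P) =
      (INF P\<in>{P. prime_in (mpolys n) P \<and> I \<subseteq> P}. height_over (mpolys n) {0} P) + 1"
  proof (rule C.height_linear_form[OF noe I a c])
    fix P assume P: "C.minimal_over I P"
      "\<And>Q. C.minimal_over I Q \<Longrightarrow> height_over (mpolys n) {0} P \<le> height_over (mpolys n) {0} Q"
    have min: "Q \<in> minimal_primes (sring (mpolys n)) I \<longleftrightarrow> C.minimal_over I Q" for Q
      by (auto simp: minimal_primes_def C.minimal_over_def C.prime_sring)
    have ht: "prime_height (sring (mpolys n)) Q = height_over (mpolys n) {0} Q" if "C.minimal_over I Q" for Q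
    proof -
      have Q: "prime_in (mpolys n) Q" using that by (simp add: C.minimal_over_def)
      have "Q \<subseteq> mpolys n" using C.ideal_sub[OF C.prime_ideal[OF Q]] by blast
      then show ?thesis using T.prime_height_eq[of Q] Q C.pull_sring[of Q] T_ker by (simp add: C.prime_sring)
    qed
    have "P \<in> minimal_primes_min_codim (sring (mpolys n)) I"
      unfolding minimal_primes_min_codim_def using P min ht by auto
    then show "a \<notin> P" using avoid by blast
  qed
  also have "{P. prime_in (mpolys n) P \<and> I \<subseteq> P} = {P. prime_in (mpolys n) P \<and> {0} \<subseteq> P \<and> I \<subseteq> P}"
    using C.ideal_zero[OF C.prime_ideal] by auto
  also have "(INF P\<in>{P. prime_in (mpolys n) P \<and> {0} \<subseteq> P \<and> I \<subseteq> P}. height_over (mpolys n) {0} P) =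
      ideal_height (sring (mpolys n)) I"
    using T.ideal_height_eq[of I] IC unfolding T_ker C.pull_sring[OF IC] by simp
  finally show ?thesis .
qed

lemma cohen_macaulay_supplement:
  assumes nz: "nonzerodivisor_on_quotient (sring (mpolys n)) I a"
    and cm: "cohen_macaulay (sring (mpolys n) Quot I)"
  shows "cohen_macaulay (sring (mpolys (Suc n)) Quot genideal (sring (mpolys (Suc n))) (I \<union> {a * Var n + c}))"
proof -
  let ?J = "genideal (sring (mpolys (Suc n))) (I \<union> {a * Var n + c})"
  have noe: "noetherian (mpolys n :: 'a mpoly set)" and jac: "jacobson (mpolys n :: 'a mpoly set)"
    using mpolys_noetherian_jacobson by auto
  have noeP: "noetherian (polys (mpolys n :: 'a mpoly set))" by (rule C.hilbert_basis[OF noe])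
  have IC: "I \<subseteq> mpolys n" using C.ideal_sub[OF I] by blast
  have IS: "ideal I (sring (mpolys n))" using I C.ideal_sring by simp
  interpret TQ: ring_presentation "mpolys n" "sring (mpolys n) Quot I" "\<lambda>x. I +>\<^bsub>sring (mpolys n)\<^esub> x"
    by (rule T.presentation_Quot(1)[OF IS])
  interpret EQ: ring_presentation "polys (mpolys n)" "sring (mpolys (Suc n)) Quot ?J"
      "\<lambda>G. ?J +>\<^bsub>sring (mpolys (Suc n))\<^esub> poly G (Var n)"
    by (rule E.presentation_Quot(1)[OF J_ideal])
  have TQk: "TQ.pull {\<zero>\<^bsub>sring (mpolys n) Quot I\<^esub>} = I"
    using T.presentation_Quot(2)[OF IS] C.pull_sring[OF IC] unfolding TQ.pull_def by simp
  have EQk: "EQ.pull {\<zero>\<^bsub>sring (mpolys (Suc n)) Quot ?J\<^esub>} = plus_gen (polys (mpolys n)) (polys I) [:c, a:]"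
    using E.presentation_Quot(2)[OF J_ideal] pull_J unfolding EQ.pull_def by simp
  have nzd_mod: "nzd_mod (mpolys n) I a"
    using nz T.nonzerodivisor_on_quotient_iff[OF IS a] C.pull_sring[OF IC] by simp
  have cC: "c \<in> mpolys n" using c IC by blast
  show ?thesis
    unfolding EQ.cohen_macaulay_iff[OF noeP] EQk
    using C.depth_eq_height_linear_form[OF noe jac I a nzd_mod cC] cm
    unfolding TQ.cohen_macaulay_iff[OF noe] TQk by blast
qed

end

section \<open>Degrees of field extensions and rational maps\<close>

lemma ring_of_type_simps [simp]:
  "carrier ring_of_type_algebra = UNIV" "monoid.mult ring_of_type_algebra = (*)"
  "monoid.one ring_of_type_algebra = 1" "ring.zero ring_of_type_algebra = 0"
  "ring.add ring_of_type_algebra = (+)"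
  by (simp_all add: ring_of_type_algebra_def)

context
  fixes F :: "'f::field ring"
  defines "F \<equiv> ring_of_type_algebra"
begin

interpretation F: field F unfolding F_def by (rule field_from_type_algebra)

lemma F_simps: "carrier F = UNIV" "monoid.mult F = (*)" "monoid.one F = 1" "ring.zero F = 0" "ring.add F = (+)"
  by (simp_all add: F_def)

lemma F_pow: "x [^]\<^bsub>F\<^esub> (k::nat) = x ^ k"
  by (induction k) (auto simp: F.nat_pow_Suc F_simps mult.commute)

lemma F_minus: "\<ominus>\<^bsub>F\<^esub> x = - x"
  by (rule F.minus_equality) (auto simp: F_simps)

lemma subfield_closed:
  assumes E: "subfield E F"
  shows subfield_zero: "0 \<in> E" and subfield_one: "1 \<in> E"
    and subfield_add: "x \<in> E \<Longrightarrow> y \<in> E \<Longrightarrow> x + y \<in> E"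
    and subfield_mult: "x \<in> E \<Longrightarrow> y \<in> E \<Longrightarrow> x * y \<in> E"
    and subfield_uminus: "x \<in> E \<Longrightarrow> - x \<in> E"
    and subfield_inverse: "x \<in> E \<Longrightarrow> inverse x \<in> E"
proof -
  note S = subringE[OF subfieldE(1)[OF E], unfolded F_simps F_minus]
  show zero: "0 \<in> E" and "1 \<in> E" using S by auto
  show "x + y \<in> E" if "x \<in> E" "y \<in> E" using S(7) that .
  show "x * y \<in> E" if "x \<in> E" "y \<in> E" using S(6) that .
  show "- x \<in> E" if "x \<in> E" using S(5) that .
  show "inverse x \<in> E" if "x \<in> E"
  proof (cases "x = 0")
    case False
    then have *: "inv\<^bsub>F\<^esub> x \<in> E" "x * inv\<^bsub>F\<^esub> x = 1"
      using F.subfield_m_inv[OF E, of x] that by (auto simp: F_simps)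
    then have "inverse x = inv\<^bsub>F\<^esub> x" by (metis inverse_unique)
    then show ?thesis using * by simp
  qed (use zero in simp)
qed

lemma subfield_divide: "subfield E F \<Longrightarrow> x \<in> E \<Longrightarrow> y \<in> E \<Longrightarrow> x / y \<in> E"
  by (simp add: divide_inverse subfield_mult subfield_inverse)
lemma subfield_diff: "subfield E F \<Longrightarrow> x \<in> E \<Longrightarrow> y \<in> E \<Longrightarrow> x - y \<in> E"
  using subfield_add[of E x "- y"] subfield_uminus by simp
lemma subfield_power: "subfield E F \<Longrightarrow> x \<in> E \<Longrightarrow> x ^ k \<in> E"
  by (induction k) (auto simp: subfield_one subfield_mult)
lemma subfield_sum: "subfield E F \<Longrightarrow> (\<And>i. i \<in> A \<Longrightarrow> f i \<in> E) \<Longrightarrow> sum f A \<in> E"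
  by (induction A rule: infinite_finite_induct) (auto simp: subfield_zero subfield_add)

lemma eval_list: "F.eval (map u (rev [0..<k])) t = (\<Sum>i<k. u i * t ^ i)"
  by (induction k) (auto simp: F_simps F_pow)

text \<open>
  The minimal polynomial of \<open>t\<close> divides the given one, and \<open>L\<close> is the simple extension \<open>K(t)\<close>.
\<close>

lemma primitive_extension_degree_le:
  assumes K: "subfield K F" and L: "subfield L F" and "K \<subseteq> L" "t \<in> L"
    and least: "\<And>E. subfield E F \<Longrightarrow> K \<subseteq> E \<Longrightarrow> t \<in> E \<Longrightarrow> L \<subseteq> E"
    and u: "\<And>i. i \<le> e \<Longrightarrow> u i \<in> K" "u e \<noteq> 0" and root: "(\<Sum>i\<le>e. u i * t ^ i) = 0"
  shows "extension_degree F K L \<le> enat e"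
proof -
  let ?p = "map u (rev [0..<Suc e])"
  have p: "?p \<in> carrier (univ_poly F K)" "?p \<noteq> []"
    using u by (auto simp: univ_poly_def polynomial_def F_simps)
  have ev: "F.eval ?p t = \<zero>\<^bsub>F\<^esub>"
    unfolding eval_list using root by (simp add: F_simps lessThan_Suc_atMost)
  have t: "t \<in> carrier F" by (simp add: F_simps)
  have alg: "(F.algebraic over K) t"
    unfolding over_def using F.algebraicI[OF p ev] by (simp add: over_def)
  have sub: "subfield (F.simple_extension K t) F"
    using F.simple_extension_is_subfield[OF K t] alg by simp
  have "L = F.simple_extension K t"
  proof
    show "L \<subseteq> F.simple_extension K t"
      using F.simple_extension_incl[OF _ t, of K] F.simple_extension_mem[OF subfieldE(1)[OF K] t]
      by (intro least[OF sub]) (auto simp: F_simps)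
    show "F.simple_extension K t \<subseteq> L"
      using assms(3,4) by (rule F.simple_extension_subring_incl[OF subfieldE(1)[OF L]])
  qed
  then have dim: "F.dimension (length (F.Irr K t) - 1) K L"
    using F.dimension_simple_extension[OF K t alg] by simp
  have "length (F.Irr K t) - 1 \<le> length ?p - 1"
    by (rule F.pdivides_imp_degree_le[OF subfieldE(1)[OF K] F.IrrE(1)[OF K t alg] p
          F.Irr_minimal[OF K t alg p(1) ev]])
  then have "length (F.Irr K t) - 1 \<le> e" by simp
  moreover have "F.dim K L = length (F.Irr K t) - 1"
    using F.dimI[OF K dim] by (simp add: over_def)
  ultimately show ?thesis
    using F.finite_dimensionI[OF dim] by (simp add: extension_degree_def)
qed

end

lemma mpolys_mono: "mpolys n \<subseteq> mpolys (Suc n)"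
  by (auto simp: mpolys_def)

lemma monom_degree_add: "monom_degree (s + t) = monom_degree s + monom_degree t"
  unfolding monom_degree_def using setsum_keys_plus_distrib[of "\<lambda>_ x. x" s t] by simp

lemma monom_degree_single [simp]: "monom_degree (single i k) = k"
  by (simp add: monom_degree_def)

definition is_form :: "nat \<Rightarrow> nat \<Rightarrow> 'a::field mpoly \<Rightarrow> bool" where
  "is_form r d p \<longleftrightarrow> p \<in> mpolys r \<and> homogeneous d p"

lemma is_form_mult:
  fixes p q :: "'a::field mpoly"
  assumes "is_form r d p" "is_form r e q" shows "is_form r (d + e) (p * q)"
proof -
  interpret comm_subring "mpolys r :: 'a mpoly set" by (rule mpolys_subring)
  have "monom_degree t = d + e" if "t \<in> keys (p * q)" for t
    using that keys_mult[of p q] assms by (fastforce simp: is_form_def homogeneous_def monom_degree_add)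
  then show ?thesis using assms mult_in by (simp add: is_form_def homogeneous_def)
qed

lemma is_form_Mon: "keys t \<subseteq> {..<r} \<Longrightarrow> is_form r (monom_degree t) (Mon t)"
  by (auto simp: is_form_def Mon_def mpolys_iff homogeneous_def)

lemma is_form_Var_power:
  assumes "i < r" shows "is_form r k (Var i ^ k)"
proof -
  have "keys (single i k) \<subseteq> {..<r}" using assms by simp
  from is_form_Mon[OF this] show ?thesis by (simp add: Var_power)
qed

lemma to_fract_sum: "to_fract (sum f A) = (\<Sum>i\<in>A. to_fract (f i))"
  by (induction A rule: infinite_finite_induct) auto

lemma to_fract_power: "to_fract (x ^ k) = to_fract x ^ k"
  by (induction k) auto

lemma field_adjoin_alt: "field_adjoin H = generate_field frac_field (to_fract ` (range Const \<union> H))"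
  by (simp add: field_adjoin_def to_fract_def[abs_def])

lemma subfield_field_adjoin: "subfield (field_adjoin H) (frac_field :: 'a::field mpoly fract ring)"
  unfolding field_adjoin_alt by (rule field.generate_field_is_subfield[OF field_from_type_algebra]) simp

lemma field_adjoin_incl: "h \<in> H \<Longrightarrow> to_fract h \<in> field_adjoin H"
  unfolding field_adjoin_alt by (intro generate_field.incl) blast

lemma field_adjoin_Const: "to_fract (Const c) \<in> field_adjoin H"
  unfolding field_adjoin_alt by (intro generate_field.incl) blast

lemma field_adjoin_least:
  assumes "subfield E (frac_field :: 'a::field mpoly fract ring)"
    "\<And>c. to_fract (Const c) \<in> E" "\<And>h. h \<in> H \<Longrightarrow> to_fract h \<in> E"
  shows "field_adjoin H \<subseteq> E"
  unfolding field_adjoin_alt using assms by (intro field.generate_field_min_subfield1[OF field_from_type_algebra]) auto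

lemma form_in_adjoin_monomials:
  assumes "is_form r d p" shows "to_fract p \<in> field_adjoin (monomials r d)"
proof -
  note K = subfield_field_adjoin[of "monomials r d"]
  have "to_fract (single t (lookup p t)) \<in> field_adjoin (monomials r d)"
    if t: "t \<in> keys p" for t
  proof -
    have "single t (lookup p t) = Const (lookup p t) * Mon t"
      by (simp add: Const_def Mon_def mult_single)
    moreover have "Mon t \<in> monomials r d"
      using assms t by (auto simp: monomials_def is_form_def mpolys_iff homogeneous_def)
    ultimately show ?thesis
      using subfield_mult[OF K field_adjoin_Const field_adjoin_incl] by simp
  qed
  then have "(\<Sum>t\<in>keys p. to_fract (single t (lookup p t)))
      \<in> field_adjoin (monomials r d)" by (intro subfield_sum[OF K])
  then show ?thesis by (subst poly_mapping_sum_single[of p]) (simp add: to_fract_sum)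
qed

context
  fixes n d e :: nat and G :: "'a::field mpoly poly" and H :: "'a mpoly set"
  assumes n: "1 \<le> n" and e: "1 \<le> e" "e \<le> d"
    and H: "\<And>h. h \<in> H \<Longrightarrow> is_form n d h"
    and birational: "field_adjoin H = field_adjoin (monomials n d)"
    and G: "G \<in> polys (mpolys n)" "degree G \<le> e" "coeff G e \<noteq> 0"
    and hom: "homogeneous d (poly G (Var n))"
begin

private definition K :: "'a mpoly fract set" where "K = field_adjoin (H \<union> {poly G (Var n)})"
private definition L :: "'a mpoly fract set" where "L = field_adjoin (monomials (Suc n) d)"
private definition x :: "'a mpoly fract" where "x = to_fract (Var 0)"
private definition t :: "'a mpoly fract" where "t = to_fract (Var n) / x"
text \<open>
  The coefficients of \<open>\<Sum> (coeff G i / x\<^sup>d\<^sup>-\<^sup>i) T\<^sup>i - g / x\<^sup>d\<close>, a polynomial in \<open>T\<close> with root \<open>t\<close>.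
\<close>

private definition u :: "nat \<Rightarrow> 'a mpoly fract" where
  "u i = to_fract (coeff G i) / x ^ (d - i) - (if i = 0 then to_fract (poly G (Var n)) / x ^ d else 0)"

private lemma K: "subfield K frac_field" and L: "subfield L frac_field"
  by (simp_all add: K_def L_def subfield_field_adjoin)

private lemma x_nz: "x \<noteq> 0"
proof -
  have "Var 0 \<noteq> (0 :: 'a mpoly)" by (metis Mon_def Var_def lookup_single_eq lookup_zero zero_neq_one)
  then show ?thesis by (simp add: x_def)
qed

private lemma coeff_form: "is_form n (d - i) (coeff G i)" if "i \<le> d"
proof -
  have C: "coeff G i \<in> mpolys n" by (rule polysD[OF G(1)])
  have "monom_degree s = d - i" if s: "s \<in> keys (coeff G i)" for s
  proof -
    have "n \<notin> keys s" using C s by (auto simp: mpolys_iff)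
    then have "s + single n i \<in> keys (poly G (Var n))"
      using lookup_eval[OF G(1), of s i] s by (simp add: in_keys_iff)
    then have "monom_degree (s + single n i) = d" using hom by (simp add: homogeneous_def)
    then show ?thesis by (simp add: monom_degree_add)
  qed
  then show ?thesis using C by (simp add: is_form_def homogeneous_def)
qed

private lemma form_in_K: "is_form n d p \<Longrightarrow> to_fract p \<in> K"
proof -
  assume p: "is_form n d p"
  have "field_adjoin H \<subseteq> K" unfolding K_def
    by (rule field_adjoin_least[OF subfield_field_adjoin field_adjoin_Const]) (simp add: field_adjoin_incl)
  then show "to_fract p \<in> K" using form_in_adjoin_monomials[OF p] birational by blast
qed

private lemma xd_in_K: "x ^ d \<in> K"
  using form_in_K[OF is_form_Var_power[of 0 n d]] n by (simp add: x_def to_fract_power)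

text \<open>
  Multiplying numerator and denominator by a power of \<open>x\<^sub>0\<close> makes both forms of degree \<open>d\<close> in the
  first \<open>n\<close> variables.
\<close>

private lemma dehomogenized_in_K: "is_form n j p \<Longrightarrow> j \<le> d \<Longrightarrow> to_fract p / x ^ j \<in> K"
proof -
  assume p: "is_form n j p" "j \<le> d"
  have "is_form n (j + (d - j)) (p * Var 0 ^ (d - j))"
    by (rule is_form_mult[OF p(1) is_form_Var_power]) (use n in simp)
  then have "to_fract (p * Var 0 ^ (d - j)) \<in> K" using p(2) by (intro form_in_K) simp
  then have "to_fract (p * Var 0 ^ (d - j)) / x ^ d \<in> K" by (rule subfield_divide[OF K _ xd_in_K])
  moreover have "to_fract (p * Var 0 ^ (d - j)) / x ^ d = to_fract p / x ^ j"
    using x_nz power_add[of x j "d - j"] p(2) by (simp add: x_def[symmetric] to_fract_power field_simps)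
  ultimately show ?thesis by simp
qed

private lemma u_in_K: "i \<le> e \<Longrightarrow> u i \<in> K"
proof -
  assume i: "i \<le> e"
  have "to_fract (coeff G i) / x ^ (d - i) \<in> K"
    using coeff_form[of i] i e by (intro dehomogenized_in_K) auto
  moreover have "to_fract (poly G (Var n)) / x ^ d \<in> K"
    by (rule subfield_divide[OF K _ xd_in_K]) (simp add: K_def field_adjoin_incl)
  ultimately show ?thesis using subfield_diff[OF K] subfield_zero[OF K] by (simp add: u_def)
qed

private lemma u_root: "(\<Sum>i\<le>e. u i * t ^ i) = 0"
proof -
  have summand: "to_fract (coeff G i) / x ^ (d - i) * t ^ i =
      to_fract (coeff G i * Var n ^ i) / x ^ d" if "i \<le> e" for i
    using x_nz power_add[of x i "d - i"] that e
    by (simp add: t_def to_fract_power field_simps)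
  have poly: "poly G (Var n) = (\<Sum>i\<le>e. coeff G i * Var n ^ i)"
    unfolding poly_altdef using G(2)
    by (intro sum.mono_neutral_left) (auto intro: le_degree)
  have "(\<Sum>i\<le>e. u i * t ^ i) = (\<Sum>i\<le>e. to_fract (coeff G i) / x ^ (d - i) * t ^ i) -
      (\<Sum>i\<le>e. if i = 0 then to_fract (poly G (Var n)) / x ^ d else 0)"
    unfolding sum_subtractf[symmetric] by (rule sum.cong) (auto simp: u_def left_diff_distrib)
  also have "(\<Sum>i\<le>e. to_fract (coeff G i) / x ^ (d - i) * t ^ i) =
      (\<Sum>i\<le>e. to_fract (coeff G i * Var n ^ i) / x ^ d)"
    using summand by (intro sum.cong) auto
  also have "\<dots> = to_fract (poly G (Var n)) / x ^ d"
    unfolding poly by (simp add: to_fract_sum sum_divide_distrib)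
  finally show ?thesis by simp
qed

private lemma u_top: "u e \<noteq> 0"
  using G(3) x_nz e by (simp add: u_def)

private lemma poly_in_mpolys: "poly G (Var n) \<in> mpolys (Suc n)"
  by (rule eval_in_mpolys[OF G(1)])

private lemma K_sub_L: "K \<subseteq> L"
  unfolding K_def L_def
proof (rule field_adjoin_least[OF subfield_field_adjoin field_adjoin_Const])
  fix h assume "h \<in> H \<union> {poly G (Var n)}"
  then have "is_form (Suc n) d h"
    using H hom poly_in_mpolys mpolys_mono[of n] by (auto simp: is_form_def)
  then show "to_fract h \<in> field_adjoin (monomials (Suc n) d)" by (rule form_in_adjoin_monomials)
qed

private lemma t_in_L: "t \<in> L"
proof -
  have d: "1 + (d - 1) = d" using e by simp
  have "is_form (Suc n) (1 + (d - 1)) (Var n ^ 1 * Var 0 ^ (d - 1))"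
    by (intro is_form_mult is_form_Var_power) auto
  then have "to_fract (Var n ^ 1 * Var 0 ^ (d - 1)) \<in> L"
    unfolding d L_def by (rule form_in_adjoin_monomials)
  moreover have "to_fract (Var n ^ 1 * Var 0 ^ (d - 1)) / x ^ d = t"
    using x_nz power_add[of x 1 "d - 1"] d by (simp add: t_def to_fract_power x_def[symmetric] field_simps)
  ultimately show ?thesis using subfield_divide[OF L] xd_in_K K_sub_L by fastforce
qed

text \<open>
  A monomial of degree \<open>d\<close> is \<open>x\<^sub>0\<^sup>d\<close> times a dehomogenized monomial in the first \<open>n\<close> variables times
  a power of \<open>t\<close>.
\<close>

private lemma L_least:
  assumes E: "subfield E frac_field" and "K \<subseteq> E" "t \<in> E" shows "L \<subseteq> E"
  unfolding L_def
proof (rule field_adjoin_least[OF E])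
  show "to_fract (Const c) \<in> E" for c using field_adjoin_Const assms(2) unfolding K_def by blast
  fix h :: "'a mpoly" assume "h \<in> monomials (Suc n) d"
  then obtain w where w: "h = Mon w" "keys w \<subseteq> {..<Suc n}" "monom_degree w = d"
    by (auto simp: monomials_def)
  let ?k = "lookup w n"
  obtain s where s: "keys s \<subseteq> {..<n}" and ws: "w = s + single n ?k"
    using exponent_split[OF w(2)] .
  have sk: "monom_degree s + ?k = d"
    using w(3) monom_degree_add[of s "single n ?k"] ws by simp
  have "h = Mon s * Var n ^ ?k"
    unfolding w(1) Var_power Mon_def mult_single ws[symmetric] by simp
  then have "to_fract h = to_fract (Mon s) * to_fract (Var n) ^ ?k" by (simp add: to_fract_power)
  then have h: "to_fract h = to_fract (Mon s) / x ^ monom_degree s * t ^ ?k * x ^ d"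
    using x_nz power_add[of x "monom_degree s" ?k] sk by (simp add: t_def field_simps)
  have "to_fract (Mon s) / x ^ monom_degree s \<in> E"
    using dehomogenized_in_K[OF is_form_Mon[OF s]] sk assms(2) by auto
  moreover have "x ^ d \<in> E" using xd_in_K assms(2) by blast
  ultimately show "to_fract h \<in> E"
    unfolding h by (intro subfield_mult[OF E] subfield_power[OF E assms(3)])
qed

lemma topological_degree_le: "topological_degree (Suc n) d (H \<union> {poly G (Var n)}) \<le> enat e"
  unfolding topological_degree_def K_def[symmetric] L_def[symmetric]
  by (rule primitive_extension_degree_le[OF K L K_sub_L t_in_L L_least u_in_K u_top u_root])

lemma birational_if_linear:
  assumes "e = 1" shows "birational_onto_image (Suc n) d (H \<union> {poly G (Var n)})"
proof -
  have "u 0 + u 1 * t = 0" using u_root assms by simp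
  then have "t = - u 0 / u 1" using u_top assms by (simp add: field_simps eq_neg_iff_add_eq_0)
  moreover have "u 0 \<in> K" "u 1 \<in> K" using u_in_K assms by auto
  ultimately have "t \<in> K" using subfield_divide[OF K] subfield_uminus[OF K] by simp
  then have "L \<subseteq> K" by (intro L_least[OF K]) auto
  then show ?thesis using K_sub_L by (simp add: birational_onto_image_def K_def L_def)
qed

end
section \<open>The rational map with one more form\<close>

theorem proposition2p4:
  fixes n m d l :: nat
    and f gc :: "nat \<Rightarrow> 'a::field mpoly"
    and g :: "'a mpoly"
  defines "R \<equiv> mpoly_ring n :: 'a mpoly ring"
    and "Rx \<equiv> mpoly_ring (Suc n) :: 'a mpoly ring"
    and "F \<equiv> f ` {..<m}"
  defines "I \<equiv> genideal R F"
  defines "J \<equiv> genideal Rx (I \<union> {g})"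
  assumes "infinite (UNIV :: 'a set)"
    and "defines_rational_map n d F"
    and "l \<le> d - 1"
    and "\<forall>j\<in>{l..d}. gc j \<in> carrier R"
    and "g = (\<Sum>j=l..d. gc j * Var n ^ (d - j))"
    and "homogeneous d g"
    and "degree_in n g = d - l"
  shows "(birational_onto_image n d F \<longrightarrow>
            topological_degree (Suc n) d (F \<union> {g}) \<le> enat (d - l) \<and>
            (l = d - 1 \<longrightarrow> birational_onto_image (Suc n) d (F \<union> {g}))) \<and>
         (degree_in n g = 1 \<and> gc d \<in> I \<longrightarrow>
            ((\<forall>P\<in>minimal_primes_min_codim R I. gc (d - 1) \<notin> P) \<longrightarrow>
               ideal_height Rx J = ideal_height R I + 1) \<and>
            (nonzerodivisor_on_quotient R I (gc (d - 1)) \<and> cohen_macaulay (R Quot I) \<longrightarrow>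
               cohen_macaulay (Rx Quot J)))"
proof -
  let ?C = "mpolys n :: 'a mpoly set"
  interpret C: comm_subring ?C by (rule mpolys_subring)
  interpret T: ring_presentation ?C "sring ?C" "\<lambda>x. x" by (rule C.presentation_sring)
  have R_eq: "R = sring ?C" and Rx_eq: "Rx = sring (mpolys (Suc n))"
    by (simp_all add: R_def Rx_def mpoly_ring_eq)
  define e where "e = d - l"
  have n: "1 \<le> n" and d: "1 \<le> d" and formF: "\<And>h. h \<in> F \<Longrightarrow> is_form n d h"
    using assms(7) by (auto simp: defines_rational_map_def is_form_def mpoly_ring_eq)
  have e: "1 \<le> e" "e \<le> d" using assms(8) d by (auto simp: e_def)
  have gcC: "gc j \<in> ?C" if "l \<le> j" "j \<le> d" for j using assms(9) that by (simp add: R_eq)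
  \<comment> \<open>\<open>g\<close> as a polynomial over \<open>R\<close>, indexed by the exponent of \<open>x\<^sub>n\<close>\<close>
  define G where "G = (\<Sum>i\<le>e. monom (gc (d - i)) i)"
  interpret P: comm_subring "polys ?C" by (rule C.polys_subring)
  have GC: "G \<in> polys ?C" unfolding G_def using gcC e by (intro P.sum_in C.monom_in) (auto simp: e_def)
  have coeffG: "coeff G i = (if i \<le> e then gc (d - i) else 0)" for i
    by (simp add: G_def coeff_sum)
  have degG: "degree G \<le> e" unfolding G_def
    by (intro degree_sum_le) (auto intro: order_trans[OF degree_monom_le])
  have gG: "g = poly G (Var n)"
  proof -
    have "g = (\<Sum>i\<le>e. gc (d - i) * Var n ^ i)" unfolding assms(10)
      by (rule sum.reindex_bij_witness[of _ "\<lambda>i. d - i" "\<lambda>j. d - j"]) (use e in \<open>auto simp: e_def\<close>)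
    then show ?thesis by (simp add: G_def poly_sum poly_monom)
  qed
  have topG: "coeff G e \<noteq> 0"
  proof -
    have "Max (insert 0 ((\<lambda>t. lookup t n) ` keys g)) = e"
      using assms(12) by (simp add: degree_in_def e_def)
    then have "e \<in> insert 0 ((\<lambda>t. lookup t n) ` keys g)"
      using Max_in[of "insert 0 ((\<lambda>t. lookup t n) ` keys g)"] by simp
    then obtain t where t: "t \<in> keys g" "lookup t n = e" using e by auto
    have "g \<in> mpolys (Suc n)" unfolding gG by (rule eval_in_mpolys[OF GC])
    then have "keys t \<subseteq> {..<Suc n}" using t by (auto simp: mpolys_iff)
    then obtain s where s: "keys s \<subseteq> {..<n}" "t = s + single n (lookup t n)"
      by (rule exponent_split)
    have "n \<notin> keys s" using s(1) by auto
    then have "lookup (coeff G e) s = lookup g t"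
      using lookup_eval[OF GC, of s e] s(2) t(2) gG by simp
    also have "\<dots> \<noteq> 0" using t(1) by (simp add: in_keys_iff)
    finally show ?thesis by auto
  qed
  have part0: "topological_degree (Suc n) d (F \<union> {g}) \<le> enat (d - l) \<and>
      (l = d - 1 \<longrightarrow> birational_onto_image (Suc n) d (F \<union> {g}))"
    if "birational_onto_image n d F"
  proof -
    have bir: "field_adjoin F = field_adjoin (monomials n d)" using that by (simp add: birational_onto_image_def)
    have hom: "homogeneous d (poly G (Var n))" using assms(11) gG by simp
    note ctx = n e formF bir GC degG topG hom
    have "topological_degree (Suc n) d (F \<union> {g}) \<le> enat e"
      unfolding gG by (rule topological_degree_le[OF ctx])
    moreover have "birational_onto_image (Suc n) d (F \<union> {g})" if "l = d - 1"
    proof -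
      have "e = 1" using that d e_def by arith
      show ?thesis unfolding gG
        by (rule birational_if_linear[OF ctx]) (assumption, rule \<open>e = 1\<close>)
    qed
    ultimately show ?thesis by (simp add: e_def)
  qed
  have FC: "F \<subseteq> ?C" using formF by (auto simp: is_form_def)
  have idI: "ideal_in ?C I"
    using T.S.genideal_ideal[of F] FC unfolding I_def R_eq by (simp add: C.ideal_sring)
  have supplement: "((\<forall>P\<in>minimal_primes_min_codim R I. gc (d - 1) \<notin> P) \<longrightarrow>
               ideal_height Rx J = ideal_height R I + 1) \<and>
            (nonzerodivisor_on_quotient R I (gc (d - 1)) \<and> cohen_macaulay (R Quot I) \<longrightarrow>
               cohen_macaulay (Rx Quot J))"
    if lin: "degree_in n g = 1" "gc d \<in> I"
  proof -
    have l: "e = 1" "l = d - 1" using lin(1) assms(8,12) d by (auto simp: e_def)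
    have g: "g = gc (d - 1) * Var n + gc d"
      unfolding gG G_def using l(1) by (simp add: poly_monom algebra_simps)
    have a: "gc (d - 1) \<in> ?C" using gcC l(2) by simp
    have J: "J = genideal Rx (I \<union> {gc (d - 1) * Var n + gc d})" unfolding J_def g ..
    show ?thesis
      unfolding J R_eq Rx_eq
      using height_supplement[OF idI a lin(2)] cohen_macaulay_supplement[OF idI a lin(2)] by blast
  qed
  show ?thesis using part0 supplement by blast
qed

end
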